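(* (a) Let $m,\ell$ be positive integers and let $G=G(m,\ell)$ be the circular Garside group with its Garside structure. Then for every rigid $x\in G$ the sequence $(|SC(x^n)|)_{n\geqslant 1}$ is constant (periodic with period $1$). Moreover, for every $y\in G$ which is conjugate to a rigid element and which has a rigid power, $r(y)\leqslant \frac{m}{\gcd(m,\ell)}$, where $r(y)$ is the smallest positive integer such that $y^{r(y)}$ is rigid. (b) Let $\mathcal B_4^*$ be the four-strand braid group with its dual (Birman–Ko–Lee) Garside structure. Then for every rigid $x\in\mathcal B_4^*$ the sequence $(|SC(x^n)|)_{n\geqslant 1}$ is periodic, with period an element of $\{1,2,\ldots,\operatorname{lcm}(1,2,\ldots,27)\}$.
   Context: A Garside structure on a group $G$ consists of a submonoid $G^+\subset G$ with $G^+\cap (G^+)^{-1}=\{1\}$ and an element $\Delta\in G^+$ (the Garside element) such that: $G^+$ generates $G$ and is atomic (for every $g\in G^+$ the lengths of decompositions of $g$ into nontrivial elements of $G^+$ are bounded); the prefix order $a\preccurlyeq b \Leftrightarrow a^{-1}b\in G^+$ is a lattice order on $G$ (meet $\wedge$, join $\vee$); conjugation by $\Delta$ preserves $G^+$; and the set of simple elements $\{s: 1\preccurlyeq s\preccurlyeq \Delta\}$ is finite and generates $G^+$. Write $\tau(x)=\Delta^{-1}x\Delta$ and, for $s$ simple, $\partial s=s^{-1}\Delta$. A product $s\cdot t$ of two simple elements is left-weighted if $t\wedge\partial s=1$. Every $x\in G$ has a unique normal form $x=\Delta^p x_1\cdots x_r$ with $p\in\mathbb Z$, each $x_i$ simple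 and different from $1,\Delta$, and each $x_i\cdot x_{i+1}$ left-weighted. If $r>0$, put $\iota(x)=\tau^{-p}(x_1)$ and $\varphi(x)=x_r$. The element $x$ is rigid if it is a power of $\Delta$ or if $\varphi(x)\cdot\iota(x)$ is left-weighted. A rigid power of $y$ means a rigid element $y^k$ with $k\geqslant 1$. If $x$ is conjugate to a rigid element, $SC(x)$ denotes the (finite) set of all rigid conjugates of $x$. A sequence $(a_n)_{n\geqslant1}$ is periodic of period $r$ if $a_{n+r}=a_n$ for all $n\geqslant 1$. Circular groups: for positive integers $m,\ell$, take letters $a_0,\ldots,a_{m-1}$ with indices in $\mathbb Z/m\mathbb Z$, and set $s(i,p)=a_ia_{i+1}\cdots a_{i+p-1}$ for $p\geqslant 1$. The circular monoid is $M(m,\ell)=\langle a_0,\ldots,a_{m-1}\mid s(i,\ell)=s(i+1,\ell),\ 0\leqslant i\leqslant m-1\rangle^+$; it is the positive monoid of a Garside structure with Garside element $\Delta=s(0,\ell)$ on its group of fractions $G(m,\ell)$. Dual structure on the 4-strand braid group: $\mathcal B_4^*$ is generated by atoms $a_{ts}$, $4\geqslant t>s\geqslant 1$, with relations $a_{ts}a_{rq}=a_{rq}a_{ts}$ if $(t-r)(t-q)(s-r)(s-q)>0$, and $a_{ts}a_{sr}=a_{tr}a_{ts}=a_{sr}a_{tr}$ for $t>s>r$. The positive monoid is the monoid with this same presentation, and the Garside element is $\delta=a_{43}a_{32}a_{21}$. *)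

theory Defs
  imports "HOL-Algebra.Group"
begin

inductive_set word_cong :: "'a set \<Rightarrow> ('a list \<times> 'a list) set \<Rightarrow> ('a list \<times> 'a list) set"
  for A R where
  refl: "u \<in> lists A \<Longrightarrow> (u, u) \<in> word_cong A R"
| rel: "\<lbrakk>(u, v) \<in> R; u \<in> lists A; v \<in> lists A; p \<in> lists A; q \<in> lists A\<rbrakk>
        \<Longrightarrow> (p @ u @ q, p @ v @ q) \<in> word_cong A R"
| sym: "(u, v) \<in> word_cong A R \<Longrightarrow> (v, u) \<in> word_cong A R"
| trans: "\<lbrakk>(u, v) \<in> word_cong A R; (v, w) \<in> word_cong A R\<rbrakk> \<Longrightarrow> (u, w) \<in> word_cong A R"

text \<open>In a group word the letter \<open>(a, True)\<close> is the generator \<open>a\<close>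
  and \<open>(a, False)\<close> is its formal inverse.\<close>

definition pos_word :: "'a list \<Rightarrow> ('a \<times> bool) list" where
  "pos_word w = map (\<lambda>a. (a, True)) w"

definition group_cong ::
    "'a set \<Rightarrow> ('a list \<times> 'a list) set \<Rightarrow> (('a \<times> bool) list \<times> ('a \<times> bool) list) set" where
  "group_cong A R = word_cong (A \<times> UNIV)
     ({(pos_word u, pos_word v) | u v. (u, v) \<in> R} \<union> {([(a, b), (a, \<not> b)], []) | a b. a \<in> A})"

record 'a garside = "'a monoid" +
  positive :: "'a set"
  garside_elt :: 'a  ("\<Delta>\<index>")

text \<open>The group \<open>\<langle>A | R\<rangle>\<close>, where \<open>R\<close> relates positive words. The positive part is the image of
  the canonical map from the monoid \<open>\<langle>A | R\<rangle>\<^sup>+\<close> to this group. For a Garside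
  monoid this map is injective and the group is the group of fractions. The word \<open>d\<close>
  represents the Garside element.\<close>

definition presented_garside ::
    "'a set \<Rightarrow> ('a list \<times> 'a list) set \<Rightarrow> 'a list \<Rightarrow> ('a \<times> bool) list set garside" where
  "presented_garside A R d =
     \<lparr>carrier = lists (A \<times> UNIV) // group_cong A R,
      monoid.mult = (\<lambda>C D. \<Union>u\<in>C. \<Union>v\<in>D. group_cong A R `` {u @ v}),
      one = group_cong A R `` {[]},
      positive = (\<lambda>w. group_cong A R `` {pos_word w}) ` lists A,
      garside_elt = group_cong A R `` {pos_word d}\<rparr>"

definition prefix_order :: "('a, 'm) garside_scheme \<Rightarrow> 'a gorder" where
  "prefix_order G =
     \<lparr>carrier = carrier G, eq = (=), le = (\<lambda>a b. inv\<^bsub>G\<^esub> a \<otimes>\<^bsub>G\<^esub> b \<in> positive G)\<rparr>"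

definition simples :: "('a, 'm) garside_scheme \<Rightarrow> 'a set" where
  "simples G = {s \<in> carrier G. \<one>\<^bsub>G\<^esub> \<sqsubseteq>\<^bsub>prefix_order G\<^esub> s \<and> s \<sqsubseteq>\<^bsub>prefix_order G\<^esub> \<Delta>\<^bsub>G\<^esub>}"

text \<open>\<open>tau_pow G k\<close> is the \<open>k\<close>-th power of \<open>\<tau>(x) = \<Delta>\<^sup>-\<^sup>1 x \<Delta>\<close>.\<close>

definition tau_pow :: "('a, 'm) garside_scheme \<Rightarrow> int \<Rightarrow> 'a \<Rightarrow> 'a" where
  "tau_pow G k x = \<Delta>\<^bsub>G\<^esub> [^]\<^bsub>G\<^esub> (- k) \<otimes>\<^bsub>G\<^esub> x \<otimes>\<^bsub>G\<^esub> \<Delta>\<^bsub>G\<^esub> [^]\<^bsub>G\<^esub> k"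

definition right_complement :: "('a, 'm) garside_scheme \<Rightarrow> 'a \<Rightarrow> 'a" where
  "right_complement G s = inv\<^bsub>G\<^esub> s \<otimes>\<^bsub>G\<^esub> \<Delta>\<^bsub>G\<^esub>"

definition left_weighted :: "('a, 'm) garside_scheme \<Rightarrow> 'a \<Rightarrow> 'a \<Rightarrow> bool" where
  "left_weighted G s t \<longleftrightarrow> s \<in> simples G \<and> t \<in> simples G \<and>
     t \<sqinter>\<^bsub>prefix_order G\<^esub> right_complement G s = \<one>\<^bsub>G\<^esub>"

definition is_normal_form :: "('a, 'm) garside_scheme \<Rightarrow> 'a \<Rightarrow> int \<times> 'a list \<Rightarrow> bool" where
  "is_normal_form G x = (\<lambda>(p, xs).
     x = \<Delta>\<^bsub>G\<^esub> [^]\<^bsub>G\<^esub> p \<otimes>\<^bsub>G\<^esub> foldr (\<otimes>\<^bsub>G\<^esub>) xs \<one>\<^bsub>G\<^esub> \<and>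
     set xs \<subseteq> simples G - {\<one>\<^bsub>G\<^esub>, \<Delta>\<^bsub>G\<^esub>} \<and>
     (\<forall>i. Suc i < length xs \<longrightarrow> left_weighted G (xs ! i) (xs ! Suc i)))"

definition normal_form :: "('a, 'm) garside_scheme \<Rightarrow> 'a \<Rightarrow> int \<times> 'a list" where
  "normal_form G x = (THE nf. is_normal_form G x nf)"

text \<open>\<open>initial_factor\<close> is \<open>\<iota>\<close> and \<open>final_factor\<close> is \<open>\<phi>\<close>. Both are only meaningful
  when \<open>x\<close> is not a power of \<open>\<Delta>\<close>, that is, when its normal form has at least one simple factor.\<close>

definition initial_factor :: "('a, 'm) garside_scheme \<Rightarrow> 'a \<Rightarrow> 'a" where
  "initial_factor G x = (case normal_form G x of (p, xs) \<Rightarrow> tau_pow G (- p) (hd xs))"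

definition final_factor :: "('a, 'm) garside_scheme \<Rightarrow> 'a \<Rightarrow> 'a" where
  "final_factor G x = last (snd (normal_form G x))"

definition rigid :: "('a, 'm) garside_scheme \<Rightarrow> 'a \<Rightarrow> bool" where
  "rigid G x \<longleftrightarrow> x \<in> carrier G \<and>
     ((\<exists>k::int. x = \<Delta>\<^bsub>G\<^esub> [^]\<^bsub>G\<^esub> k) \<or> left_weighted G (final_factor G x) (initial_factor G x))"

definition conjugate :: "('a, 'm) monoid_scheme \<Rightarrow> 'a \<Rightarrow> 'a \<Rightarrow> bool" where
  "conjugate G x y \<longleftrightarrow> (\<exists>g\<in>carrier G. y = inv\<^bsub>G\<^esub> g \<otimes>\<^bsub>G\<^esub> x \<otimes>\<^bsub>G\<^esub> g)"

definition SC :: "('a, 'm) garside_scheme \<Rightarrow> 'a \<Rightarrow> 'a set" where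
  "SC G x = {y. rigid G y \<and> conjugate G x y}"

definition rigid_exponent :: "('a, 'm) garside_scheme \<Rightarrow> 'a \<Rightarrow> nat" where
  "rigid_exponent G y = (LEAST k. 1 \<le> k \<and> rigid G (y [^]\<^bsub>G\<^esub> k))"

text \<open>Sequences are indexed by the integers \<open>n \<ge> 1\<close>; the value at \<open>0\<close> is ignored.\<close>

definition periodic :: "nat \<Rightarrow> (nat \<Rightarrow> 'b) \<Rightarrow> bool" where
  "periodic r a \<longleftrightarrow> 1 \<le> r \<and> (\<forall>n\<ge>1. a (n + r) = a n)"

definition circular_word :: "nat \<Rightarrow> nat \<Rightarrow> nat \<Rightarrow> nat list" where
  "circular_word m i p = map (\<lambda>j. (i + j) mod m) [0..<p]"

definition circular_group :: "nat \<Rightarrow> nat \<Rightarrow> (nat \<times> bool) list set garside" where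
  "circular_group m l = presented_garside {0..<m}
     {(circular_word m i l, circular_word m (i + 1) l) | i. i < m}
     (circular_word m 0 l)"

text \<open>The pair \<open>(t, s)\<close> stands for the atom \<open>a\<^sub>t\<^sub>s\<close>.\<close>

definition bkl_atoms :: "(int \<times> int) set" where
  "bkl_atoms = {(t, s). 4 \<ge> t \<and> t > s \<and> s \<ge> 1}"

definition bkl_relations :: "((int \<times> int) list \<times> (int \<times> int) list) set" where
  "bkl_relations =
     {([(t, s), (r, q)], [(r, q), (t, s)]) | t s r q.
        (t, s) \<in> bkl_atoms \<and> (r, q) \<in> bkl_atoms \<and> (t - r) * (t - q) * (s - r) * (s - q) > 0} \<union>
     {([(t, s), (s, r)], [(t, r), (t, s)]) | t s r. 4 \<ge> t \<and> t > s \<and> s > r \<and> r \<ge> 1} \<union>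
     {([(t, r), (t, s)], [(s, r), (t, r)]) | t s r. 4 \<ge> t \<and> t > s \<and> s > r \<and> r \<ge> 1}"

definition dual_braid_group_4 :: "((int \<times> int) \<times> bool) list set garside" where
  "dual_braid_group_4 =
     presented_garside bkl_atoms bkl_relations [(4, 3), (3, 2), (2, 1)]"

end

theory Submission imports Defs begin

text \<open>An element \<open>x\<close> that is not a power of \<open>\<Delta>\<close> is rigid iff
  \<open>x \<Delta>\<^sup>-\<^sup>p \<and> x\<^sup>-\<^sup>1 \<Delta>\<^sup>q = 1\<close> for some \<open>p < q\<close>. Hence \<open>c\<^sup>-\<^sup>1 x c\<close> is rigid with the same exponents iff \<open>c\<close>
  lies in \<open>V x = {c. A c \<and> B c = c}\<close>, where \<open>A c = x c \<Delta>\<^sup>-\<^sup>p\<close> and \<open>B c = x\<^sup>-\<^sup>1 c \<Delta>\<^sup>q\<close> are lattice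
  automorphisms. On \<open>V x\<close> the maps \<open>sh c = A c \<and> c \<Delta>\<close> and \<open>co c = B c \<and> c \<Delta>\<close> are injective, their
  composite is translation by \<open>\<Delta>\<close>, and \<open>sh\<close> iterated \<open>q - p\<close> times is \<open>A\<close>: the points \<open>c, sh c, sh\<^sup>2 c, \<dots>\<close>
  form an axis of \<open>x\<close>. Moreover \<open>V x \<subseteq> V (x\<^sup>n)\<close>, and \<open>SC (x\<^sup>n)\<close> is the set of orbits of the centralizer of
  \<open>x\<^sup>n\<close> on \<open>V (x\<^sup>n)\<close>. So \<open>V (x\<^sup>n) \<subseteq> V (x\<^sup>L)\<close> for all \<open>n\<close> implies that the cardinality is periodic with
  period \<open>L\<close>.

  Shifting \<open>q - p\<close> steps forward and translating back by \<open>x\<close> is an order automorphism \<open>T\<close> of \<open>V (x\<^sup>n)\<close>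
  that commutes with \<open>sh\<close> and \<open>co\<close>, and whose fixed points are the elements of \<open>V x\<close>. A smallest step upwards from \<open>c\<close>
  in \<open>V (x\<^sup>n)\<close> stays below \<open>co c\<close> or below \<open>sh c\<close>, so it suffices to control the points strictly
  between. In a circular group there are none, since \<open>\<Delta>\<close> is the only simple common multiple of two
  simple elements with trivial meet; hence \<open>T = id\<close> and \<open>L = 1\<close>. In the four-strand dual braid group
  \<open>\<Delta>\<close> has length \<open>3\<close>, so after possibly replacing \<open>x\<close> by its inverse only the interval from \<open>c\<close> to
  \<open>co c\<close> matters; there are at most three points in it, and a map fixing one of
  them fixes all, because the cyclic order of the atoms below a triangle is preserved; hence
  \<open>T\<^sup>6 = id\<close> and \<open>L = 6\<close>.\<close>

section \<open>Axes in a meet semilattice\<close>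

text \<open>The exponents p and q are the infimum and supremum of the rigid element. They depend
  only on its conjugacy class, so all rigid conjugates of x^n come from a single set V. Inclusions
  of axis sets give periodicity through two facts: a point of V (x^b) lies in V (x^a) iff it lies in
  V (x^(a+b)), and for two points on axes of both x^a and x^b, equal conjugates of x^a imply equal
  conjugates of x^b. Take b = L. In the braid group a length count chooses between x and its
  inverse. A point strictly between c and co c makes every shift along the axis of c add exactly 1
  to the length; a point strictly between d and sh d makes every shift along the axis of d add at
  least 2. The total over q - p shifts is the same for both, so only one kind of interval can have
  interior points. The number 6 is lcm(1, 2, 3), for the orbits on at most three points. The groups
  are given by presentations, so their order structure has to be established. An abstract system of
  simple elements acts on normal forms by left multiplication; this action respects the defining
  relations, hence distinct normal forms are distinct group elements.\<close>

locale meet_order =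
  fixes X :: "'a set"
    and le :: "'a \<Rightarrow> 'a \<Rightarrow> bool" (infix "\<preceq>" 50)
    and meet :: "'a \<Rightarrow> 'a \<Rightarrow> 'a" (infixl "\<curlywedge>" 70)
  assumes le_refl: "a \<in> X \<Longrightarrow> a \<preceq> a"
    and le_antisym: "\<lbrakk>a \<in> X; b \<in> X; a \<preceq> b; b \<preceq> a\<rbrakk> \<Longrightarrow> a = b"
    and le_trans: "\<lbrakk>a \<in> X; b \<in> X; c \<in> X; a \<preceq> b; b \<preceq> c\<rbrakk> \<Longrightarrow> a \<preceq> c"
    and meet_closed [simp]: "\<lbrakk>a \<in> X; b \<in> X\<rbrakk> \<Longrightarrow> a \<curlywedge> b \<in> X"
    and meet_le1: "\<lbrakk>a \<in> X; b \<in> X\<rbrakk> \<Longrightarrow> a \<curlywedge> b \<preceq> a"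
    and meet_le2: "\<lbrakk>a \<in> X; b \<in> X\<rbrakk> \<Longrightarrow> a \<curlywedge> b \<preceq> b"
    and meet_greatest: "\<lbrakk>a \<in> X; b \<in> X; c \<in> X; c \<preceq> a; c \<preceq> b\<rbrakk> \<Longrightarrow> c \<preceq> a \<curlywedge> b"
begin

lemma meet_commute: "\<lbrakk>a \<in> X; b \<in> X\<rbrakk> \<Longrightarrow> a \<curlywedge> b = b \<curlywedge> a"
  by (intro le_antisym) (auto intro: meet_greatest meet_le1 meet_le2)

lemma le_iff_meet: "\<lbrakk>a \<in> X; b \<in> X\<rbrakk> \<Longrightarrow> a \<preceq> b \<longleftrightarrow> a \<curlywedge> b = a"
  by (metis le_antisym le_refl meet_closed meet_greatest meet_le1 meet_le2)

lemma meet_le1_trans: "\<lbrakk>a \<in> X; b \<in> X; c \<in> X; a \<preceq> c\<rbrakk> \<Longrightarrow> a \<curlywedge> b \<preceq> c"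
  by (meson le_trans meet_closed meet_le1)

lemma meet_le2_trans: "\<lbrakk>a \<in> X; b \<in> X; c \<in> X; b \<preceq> c\<rbrakk> \<Longrightarrow> a \<curlywedge> b \<preceq> c"
  by (meson le_trans meet_closed meet_le2)

lemma meet_assoc: "\<lbrakk>a \<in> X; b \<in> X; c \<in> X\<rbrakk> \<Longrightarrow> a \<curlywedge> b \<curlywedge> c = a \<curlywedge> (b \<curlywedge> c)"
  by (intro le_antisym meet_greatest)
    (auto intro: meet_le1_trans meet_le2_trans meet_le1 meet_le2)

lemma meet_mono: "\<lbrakk>a \<in> X; b \<in> X; c \<in> X; d \<in> X; a \<preceq> c; b \<preceq> d\<rbrakk> \<Longrightarrow> a \<curlywedge> b \<preceq> c \<curlywedge> d"
  by (auto intro: meet_greatest meet_le1_trans meet_le2_trans)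

lemma meet_idem: "a \<in> X \<Longrightarrow> a \<curlywedge> a = a"
  by (simp add: le_iff_meet[symmetric] le_refl)

lemma meet_swap:
  assumes "a \<in> X" "b \<in> X" "c \<in> X" "d \<in> X"
  shows "a \<curlywedge> b \<curlywedge> (c \<curlywedge> d) = a \<curlywedge> c \<curlywedge> (b \<curlywedge> d)"
proof -
  have "b \<curlywedge> (c \<curlywedge> d) = c \<curlywedge> (b \<curlywedge> d)"
    using assms by (simp only: meet_assoc[symmetric] meet_commute[of b c])
  then show ?thesis using assms by (simp only: meet_assoc meet_closed)
qed

lemma mono_of_meet_hom:
  assumes "\<And>a b. \<lbrakk>a \<in> X; b \<in> X\<rbrakk> \<Longrightarrow> f (a \<curlywedge> b) = f a \<curlywedge> f b" "\<And>a. a \<in> X \<Longrightarrow> f a \<in> X"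
    and "a \<in> X" "b \<in> X" "a \<preceq> b"
  shows "f a \<preceq> f b"
  using assms by (metis le_iff_meet)

end

text \<open>Abstract picture of one group element: A and B stand for the left translations by x and
  by its inverse, each corrected by a power of Delta, E for right multiplication by Delta, and l for
  q - p.\<close>

locale axis_pair = meet_order X le meet
  for X :: "'a set" and le (infix "\<preceq>" 50) and meet (infixl "\<curlywedge>" 70) +
  fixes A B E :: "'a \<Rightarrow> 'a" and l :: nat
  assumes A_closed [simp]: "a \<in> X \<Longrightarrow> A a \<in> X"
    and B_closed [simp]: "a \<in> X \<Longrightarrow> B a \<in> X"
    and E_closed [simp]: "a \<in> X \<Longrightarrow> E a \<in> X"
    and A_meet: "\<lbrakk>a \<in> X; b \<in> X\<rbrakk> \<Longrightarrow> A (a \<curlywedge> b) = A a \<curlywedge> A b"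
    and B_meet: "\<lbrakk>a \<in> X; b \<in> X\<rbrakk> \<Longrightarrow> B (a \<curlywedge> b) = B a \<curlywedge> B b"
    and E_meet: "\<lbrakk>a \<in> X; b \<in> X\<rbrakk> \<Longrightarrow> E (a \<curlywedge> b) = E a \<curlywedge> E b"
    and A_E: "a \<in> X \<Longrightarrow> A (E a) = E (A a)"
    and B_E: "a \<in> X \<Longrightarrow> B (E a) = E (B a)"
    and A_B: "a \<in> X \<Longrightarrow> A (B a) = (E ^^ l) a"
    and B_A: "a \<in> X \<Longrightarrow> B (A a) = (E ^^ l) a"
    and E_infl: "a \<in> X \<Longrightarrow> a \<preceq> E a"
    and E_bij: "bij_betw E X X"
    and l_pos: "0 < l"
begin

text \<open>Passing to the inverse of x exchanges A with B and sh with co while keeping V; each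
  statement about A and sh thus has a mirror image.\<close>

lemma dual: "axis_pair X (\<preceq>) (\<curlywedge>) B A E l"
  by unfold_locales
    (auto simp: A_meet B_meet E_meet A_E B_E A_B B_A E_infl E_bij l_pos)

lemma A_mono: "\<lbrakk>a \<in> X; b \<in> X; a \<preceq> b\<rbrakk> \<Longrightarrow> A a \<preceq> A b"
  using mono_of_meet_hom[of A] A_meet by auto

lemma B_mono: "\<lbrakk>a \<in> X; b \<in> X; a \<preceq> b\<rbrakk> \<Longrightarrow> B a \<preceq> B b"
  using mono_of_meet_hom[of B] B_meet by auto

lemma E_mono: "\<lbrakk>a \<in> X; b \<in> X; a \<preceq> b\<rbrakk> \<Longrightarrow> E a \<preceq> E b"
  using mono_of_meet_hom[of E] E_meet by auto

lemma E_inj: "\<lbrakk>a \<in> X; b \<in> X; E a = E b\<rbrakk> \<Longrightarrow> a = b"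
  using E_bij by (auto simp: bij_betw_def inj_on_def)

lemma pow_closed [simp]:
  "a \<in> X \<Longrightarrow> (A ^^ k) a \<in> X" "a \<in> X \<Longrightarrow> (B ^^ k) a \<in> X" "a \<in> X \<Longrightarrow> (E ^^ k) a \<in> X"
  by (induction k) auto

lemma Epow_infl: "a \<in> X \<Longrightarrow> a \<preceq> (E ^^ k) a"
  by (induction k) (auto intro: le_refl le_trans[OF _ _ _ _ E_infl])

lemma Epow_mono_exp:
  assumes "a \<in> X" "j \<le> k"
  shows "(E ^^ j) a \<preceq> (E ^^ k) a"
proof -
  have "(E ^^ k) a = (E ^^ (k - j)) ((E ^^ j) a)"
    using assms(2) by (simp flip: funpow_add[THEN fun_cong, unfolded o_def])
  then show ?thesis using Epow_infl assms(1) by simp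
qed

definition V where "V = {c \<in> X. A c \<curlywedge> B c = c}"
definition sh where "sh c = A c \<curlywedge> E c"
definition co where "co c = B c \<curlywedge> E c"

lemma dual_V: "axis_pair.V X (\<curlywedge>) B A = V"
  by (auto simp: axis_pair.V_def[OF dual] V_def meet_commute)

lemma dual_sh: "axis_pair.sh (\<curlywedge>) B E = co" and dual_co: "axis_pair.co (\<curlywedge>) A E = sh"
  by (auto simp: fun_eq_iff axis_pair.sh_def[OF dual] axis_pair.co_def[OF dual] sh_def co_def)

lemma V_X: "c \<in> V \<Longrightarrow> c \<in> X" by (simp add: V_def)

lemma VD: "c \<in> V \<Longrightarrow> A c \<curlywedge> B c = c" by (simp add: V_def)

lemma V_le_A: "c \<in> V \<Longrightarrow> c \<preceq> A c" and V_le_B: "c \<in> V \<Longrightarrow> c \<preceq> B c"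
  unfolding V_def using meet_le1 meet_le2 by (metis (mono_tags) A_closed B_closed mem_Collect_eq)+

lemma V_meet:
  assumes "c \<in> V" "d \<in> V" shows "c \<curlywedge> d \<in> V"
proof -
  have [simp]: "c \<in> X" "d \<in> X" using assms V_X by auto
  have "A (c \<curlywedge> d) \<curlywedge> B (c \<curlywedge> d) = (A c \<curlywedge> B c) \<curlywedge> (A d \<curlywedge> B d)"
    by (simp add: A_meet B_meet) (rule meet_swap; simp)
  then show ?thesis using assms by (simp add: V_def)
qed

lemma V_E: "c \<in> V \<Longrightarrow> E c \<in> V"
  by (simp add: V_def A_E B_E E_meet[symmetric])

lemma V_A: "c \<in> V \<Longrightarrow> A c \<in> V"
  by (simp add: V_def B_A flip: A_B A_meet)

lemma V_B: "c \<in> V \<Longrightarrow> B c \<in> V"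
  by (simp add: V_def A_B flip: B_A B_meet)

lemma V_sh: "c \<in> V \<Longrightarrow> sh c \<in> V" and V_co: "c \<in> V \<Longrightarrow> co c \<in> V"
  by (auto simp: sh_def co_def intro: V_meet V_A V_B V_E)

lemma sh_mono: "\<lbrakk>a \<in> X; b \<in> X; a \<preceq> b\<rbrakk> \<Longrightarrow> sh a \<preceq> sh b"
  unfolding sh_def by (auto intro: meet_mono A_mono E_mono)

lemma co_mono: "\<lbrakk>a \<in> X; b \<in> X; a \<preceq> b\<rbrakk> \<Longrightarrow> co a \<preceq> co b"
  unfolding co_def by (auto intro: meet_mono B_mono E_mono)

lemma sh_closed [simp]: "a \<in> X \<Longrightarrow> sh a \<in> X" and co_closed [simp]: "a \<in> X \<Longrightarrow> co a \<in> X"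
  by (auto simp: sh_def co_def)

lemma le_sh: "c \<in> V \<Longrightarrow> c \<preceq> sh c" and le_co: "c \<in> V \<Longrightarrow> c \<preceq> co c"
  unfolding sh_def co_def by (auto intro!: meet_greatest V_le_A V_le_B E_infl simp: V_X)

lemma sh_le_E: "c \<in> X \<Longrightarrow> sh c \<preceq> E c" and co_le_E: "c \<in> X \<Longrightarrow> co c \<preceq> E c"
  unfolding sh_def co_def by (auto intro!: meet_le2)

text \<open>Expanded, sh (co c) is the meet of \<open>E^l c\<close>, \<open>E (A c)\<close>,
  \<open>E (B c)\<close> and \<open>E (E c)\<close>. The middle two meet in E c because c lies in V,
  and E c is below the other two since l > 0.\<close>

lemma sh_co: assumes "c \<in> V" shows "sh (co c) = E c"
proof (rule le_antisym)
  have c: "c \<in> X" using assms V_X by auto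
  then show "sh (co c) \<in> X" "E c \<in> X" by auto
  have 1: "E (A c) \<curlywedge> E (B c) = E c"
    using VD[OF assms] c by (simp flip: E_meet)
  have "sh (co c) \<preceq> A (E c)"
    unfolding sh_def co_def using c
    by (intro meet_le1_trans A_mono meet_le2) auto
  moreover have "sh (co c) \<preceq> E (B c)"
    unfolding sh_def co_def using c
    by (intro meet_le2_trans E_mono meet_le1) auto
  ultimately show "sh (co c) \<preceq> E c"
    using c 1 by (metis A_E A_closed B_closed E_closed \<open>sh (co c) \<in> X\<close> meet_greatest)
  have "E c \<preceq> (E ^^ l) c" using Epow_mono_exp[of c 1 l] c l_pos by auto
  moreover have "E c \<preceq> E (A c)" "E c \<preceq> E (B c)" "E c \<preceq> E (E c)"
    using assms c V_le_A V_le_B E_infl E_mono by auto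
  ultimately show "E c \<preceq> sh (co c)"
    using c by (simp add: sh_def co_def A_meet E_meet A_B A_E meet_greatest)
qed

lemma co_sh: "c \<in> V \<Longrightarrow> co (sh c) = E c"
  using axis_pair.sh_co[OF dual] by (simp add: dual_V dual_sh dual_co)

lemma sh_inj: "\<lbrakk>c \<in> V; d \<in> V; sh c = sh d\<rbrakk> \<Longrightarrow> c = d"
  using E_inj[of c d] co_sh[of c] co_sh[of d] V_X by simp

lemma co_inj: "\<lbrakk>c \<in> V; d \<in> V; co c = co d\<rbrakk> \<Longrightarrow> c = d"
  using E_inj[of c d] sh_co[of c] sh_co[of d] V_X by simp

lemma V_E_iff: "c \<in> X \<Longrightarrow> E c \<in> V \<longleftrightarrow> c \<in> V"
  using E_inj[of "A c \<curlywedge> B c" c] by (auto simp: V_def A_E B_E simp flip: E_meet)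

lemma E_surj_V: assumes "c \<in> V" obtains d where "d \<in> V" "E d = c"
proof -
  have "c \<in> E ` X" using E_bij V_X[OF assms] by (simp add: bij_betw_def)
  then obtain d where "d \<in> X" "c = E d" by blast
  then show ?thesis using that[of d] V_E_iff[of d] assms by simp
qed

lemma A_le_Epow: "c \<in> V \<Longrightarrow> A c \<preceq> (E ^^ l) c"
  using A_mono[OF _ _ V_le_B] by (simp add: V_X flip: A_B)

lemma sh_pow_le:
  assumes "c \<in> V" "k < l"
  shows "(sh ^^ Suc k) c = A c \<curlywedge> (E ^^ Suc k) c"
  using assms(2)
proof (induction k)
  case 0 then show ?case by (simp add: sh_def)
next
  case (Suc k)
  have c: "c \<in> X" using assms V_X by auto
  let ?e = "(E ^^ Suc k) c"
  have "(sh ^^ Suc (Suc k)) c = sh (A c \<curlywedge> ?e)" using Suc by auto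
  also have "\<dots> = A (A c) \<curlywedge> A ?e \<curlywedge> (E (A c) \<curlywedge> E ?e)"
    using c by (simp add: sh_def A_meet E_meet)
  also have "\<dots> = A c \<curlywedge> E ?e"
  proof (rule le_antisym)
    have le: "E ?e \<preceq> (E ^^ l) c" using Epow_mono_exp[of c "Suc (Suc k)" l] c Suc by auto
    have 1: "A (A c) \<curlywedge> (E ^^ l) c = A c"
      using c VD[OF assms(1)] by (simp flip: A_B A_meet)
    let ?m = "A (A c) \<curlywedge> A ?e \<curlywedge> (E (A c) \<curlywedge> E ?e)"
    show m: "?m \<in> X" "A c \<curlywedge> E ?e \<in> X" using c by (auto simp del: funpow.simps)
    have "?m \<preceq> A (A c)" using c by (intro meet_le1_trans meet_le1) (auto simp del: funpow.simps)
    moreover have b: "?m \<preceq> E ?e" using c by (intro meet_le2_trans meet_le2) (auto simp del: funpow.simps)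
    ultimately have "?m \<preceq> A (A c) \<curlywedge> (E ^^ l) c"
      using le c m by (rule_tac meet_greatest) (auto intro: le_trans[of ?m "E ?e"] simp del: funpow.simps)
    then have "?m \<preceq> A c" unfolding 1 .
    then show "?m \<preceq> A c \<curlywedge> E ?e" using b m c by (auto intro!: meet_greatest simp del: funpow.simps)
    have "A c \<preceq> A (A c)" "A c \<preceq> A ?e" "A c \<preceq> E (A c)"
      using c assms V_le_A Epow_infl[of c "Suc k"] E_infl by (auto intro!: A_mono simp del: funpow.simps)
    then show "A c \<curlywedge> E ?e \<preceq> ?m" using c
      by (intro meet_greatest) (auto intro: meet_le1_trans meet_le2 simp del: funpow.simps)
  qed
  finally show ?case by simp
qed

lemma sh_pow_l: assumes "c \<in> V" shows "(sh ^^ l) c = A c"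
proof -
  obtain k where k: "l = Suc k" using l_pos by (cases l) auto
  have "(sh ^^ l) c = A c \<curlywedge> (E ^^ l) c" using sh_pow_le[OF assms, of k] k by simp
  then show ?thesis using A_le_Epow[OF assms] V_X[OF assms] by (simp add: le_iff_meet)
qed

lemma A_pow_le: "c \<in> V \<Longrightarrow> c \<preceq> (A ^^ k) c"
proof (induction k)
  case (Suc k)
  then have "A c \<preceq> A ((A ^^ k) c)" by (auto intro: A_mono simp: V_X)
  then have "c \<preceq> A ((A ^^ k) c)"
    using Suc.prems V_X by (rule_tac le_trans[OF _ _ _ V_le_A[OF Suc.prems]]) auto
  then show ?case by simp
next
  case 0 then show ?case using V_X le_refl by simp
qed

text \<open>Applying A to the induction hypothesis bounds the new meet by A c, because B c lies
  below \<open>A (B c)\<close>. It is also below B c, hence below c.\<close>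

lemma A_pow_B: "c \<in> V \<Longrightarrow> (A ^^ Suc k) c \<curlywedge> B c = c"
proof (induction k)
  case (Suc k)
  have c: "c \<in> X" using Suc V_X by auto
  let ?u = "(A ^^ Suc k) c"
  have u: "?u \<in> X" using c pow_closed by blast
  have "A ?u \<curlywedge> A (B c) = A c" using Suc c u by (metis A_meet B_closed)
  moreover have "B c \<preceq> A (B c)" using c Suc by (metis A_B B_A B_mono V_le_A A_closed)
  ultimately have "A ?u \<curlywedge> B c \<preceq> A c"
    using c u by (metis A_closed B_closed meet_closed meet_greatest meet_le1 meet_le2_trans meet_le2 )
  then have "A ?u \<curlywedge> B c \<preceq> A c \<curlywedge> B c"
    using c u by (auto intro!: meet_greatest meet_le2 simp del: funpow.simps)
  moreover have "c \<preceq> A ?u \<curlywedge> B c"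
    using A_pow_le[of c "Suc (Suc k)"] V_le_B[of c] Suc.prems c u by (intro meet_greatest) auto
  ultimately have "A ?u \<curlywedge> B c = c"
    using VD[of c] Suc.prems c u by (intro le_antisym) auto
  then show ?case by simp
next
  case 0 then show ?case using VD[of c] by simp
qed

text \<open>For the group this says that x^n and x take the same single step at a point of an axis
  of x. Below \<open>E^l c\<close>, and so below E c, the powers of A cannot be told apart from A
  itself: apply A to \<open>A_pow_B\<close>.\<close>

lemma A_pow_E: assumes "c \<in> V" shows "(A ^^ Suc k) c \<curlywedge> E c = sh c"
proof (cases k)
  case 0 show ?thesis unfolding 0 sh_def by simp
next
  case (Suc j)
  have c: "c \<in> X" using assms V_X by auto
  let ?u = "(A ^^ Suc k) c"
  have u: "?u \<in> X" using c pow_closed by blast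
  have 1: "?u \<curlywedge> (E ^^ l) c = A c"
  proof -
    have "?u \<curlywedge> (E ^^ l) c = A ((A ^^ Suc j) c \<curlywedge> B c)"
      using c Suc by (simp add: A_meet A_B)
    then show ?thesis using A_pow_B[OF assms] by simp
  qed
  have El: "E c \<preceq> (E ^^ l) c" using Epow_mono_exp[of c 1 l] c l_pos by auto
  show ?thesis
  proof (rule le_antisym)
    show "?u \<curlywedge> E c \<in> X" "sh c \<in> X" using c u by auto
    have "?u \<curlywedge> E c \<preceq> ?u \<curlywedge> (E ^^ l) c" using c u El by (intro meet_mono le_refl) auto
    then show "?u \<curlywedge> E c \<preceq> sh c" using 1 c u unfolding sh_def
      by (auto intro!: meet_greatest meet_le2 simp del: funpow.simps)
    have "A c \<preceq> ?u" using 1 c u by (metis meet_le1 pow_closed(3))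
    then show "sh c \<preceq> ?u \<curlywedge> E c" unfolding sh_def using c u by (intro meet_mono le_refl) auto
  qed
qed

text \<open>With equal exponents this becomes the inclusion of V x in V (x^n).\<close>

lemma A_pow_B_pow: assumes "c \<in> V" shows "(A ^^ Suc k) c \<curlywedge> (B ^^ Suc m) c = c"
proof (induction m)
  case 0 then show ?case using A_pow_B[OF assms] by simp
next
  case (Suc m)
  have c: "c \<in> X" using assms V_X by auto
  let ?u = "(A ^^ Suc k) c" and ?v = "(B ^^ Suc m) c"
  have u: "?u \<in> X" "?v \<in> X" using c pow_closed by blast+
  have comm: "B ((A ^^ j) c) = (A ^^ j) (B c)" for j
    by (induction j) (use c in \<open>auto simp: A_B B_A\<close>, metis A_B B_A B_closed pow_closed(1))
  have "B ?u \<curlywedge> B ?v = B c" using Suc c u by (metis B_meet)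
  moreover have "?u \<preceq> B ?u"
  proof -
    have "c \<preceq> B c" using assms V_le_B by auto
    then have "(A ^^ j) c \<preceq> (A ^^ j) (B c)" for j
      by (induction j) (auto intro: A_mono simp: c)
    then show ?thesis by (simp only: comm)
  qed
  ultimately have "?u \<curlywedge> B ?v \<preceq> B c"
    using c u by (metis B_closed meet_mono le_refl)
  then have "?u \<curlywedge> B ?v \<preceq> ?u \<curlywedge> B c"
    using c u by (auto intro!: meet_greatest meet_le1 simp del: funpow.simps)
  moreover have "c \<preceq> ?u \<curlywedge> B ?v"
    using A_pow_le[OF assms, of "Suc k"] axis_pair.A_pow_le[OF dual, of c "Suc (Suc m)"] assms c u
    by (intro meet_greatest) (auto simp: dual_V)
  ultimately have "?u \<curlywedge> B ?v = c"
    using A_pow_B[OF assms, of k] c u by (intro le_antisym) auto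
  then show ?case by simp
qed

text \<open>If e meets co c in more than c, that meet is the required point. Otherwise the meet of e
  with E c works: it meets B c only in c, so its image under A meets \<open>E^l c\<close> in A c,
  which forces it below A c. By \<open>noeth\<close> it is not c.\<close>

lemma step_cases:
  assumes "c \<in> V" "e \<in> V" "c \<preceq> e" "c \<noteq> e"
    and noeth: "\<And>e. \<lbrakk>e \<in> X; c \<preceq> e; e \<curlywedge> E c = c\<rbrakk> \<Longrightarrow> e = c"
  obtains d where "d \<in> V" "c \<preceq> d" "c \<noteq> d" "d \<preceq> e" "d \<preceq> co c \<or> d \<preceq> sh c"
proof (cases "e \<curlywedge> co c = c")
  case False
  have "c \<preceq> e \<curlywedge> co c" "e \<curlywedge> co c \<preceq> co c" "e \<curlywedge> co c \<preceq> e"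
    using assms V_X le_co by (auto intro!: meet_greatest meet_le2 meet_le1)
  then show ?thesis using that[of "e \<curlywedge> co c"] False assms V_meet V_co by auto
next
  case True
  let ?d = "e \<curlywedge> E c"
  have X: "c \<in> X" "e \<in> X" using assms V_X by auto
  have d: "?d \<in> V" using assms V_meet V_E by auto
  have "?d \<curlywedge> B c = c"
    using True X unfolding co_def by (metis B_closed E_closed meet_assoc meet_commute)
  then have 1: "A ?d \<curlywedge> (E ^^ l) c = A c" using X by (metis A_B A_meet B_closed E_closed meet_closed)
  have "E c \<preceq> (E ^^ l) c" using Epow_mono_exp[of c 1 l] X l_pos by auto
  then have "?d \<preceq> A ?d" "?d \<preceq> (E ^^ l) c"
    using d V_le_A X by (auto intro: meet_le2_trans)
  then have "?d \<preceq> A c" using 1 X V_X d by (metis A_closed meet_greatest pow_closed(3))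
  then have "?d \<preceq> sh c" unfolding sh_def using X by (auto intro!: meet_greatest meet_le2)
  moreover have "c \<preceq> ?d" "?d \<preceq> e" using X assms E_infl by (auto intro!: meet_greatest meet_le1)
  moreover have "?d \<noteq> c" using noeth[of e] assms X by auto
  ultimately show ?thesis using that[of ?d] d by auto
qed

text \<open>The neighbours of c. Only the interval up to co c is recorded; the one up to sh c is
  required to have no interior points when the neighbours are used.\<close>

definition N where "N c = {d \<in> V. c \<preceq> d \<and> d \<preceq> co c \<and> d \<noteq> c \<and> d \<noteq> co c}"

text \<open>The upper end co c is carried to E c, which is co (sh c).\<close>

lemma N_sh: "\<lbrakk>c \<in> V; d \<in> N c\<rbrakk> \<Longrightarrow> sh d \<in> N (sh c)"
  unfolding N_def using sh_mono sh_inj V_sh V_co co_sh sh_co V_X sh_mono[of d "co c"]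
  by (auto dest: sh_inj)

lemma N_E_iff: assumes "c \<in> V" "d \<in> V" shows "E d \<in> N (E c) \<longleftrightarrow> d \<in> N c"
proof -
  have le: "E a \<preceq> E b \<longleftrightarrow> a \<preceq> b" if "a \<in> X" "b \<in> X" for a b
    using that by (metis E_closed E_inj E_meet le_iff_meet meet_closed)
  have "co (E c) = E (co c)" using assms by (metis V_E V_co co_sh sh_co)
  then show ?thesis unfolding N_def using assms le V_X V_E E_inj V_co by auto
qed

lemma N_co: "\<lbrakk>c \<in> V; d \<in> N c\<rbrakk> \<Longrightarrow> co d \<in> N (co c)"
  unfolding N_def using co_mono co_inj V_co V_X
  by (auto dest: co_inj)

text \<open>After a step from c to a neighbour d, the old end co c is itself a neighbour of d. It is
  the one neighbour of d that is known to be fixed.\<close>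

lemma N_return: "\<lbrakk>c \<in> V; d \<in> N c\<rbrakk> \<Longrightarrow> co c \<in> N d"
  unfolding N_def using co_mono V_co V_X by (auto dest: co_inj)

end

section \<open>Automorphisms of an axis set and their fixed points\<close>

locale axis_aut = axis_pair +
  fixes U
  assumes U_V: "c \<in> V \<Longrightarrow> U c \<in> V"
    and U_mono: "\<lbrakk>c \<in> V; d \<in> V; c \<preceq> d\<rbrakk> \<Longrightarrow> U c \<preceq> U d"
    and U_inj: "\<lbrakk>c \<in> V; d \<in> V; U c = U d\<rbrakk> \<Longrightarrow> c = d"
    and U_sh: "c \<in> V \<Longrightarrow> U (sh c) = sh (U c)"
    and U_co: "c \<in> V \<Longrightarrow> U (co c) = co (U c)"
begin

lemma U_E: "c \<in> V \<Longrightarrow> U (E c) = E (U c)"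
  by (metis U_V U_co U_sh V_co sh_co)

lemma U_N: "\<lbrakk>c \<in> V; U c = c; d \<in> N c\<rbrakk> \<Longrightarrow> U d \<in> N c"
proof -
  assume c: "c \<in> V" "U c = c" and "d \<in> N c"
  then have d: "d \<in> V" "c \<preceq> d" "d \<preceq> co c" "d \<noteq> c" "d \<noteq> co c" by (auto simp: N_def)
  have "U (co c) = co c" using c U_co by simp
  then show "U d \<in> N c"
    using d c U_V[of d] U_mono[of c d] U_mono[of d "co c"] V_co[of c]
      U_inj[of d c] U_inj[of d "co c"] by (auto simp: N_def)
qed

text \<open>The property that a point and all its neighbours are fixed spreads upwards until e is
  reached; \<open>len\<close> makes the process stop. A step leads to a neighbour, where
  \<open>rot\<close> takes over, or by \<open>black\<close> it is a full step to co c or sh c, which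
  transports neighbours.\<close>

lemma fix_all:
  fixes len :: "_ \<Rightarrow> int"
  assumes noeth: "\<And>c e. \<lbrakk>c \<in> X; e \<in> X; c \<preceq> e; e \<curlywedge> E c = c\<rbrakk> \<Longrightarrow> e = c"
    and len: "\<And>c d. \<lbrakk>c \<in> X; d \<in> X; c \<preceq> d; c \<noteq> d\<rbrakk> \<Longrightarrow> len c < len d"
    and c: "c \<in> V" "U c = c" "\<And>d. d \<in> N c \<Longrightarrow> U d = d"
    and rot: "\<And>d a b. \<lbrakk>d \<in> V; U d = d; a \<in> N d; U a = a; b \<in> N d\<rbrakk> \<Longrightarrow> U b = b"
    and black: "\<And>c d. \<lbrakk>c \<in> V; d \<in> V; c \<preceq> d; d \<preceq> sh c\<rbrakk> \<Longrightarrow> d = c \<or> d = sh c"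
    and e: "e \<in> V" "c \<preceq> e"
  shows "U e = e"
  using c e(2)
proof (induction "nat (len e - len c)" arbitrary: c rule: less_induct)
  case less
  show ?case
  proof (cases "c = e")
    case True then show ?thesis using less by auto
  next
    case False
    obtain d where d: "d \<in> V" "c \<preceq> d" "c \<noteq> d" "d \<preceq> e" "d \<preceq> co c \<or> d \<preceq> sh c"
      using step_cases[of c e] noeth[of c] less.prems e False V_X by metis
    have X: "c \<in> X" "d \<in> X" "e \<in> X" using less.prems d e V_X by auto
    have lt: "nat (len e - len d) < nat (len e - len c)"
      using len[of c d] len[of c e] X d less.prems False by auto
    have "U d = d \<and> (\<forall>a\<in>N d. U a = a)"
    proof (cases "d \<in> N c")
      case True
      then have "U d = d" using less.prems by auto
      \<comment> \<open>This is the fixed neighbour of d from which \<open>rot\<close>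
        starts.\<close>
      moreover have "co c \<in> N d" "U (co c) = co c"
        using N_return True less.prems U_co by auto
      ultimately show ?thesis using rot d by blast
    next
      case False
      then consider "d = co c" | "d = sh c"
        using d black[of c d] less.prems by (auto simp: N_def)
      then show ?thesis
      proof cases
        case 1
        have "U a = a" if a: "a \<in> N d" for a
        proof -
          \<comment> \<open>One shift takes the neighbours of co c to neighbours of E c. These are
            translates by E of neighbours of c, hence fixed, and sh is injective on V.\<close>
          have "sh a \<in> N (E c)" using N_sh[of d a] a d sh_co less.prems 1 by auto
          moreover obtain b where b: "b \<in> V" "E b = sh a"
            using E_surj_V V_sh a unfolding N_def by (metis (no_types, lifting) mem_Collect_eq)
          ultimately have "b \<in> N c" using N_E_iff less.prems by metis
          then have "U (sh a) = sh a" using b less.prems U_E by metis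
          then show ?thesis using a U_sh U_V sh_inj unfolding N_def
            by (metis (no_types, lifting) mem_Collect_eq)
        qed
        then show ?thesis using 1 U_co less.prems by auto
      next
        case 2
        have "U a = a" if a: "a \<in> N d" for a
        proof -
          have "co a \<in> N (E c)" using N_co[of d a] a d co_sh less.prems 2 by auto
          moreover obtain b where b: "b \<in> V" "E b = co a"
            using E_surj_V V_co a unfolding N_def by (metis (no_types, lifting) mem_Collect_eq)
          ultimately have "b \<in> N c" using N_E_iff less.prems by metis
          then have "U (co a) = co a" using b less.prems U_E by metis
          then show ?thesis using a U_co U_V co_inj unfolding N_def
            by (metis (no_types, lifting) mem_Collect_eq)
        qed
        then show ?thesis using 2 U_sh less.prems by auto
      qed
    qed
    then show ?thesis using less.hyps[OF lt] d by auto
  qed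
qed

end

context axis_pair
begin

lemma sh_pow_V: "c \<in> V \<Longrightarrow> (sh ^^ k) c \<in> V"
  by (induction k) (auto intro: V_sh)

lemma co_pow_V: "c \<in> V \<Longrightarrow> (co ^^ k) c \<in> V"
  by (induction k) (auto intro: V_co)

lemma sh_pow_inj: "\<lbrakk>c \<in> V; d \<in> V; (sh ^^ k) c = (sh ^^ k) d\<rbrakk> \<Longrightarrow> c = d"
  by (induction k) (auto dest!: sh_inj[rotated 2] intro: sh_pow_V)

lemma co_E: "c \<in> V \<Longrightarrow> co (E c) = E (co c)"
  by (metis V_co co_sh sh_co)

lemma co_pow_E: "c \<in> V \<Longrightarrow> (co ^^ k) (E c) = E ((co ^^ k) c)"
  by (induction k) (auto simp: co_E co_pow_V)

lemma co_pow_sh_pow: "c \<in> V \<Longrightarrow> (co ^^ k) ((sh ^^ k) c) = (E ^^ k) c"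
proof (induction k)
  case (Suc k)
  have "(co ^^ Suc k) ((sh ^^ Suc k) c) = (co ^^ k) (co (sh ((sh ^^ k) c)))"
    by (simp add: funpow_swap1)
  also have "\<dots> = E ((co ^^ k) ((sh ^^ k) c))"
    using Suc.prems by (simp add: co_sh sh_pow_V co_pow_E)
  finally show ?case using Suc by simp
qed simp

lemma sh_pow_le_A: assumes "c \<in> V" shows "(sh ^^ k) c \<preceq> (A ^^ k) c"
proof (induction k)
  case (Suc k)
  have X: "(sh ^^ k) c \<in> X" "(A ^^ k) c \<in> X" using assms sh_pow_V V_X by auto
  have "sh ((sh ^^ k) c) \<preceq> A ((sh ^^ k) c)" unfolding sh_def[of "(sh ^^ k) c"] using X by (simp add: meet_le1)
  also have "A ((sh ^^ k) c) \<preceq> A ((A ^^ k) c)" using Suc X A_mono by blast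
  ultimately show ?case using X le_trans[of "sh ((sh ^^ k) c)" "A ((sh ^^ k) c)"] by simp
qed (use assms V_X le_refl in auto)

lemma co_pow_le_B: "c \<in> V \<Longrightarrow> (co ^^ k) c \<preceq> (B ^^ k) c"
  using axis_pair.sh_pow_le_A[OF dual] by (simp add: dual_V dual_sh)

end

section \<open>Translations that commute with the axes\<close>

locale axis_centralizer = axis_pair +
  fixes C
  assumes C_closed [simp]: "a \<in> X \<Longrightarrow> C a \<in> X"
    and C_meet: "\<lbrakk>a \<in> X; b \<in> X\<rbrakk> \<Longrightarrow> C (a \<curlywedge> b) = C a \<curlywedge> C b"
    and C_A: "a \<in> X \<Longrightarrow> C (A a) = A (C a)"
    and C_B: "a \<in> X \<Longrightarrow> C (B a) = B (C a)"
    and C_E: "a \<in> X \<Longrightarrow> C (E a) = E (C a)"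
    and C_inj: "\<lbrakk>a \<in> X; b \<in> X; C a = C b\<rbrakk> \<Longrightarrow> a = b"
begin

lemma C_sh: "a \<in> X \<Longrightarrow> C (sh a) = sh (C a)" and C_co: "a \<in> X \<Longrightarrow> C (co a) = co (C a)"
  by (simp_all add: sh_def co_def C_meet C_A C_B C_E)

lemma C_V: "c \<in> V \<Longrightarrow> C c \<in> V"
  by (simp add: V_def flip: C_A C_B C_meet)

lemma C_sh_pow: "c \<in> V \<Longrightarrow> C ((sh ^^ k) c) = (sh ^^ k) (C c)"
  by (induction k) (auto simp: C_sh sh_pow_V V_X)

lemma C_co_pow: "c \<in> V \<Longrightarrow> C ((co ^^ k) c) = (co ^^ k) (C c)"
  by (induction k) (auto simp: C_co co_pow_V V_X)

text \<open>C commutes with sh and co because it commutes with A, B, E and meets; sh commutes with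
  co on V because both composites are E.\<close>

lemma axis_aut_sh_pow: "axis_aut X (\<preceq>) (\<curlywedge>) A B E l (\<lambda>c. C ((sh ^^ r) c))"
proof unfold_locales
  fix c d assume c: "c \<in> V"
  show "C ((sh ^^ r) c) \<in> V" using c C_V sh_pow_V by blast
  show "C ((sh ^^ r) (sh c)) = sh (C ((sh ^^ r) c))"
    using c sh_pow_V V_X by (simp add: funpow_swap1 flip: C_sh)
  have "(sh ^^ r) (co c) = co ((sh ^^ r) c)"
    by (induction r) (use c sh_pow_V in \<open>auto simp: sh_co co_sh V_co\<close>)
  then show "C ((sh ^^ r) (co c)) = co (C ((sh ^^ r) c))"
    using c sh_pow_V V_X by (simp flip: C_co)
  assume d: "d \<in> V"
  have X: "(sh ^^ k) c \<in> X" "(sh ^^ k) d \<in> X" for k using c d sh_pow_V V_X by auto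
  show "c = d" if "C ((sh ^^ r) c) = C ((sh ^^ r) d)"
    using C_inj[OF X that] sh_pow_inj c d by blast
  assume "c \<preceq> d"
  then have "(sh ^^ k) c \<preceq> (sh ^^ k) d" for k
    by (induction k) (auto intro: sh_mono X)
  then show "C ((sh ^^ r) c) \<preceq> C ((sh ^^ r) d)"
    using mono_of_meet_hom[of C, OF C_meet C_closed X] by blast
qed

text \<open>If translation by \<open>C\<close> moves the axis of \<open>c\<close> to itself, \<open>r\<close> steps forward,
  then \<open>c\<close> also lies on an axis of \<open>C\<close>.\<close>

lemma root_axis:
  assumes c: "c \<in> V" "(sh ^^ r) c = C c" and b: "b \<in> X" "C b = (E ^^ r) c"
  shows "C c \<curlywedge> b = c"
proof -
  have X: "c \<in> X" "(sh ^^ r) c \<in> X" "(co ^^ r) c \<in> X" using c(1) sh_pow_V co_pow_V V_X by auto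
  \<comment> \<open>Apply \<open>co^r\<close> to \<open>sh^r c = C c\<close>. This identifies b as
    \<open>co^r c\<close>, and the claim becomes that \<open>sh^r c\<close> and
    \<open>co^r c\<close> meet in c. Their meet lies between c and the meet of \<open>A^r c\<close>
    with \<open>B^r c\<close>, which is c.\<close>
  have "C ((co ^^ r) c) = (E ^^ r) c"
    using c C_co_pow co_pow_sh_pow by metis
  then have b_eq: "b = (co ^^ r) c" using b X C_inj by auto
  show ?thesis
  proof (cases r)
    case 0 then show ?thesis using c b_eq X meet_idem by simp
  next
    case (Suc k)
    have A: "(A ^^ r) c \<curlywedge> (B ^^ r) c = c" using A_pow_B_pow[OF c(1), of k k] Suc by simp
    have "(sh ^^ r) c \<curlywedge> (co ^^ r) c \<preceq> (A ^^ r) c \<curlywedge> (B ^^ r) c"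
      using c(1) X by (intro meet_mono sh_pow_le_A co_pow_le_B) auto
    moreover have "c \<preceq> (sh ^^ k) c" for k
      by (induction k) (use c(1) X sh_pow_V V_X le_sh in \<open>auto intro: le_refl le_trans[of _ "(sh ^^ _) c"]\<close>)
    moreover have "c \<preceq> (co ^^ k) c" for k
      by (induction k) (use c(1) X co_pow_V V_X le_co in \<open>auto intro: le_refl le_trans[of _ "(co ^^ _) c"]\<close>)
    ultimately have "(sh ^^ r) c \<curlywedge> (co ^^ r) c = c"
      using X A by (intro le_antisym meet_greatest) auto
    then show ?thesis using c b_eq by simp
  qed
qed

end

section \<open>Garside groups\<close>

text \<open>The additive length \<open>len\<close> encodes atomicity. \<open>ex_join\<close>
  provides the join of 1 and g, from which left translation produces all joins; meets are derived.
  \<open>central\<close> and \<open>dominated\<close> allow negative powers of Delta to be traded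
  for positive ones.\<close>

locale garside_group = group G for G :: "('a, 'm) garside_scheme" (structure) +
  fixes len :: "'a \<Rightarrow> int"
  assumes pos_carrier: "positive G \<subseteq> carrier G"
    and pos_one [simp]: "\<one> \<in> positive G"
    and pos_mult: "\<lbrakk>a \<in> positive G; b \<in> positive G\<rbrakk> \<Longrightarrow> a \<otimes> b \<in> positive G"
    and Delta_pos [simp]: "\<Delta> \<in> positive G"
    and Delta_neq_one: "\<Delta> \<noteq> \<one>"
    and conj_pos: "p \<in> positive G \<Longrightarrow> inv \<Delta> \<otimes> p \<otimes> \<Delta> \<in> positive G"
    and central: "\<exists>e::nat. 0 < e \<and> (\<forall>g\<in>carrier G. \<Delta> [^] e \<otimes> g = g \<otimes> \<Delta> [^] e)"
    and dominated: "g \<in> carrier G \<Longrightarrow> \<exists>k::nat. \<Delta> [^] k \<otimes> g \<in> positive G"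
    and len_mult: "\<lbrakk>a \<in> carrier G; b \<in> carrier G\<rbrakk> \<Longrightarrow> len (a \<otimes> b) = len a + len b"
    and len_pos: "\<lbrakk>p \<in> positive G; p \<noteq> \<one>\<rbrakk> \<Longrightarrow> 0 < len p"
    and ex_join: "g \<in> carrier G \<Longrightarrow> \<exists>j\<in>positive G. inv g \<otimes> j \<in> positive G \<and>
      (\<forall>w\<in>positive G. inv g \<otimes> w \<in> positive G \<longrightarrow> inv j \<otimes> w \<in> positive G)"
begin

lemma posD [simp, dest]: "p \<in> positive G \<Longrightarrow> p \<in> carrier G"
  using pos_carrier by blast

abbreviation D :: "int \<Rightarrow> 'a" where "D k \<equiv> \<Delta> [^] k"

abbreviation le (infix "\<preceq>" 50) where "a \<preceq> b \<equiv> inv a \<otimes> b \<in> positive G"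

lemma Delta_carrier [simp]: "\<Delta> \<in> carrier G" by auto

lemma D_add: "D (j + k) = D j \<otimes> D k" by (simp add: int_pow_mult)

lemma D_minus: "D (- k) = inv (D k)" by (simp add: int_pow_neg)

lemma D_int: "D (int n) = \<Delta> [^] n" by (simp add: int_pow_int)

lemma len_one [simp]: "len \<one> = 0" using len_mult[of \<one> \<one>] by simp

lemma len_inv: "a \<in> carrier G \<Longrightarrow> len (inv a) = - len a"
  using len_mult[of "inv a" a] by simp

lemma len_ge0: "p \<in> positive G \<Longrightarrow> 0 \<le> len p"
  using len_pos[of p] by (cases "p = \<one>") auto

lemma D_nat_pos: "0 \<le> k \<Longrightarrow> D k \<in> positive G"
proof -
  have "\<Delta> [^] n \<in> positive G" for n :: nat by (induction n) (auto intro: pos_mult)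
  then show "0 \<le> k \<Longrightarrow> D k \<in> positive G" by (auto simp: D_int elim!: nonneg_int_cases)
qed

lemma inv_mult_cancel [simp]:
  "\<lbrakk>a \<in> carrier G; b \<in> carrier G\<rbrakk> \<Longrightarrow> inv a \<otimes> (a \<otimes> b) = b"
  "\<lbrakk>a \<in> carrier G; b \<in> carrier G\<rbrakk> \<Longrightarrow> a \<otimes> (inv a \<otimes> b) = b"
  by (simp_all flip: m_assoc)

text \<open>\<open>conj_pos\<close> concerns conjugation by Delta in one direction only. Adding the
  multiple e |k| of a central exponent to k makes the exponent nonnegative and leaves the conjugate
  unchanged.\<close>

lemma D_conj_pos:
  assumes "p \<in> positive G" shows "D (- k) \<otimes> p \<otimes> D k \<in> positive G"
proof -
  have nn: "inv (D (int n)) \<otimes> p \<otimes> D (int n) \<in> positive G" if "p \<in> positive G" for n p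
    using that
  proof (induction n arbitrary: p)
    case (Suc n)
    have "inv (D (int (Suc n))) \<otimes> p \<otimes> D (int (Suc n)) = inv \<Delta> \<otimes> (inv (D (int n)) \<otimes> p \<otimes> D (int n)) \<otimes> \<Delta>"
      using Suc.prems D_add[of "int n" 1] by (simp add: inv_mult_group m_assoc add.commute)
    then show ?case using Suc.IH[OF Suc.prems] conj_pos by simp
  qed auto
  obtain e :: nat where e: "0 < e" "\<And>g. g \<in> carrier G \<Longrightarrow> \<Delta> [^] e \<otimes> g = g \<otimes> \<Delta> [^] e"
    using central by blast
  define n where "n = nat (k + int e * \<bar>k\<bar>)"
  have "0 \<le> k + int e * \<bar>k\<bar>" using e(1) by (smt (verit) mult_le_cancel_right1 of_nat_0_less_iff)
  then have n: "int n = k + int e * \<bar>k\<bar>" by (simp add: n_def)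
  have c: "D (int e * \<bar>k\<bar>) \<otimes> g = g \<otimes> D (int e * \<bar>k\<bar>)" if "g \<in> carrier G" for g
  proof -
    have "(\<Delta> [^] e) [^] m \<otimes> g = g \<otimes> (\<Delta> [^] e) [^] m" for m :: nat
      using that e(2) by (induction m) (simp_all add: m_assoc, metis Delta_carrier m_assoc nat_pow_closed)
    from this[of "nat \<bar>k\<bar>"] have "D (int (e * nat \<bar>k\<bar>)) \<otimes> g = g \<otimes> D (int (e * nat \<bar>k\<bar>))"
      by (simp only: nat_pow_pow Delta_carrier D_int)
    then show ?thesis by simp
  qed
  have "inv (D (int n)) \<otimes> p \<otimes> D (int n) = inv (D (int e * \<bar>k\<bar>)) \<otimes> (inv (D k) \<otimes> p \<otimes> D k) \<otimes> D (int e * \<bar>k\<bar>)"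
    unfolding n D_add using assms by (simp add: inv_mult_group m_assoc)
  also have "\<dots> = inv (D k) \<otimes> p \<otimes> D k"
  proof -
    have X: "inv (D k) \<otimes> p \<otimes> D k \<in> carrier G" using assms by simp
    show ?thesis by (subst m_assoc) (use X in \<open>simp_all add: c[OF X, symmetric] del: m_closed\<close>)
  qed
  finally show ?thesis using nn[OF assms, of n] by (simp add: D_minus)
qed

lemma le_refl: "a \<in> carrier G \<Longrightarrow> a \<preceq> a" by simp

lemma le_trans: assumes "a \<in> carrier G" "b \<in> carrier G" "c \<in> carrier G" "a \<preceq> b" "b \<preceq> c" shows "a \<preceq> c"
  using pos_mult[OF assms(4,5)] assms(1-3) by (simp add: m_assoc)

lemma le_antisym: assumes "a \<in> carrier G" "b \<in> carrier G" "a \<preceq> b" "b \<preceq> a" shows "a = b"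
proof -
  have "len (inv a \<otimes> b) + len (inv b \<otimes> a) = 0" using assms by (simp add: len_mult len_inv)
  then have "inv a \<otimes> b = \<one>" using len_pos[OF assms(3)] len_ge0[OF assms(4)] by force
  then show ?thesis using assms by (metis inv_equality inv_inv inv_closed)
qed

lemma le_mult_left: "\<lbrakk>g \<in> carrier G; a \<in> carrier G; b \<in> carrier G\<rbrakk> \<Longrightarrow> g \<otimes> a \<preceq> g \<otimes> b \<longleftrightarrow> a \<preceq> b"
  by (simp add: inv_mult_group m_assoc)

lemma le_mult_D: assumes "a \<in> carrier G" "b \<in> carrier G" shows "a \<otimes> D k \<preceq> b \<otimes> D k \<longleftrightarrow> a \<preceq> b"
proof -
  have 1: "inv (a \<otimes> D k) \<otimes> (b \<otimes> D k) = D (- k) \<otimes> (inv a \<otimes> b) \<otimes> D k"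
    using assms by (simp add: inv_mult_group m_assoc D_minus)
  moreover have "D (- (- k)) \<otimes> (D (- k) \<otimes> (inv a \<otimes> b) \<otimes> D k) \<otimes> D (- k) = inv a \<otimes> b"
    using assms by (simp add: m_assoc D_minus)
  ultimately show ?thesis using D_conj_pos[of "inv a \<otimes> b" k]
      D_conj_pos[of "D (- k) \<otimes> (inv a \<otimes> b) \<otimes> D k" "- k"] by auto
qed

lemma one_le: "a \<in> carrier G \<Longrightarrow> \<one> \<preceq> a \<longleftrightarrow> a \<in> positive G" by simp

lemma le_D: "\<lbrakk>a \<in> carrier G; 0 \<le> k\<rbrakk> \<Longrightarrow> a \<preceq> a \<otimes> D k"
  by (simp add: D_nat_pos)

lemma le_len: "\<lbrakk>a \<in> carrier G; b \<in> carrier G; a \<preceq> b\<rbrakk> \<Longrightarrow> len a \<le> len b"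
  using len_ge0[of "inv a \<otimes> b"] by (simp add: len_mult len_inv)

lemma less_len: "\<lbrakk>a \<in> carrier G; b \<in> carrier G; a \<preceq> b; a \<noteq> b\<rbrakk> \<Longrightarrow> len a < len b"
  using len_pos[of "inv a \<otimes> b"]
  by (simp add: len_mult len_inv) (metis inv_equality inv_inv inv_closed)

lemma D_le_self: assumes "g \<in> carrier G" shows "\<exists>k\<ge>0. D (- k) \<preceq> g"
proof -
  obtain k :: nat where "\<Delta> [^] k \<otimes> g \<in> positive G" using dominated assms by blast
  then show ?thesis using D_int[of k] by (intro exI[of _ "int k"]) (simp add: D_minus)
qed

lemma D_mono: "j \<le> k \<Longrightarrow> D j \<preceq> D k"
  using D_nat_pos[of "k - j"] D_add[of "-j" k] by (simp add: D_minus)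

lemma ex_join2:
  assumes "a \<in> carrier G" "b \<in> carrier G"
  shows "\<exists>j\<in>carrier G. a \<preceq> j \<and> b \<preceq> j \<and> (\<forall>u\<in>carrier G. a \<preceq> u \<longrightarrow> b \<preceq> u \<longrightarrow> j \<preceq> u)"
proof -
  let ?g = "inv a \<otimes> b"
  obtain j where j: "j \<in> positive G" "inv ?g \<otimes> j \<in> positive G"
      "\<And>w. \<lbrakk>w \<in> positive G; inv ?g \<otimes> w \<in> positive G\<rbrakk> \<Longrightarrow> inv j \<otimes> w \<in> positive G"
    using ex_join[of ?g] assms by auto
  have "a \<otimes> j \<preceq> u" if "u \<in> carrier G" "a \<preceq> u" "b \<preceq> u" for u
    using j(3)[of "inv a \<otimes> u"] that assms j(1) by (simp add: inv_mult_group m_assoc)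
  then show ?thesis using j assms by (intro bexI[of _ "a \<otimes> j"]) (auto simp: inv_mult_group m_assoc)
qed

text \<open>A lower bound of maximal length is the meet: its join with any other lower bound is
  again a lower bound, is not longer, and is therefore equal to it. A sufficiently negative power of
  Delta shows that lower bounds exist.\<close>

lemma ex_meet:
  assumes a: "a \<in> carrier G" and b: "b \<in> carrier G"
  shows "\<exists>m\<in>carrier G. m \<preceq> a \<and> m \<preceq> b \<and> (\<forall>u\<in>carrier G. u \<preceq> a \<longrightarrow> u \<preceq> b \<longrightarrow> u \<preceq> m)"
proof -
  define P where "P c \<longleftrightarrow> c \<in> carrier G \<and> c \<preceq> a \<and> c \<preceq> b" for c
  obtain k1 k2 where k: "D (- k1) \<preceq> a" "D (- k2) \<preceq> b" using D_le_self a b by meson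
  have "P (D (- max k1 k2))" unfolding P_def
    using k a b le_trans[OF _ _ a D_mono[of "- max k1 k2" "-k1"]] le_trans[OF _ _ b D_mono[of "- max k1 k2" "-k2"]]
    by auto
  then obtain c where c: "P c" "\<And>d. P d \<Longrightarrow> nat (len a - len c) \<le> nat (len a - len d)"
    using ex_has_least_nat[of P _ "\<lambda>c. nat (len a - len c)"] by blast
  have "u \<preceq> c" if u: "u \<in> carrier G" "u \<preceq> a" "u \<preceq> b" for u
  proof -
    obtain j where j: "j \<in> carrier G" "c \<preceq> j" "u \<preceq> j" "P j"
      using ex_join2[of c u] c(1) u a b unfolding P_def by blast
    have "len j \<le> len a" "len c \<le> len a" using j(4) c(1) le_len a unfolding P_def by auto
    then have "len j \<le> len c" using c(2)[OF j(4)] by auto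
    then have "c = j" using less_len[of c j] j c(1) unfolding P_def by force
    then show ?thesis using j by simp
  qed
  then show ?thesis using c(1) unfolding P_def by blast
qed

definition meet (infixl "\<curlywedge>" 65) where
  "meet a b = (SOME m. m \<in> carrier G \<and> m \<preceq> a \<and> m \<preceq> b \<and> (\<forall>u\<in>carrier G. u \<preceq> a \<longrightarrow> u \<preceq> b \<longrightarrow> u \<preceq> m))"

sublocale meet_order "carrier G" "(\<preceq>)" "(\<curlywedge>)"
proof -
  have m: "a \<curlywedge> b \<in> carrier G \<and> a \<curlywedge> b \<preceq> a \<and> a \<curlywedge> b \<preceq> b \<and>
      (\<forall>u\<in>carrier G. u \<preceq> a \<longrightarrow> u \<preceq> b \<longrightarrow> u \<preceq> a \<curlywedge> b)" if "a \<in> carrier G" "b \<in> carrier G" for a b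
    unfolding meet_def by (rule someI_ex[OF ex_meet[OF that, unfolded Bex_def]])
  show "meet_order (carrier G) (\<preceq>) (\<curlywedge>)"
  proof unfold_locales
    fix a b c assume "a \<in> carrier G" "b \<in> carrier G" "c \<in> carrier G"
    then show "a \<preceq> b \<Longrightarrow> b \<preceq> c \<Longrightarrow> a \<preceq> c" "c \<preceq> a \<Longrightarrow> c \<preceq> b \<Longrightarrow> c \<preceq> a \<curlywedge> b"
      using m[of a b] le_trans[of a b c] by blast+
  qed (use m le_antisym in auto)
qed

lemma mult_meet:
  assumes "g \<in> carrier G" "a \<in> carrier G" "b \<in> carrier G"
  shows "g \<otimes> (a \<curlywedge> b) = g \<otimes> a \<curlywedge> g \<otimes> b"
proof (rule le_antisym)
  have m: "a \<curlywedge> b \<in> carrier G" "a \<curlywedge> b \<preceq> a" "a \<curlywedge> b \<preceq> b" using assms meet_le1 meet_le2 by auto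
  show "g \<otimes> (a \<curlywedge> b) \<preceq> g \<otimes> a \<curlywedge> g \<otimes> b"
    using m assms le_mult_left by (intro meet_greatest) auto
  let ?m = "g \<otimes> a \<curlywedge> g \<otimes> b"
  have "?m \<in> carrier G" "?m \<preceq> g \<otimes> a" "?m \<preceq> g \<otimes> b" using assms meet_le1 meet_le2 by auto
  then have "inv g \<otimes> ?m \<preceq> a" "inv g \<otimes> ?m \<preceq> b"
    using assms le_mult_left[of "inv g" ?m "g \<otimes> a"] le_mult_left[of "inv g" ?m "g \<otimes> b"] by auto
  then have "inv g \<otimes> ?m \<preceq> a \<curlywedge> b" using assms by (intro meet_greatest) auto
  then show "?m \<preceq> g \<otimes> (a \<curlywedge> b)" using assms le_mult_left[of g "inv g \<otimes> ?m" "a \<curlywedge> b"] by auto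
qed (use assms in auto)

lemma meet_D:
  assumes "a \<in> carrier G" "b \<in> carrier G"
  shows "(a \<curlywedge> b) \<otimes> D k = a \<otimes> D k \<curlywedge> b \<otimes> D k"
proof (rule le_antisym)
  have m: "a \<curlywedge> b \<in> carrier G" "a \<curlywedge> b \<preceq> a" "a \<curlywedge> b \<preceq> b" using assms meet_le1 meet_le2 by auto
  show "(a \<curlywedge> b) \<otimes> D k \<preceq> a \<otimes> D k \<curlywedge> b \<otimes> D k"
    using m assms le_mult_D by (intro meet_greatest) auto
  let ?m = "a \<otimes> D k \<curlywedge> b \<otimes> D k"
  have m: "?m \<in> carrier G" "?m \<preceq> a \<otimes> D k" "?m \<preceq> b \<otimes> D k" using assms meet_le1 meet_le2 by auto
  have c: "c \<otimes> D k \<otimes> D (- k) = c" "c \<otimes> D (- k) \<otimes> D k = c" if "c \<in> carrier G" for c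
    using that by (auto simp: D_minus m_assoc)
  have "?m \<otimes> D (- k) \<preceq> a" "?m \<otimes> D (- k) \<preceq> b"
    using assms m c le_mult_D[of ?m "a \<otimes> D k" "-k"] le_mult_D[of ?m "b \<otimes> D k" "-k"] by auto
  then have "?m \<otimes> D (- k) \<preceq> a \<curlywedge> b" using assms by (intro meet_greatest) auto
  then show "?m \<preceq> (a \<curlywedge> b) \<otimes> D k" using assms le_mult_D[of "?m \<otimes> D (- k)" "a \<curlywedge> b" k] c by auto
qed (use assms in auto)

text \<open>\<open>act x p\<close> is the translation of the axis of a rigid element \<open>x\<close> with infimum \<open>p\<close>.\<close>

definition act :: "'a \<Rightarrow> int \<Rightarrow> 'a \<Rightarrow> 'a" where "act x p c = x \<otimes> c \<otimes> D (- p)"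

abbreviation E :: "'a \<Rightarrow> 'a" where "E c \<equiv> c \<otimes> \<Delta>"

lemma act_closed [simp]: "\<lbrakk>x \<in> carrier G; c \<in> carrier G\<rbrakk> \<Longrightarrow> act x p c \<in> carrier G"
  by (simp add: act_def)

lemma act_act:
  "\<lbrakk>x \<in> carrier G; y \<in> carrier G; c \<in> carrier G\<rbrakk> \<Longrightarrow> act x p (act y q c) = act (x \<otimes> y) (p + q) c"
  using D_add[of "-q" "-p"] by (simp add: act_def m_assoc add.commute)

lemma act_meet: "\<lbrakk>x \<in> carrier G; a \<in> carrier G; b \<in> carrier G\<rbrakk> \<Longrightarrow> act x p (a \<curlywedge> b) = act x p a \<curlywedge> act x p b"
  by (simp add: act_def mult_meet meet_D)

lemma act_inj: "\<lbrakk>x \<in> carrier G; a \<in> carrier G; b \<in> carrier G; act x p a = act x p b\<rbrakk> \<Longrightarrow> a = b"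
  by (simp add: act_def)

lemma act_one [simp]: "c \<in> carrier G \<Longrightarrow> act \<one> 0 c = c" by (simp add: act_def)

lemma D_commute_\<Delta>: "D k \<otimes> \<Delta> = \<Delta> \<otimes> D k"
  using D_add[of k 1] D_add[of 1 k] by (simp add: add.commute)

lemma act_E: "\<lbrakk>x \<in> carrier G; c \<in> carrier G\<rbrakk> \<Longrightarrow> act x p (E c) = E (act x p c)"
  by (simp add: act_def m_assoc D_commute_\<Delta>)

lemma act_pow: "\<lbrakk>x \<in> carrier G; c \<in> carrier G\<rbrakk> \<Longrightarrow> (act x p ^^ n) c = act (x [^] n) (int n * p) c"
proof (induction n)
  case (Suc n)
  have "x [^] Suc n = x \<otimes> x [^] n" using Suc.prems by (metis nat_pow_Suc2)
  then show ?case using Suc act_act[of x "x [^] n" c p "int n * p"] by (simp add: algebra_simps)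
qed simp

lemma E_pow: "c \<in> carrier G \<Longrightarrow> (E ^^ n) c = c \<otimes> D (int n)"
proof (induction n)
  case (Suc n) then show ?case using D_add[of "int n" 1] by (simp add: m_assoc add.commute)
qed simp

lemma E_meet: "\<lbrakk>a \<in> carrier G; b \<in> carrier G\<rbrakk> \<Longrightarrow> E (a \<curlywedge> b) = E a \<curlywedge> E b"
  using meet_D[of a b 1] by simp

lemma E_bij: "bij_betw E (carrier G) (carrier G)"
  by (rule bij_betwI[of _ _ _ "\<lambda>c. c \<otimes> inv \<Delta>"]) (auto simp: m_assoc)

lemma axis_pair_act:
  assumes x: "x \<in> carrier G" and "p < q"
  shows "axis_pair (carrier G) (\<preceq>) (\<curlywedge>) (act x p) (act (inv x) (- q)) E (nat (q - p))"
proof unfold_locales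
  fix a assume a: "a \<in> carrier G"
  show "a \<preceq> E a" using le_D[OF a, of 1] by simp
  have e: "act \<one> (p - q) a = (E ^^ nat (q - p)) a"
    using a \<open>p < q\<close> by (simp add: E_pow act_def)
  show "act x p (act (inv x) (- q) a) = (E ^^ nat (q - p)) a"
    using act_act[of x "inv x" a p "-q"] x a e by simp
  show "act (inv x) (- q) (act x p a) = (E ^^ nat (q - p)) a"
    using act_act[of "inv x" x a "-q" p] x a e by simp
qed (use assms in \<open>auto simp: act_meet act_E E_meet E_bij\<close>)

section \<open>Axis sets of group elements\<close>

definition V :: "'a \<Rightarrow> int \<Rightarrow> int \<Rightarrow> 'a set" where
  "V x p q = {c \<in> carrier G. act x p c \<curlywedge> act (inv x) (- q) c = c}"

definition sh :: "'a \<Rightarrow> int \<Rightarrow> 'a \<Rightarrow> 'a" where "sh x p c = act x p c \<curlywedge> E c"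

lemma axis_V: "\<lbrakk>x \<in> carrier G; p < q\<rbrakk> \<Longrightarrow>
    axis_pair.V (carrier G) (\<curlywedge>) (act x p) (act (inv x) (- q)) = V x p q"
  by (simp add: axis_pair.V_def[OF axis_pair_act] V_def)

lemma axis_sh: "\<lbrakk>x \<in> carrier G; p < q\<rbrakk> \<Longrightarrow> axis_pair.sh (\<curlywedge>) (act x p) E = sh x p"
  by (auto simp: axis_pair.sh_def[OF axis_pair_act] sh_def fun_eq_iff)

lemma axis_co: "\<lbrakk>x \<in> carrier G; p < q\<rbrakk> \<Longrightarrow> axis_pair.co (\<curlywedge>) (act (inv x) (- q)) E = sh (inv x) (- q)"
  by (auto simp: axis_pair.co_def[OF axis_pair_act] sh_def fun_eq_iff)

lemma V_carrier: "c \<in> V x p q \<Longrightarrow> c \<in> carrier G" by (simp add: V_def)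

lemma V_inv: "x \<in> carrier G \<Longrightarrow> V (inv x) (- q) (- p) = V x p q"
  by (auto simp: V_def meet_commute)

lemma inv_pow: "x \<in> carrier G \<Longrightarrow> inv (x [^] (n::nat)) = inv x [^] n"
  by (simp add: nat_pow_inv)

lemma V_pow:
  assumes x: "x \<in> carrier G" and pq: "p < q" and c: "c \<in> V x p q" and n: "1 \<le> n"
  shows "c \<in> V (x [^] n) (int n * p) (int n * q)"
proof -
  interpret ax: axis_pair "carrier G" "(\<preceq>)" "(\<curlywedge>)" "act x p" "act (inv x) (- q)" E "nat (q - p)"
    using axis_pair_act x pq .
  obtain k where k: "n = Suc k" using n by (cases n) auto
  have "(act x p ^^ n) c \<curlywedge> (act (inv x) (- q) ^^ n) c = c"
    using ax.A_pow_B_pow[of c k k] c axis_V[OF x pq] k by simp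
  then show ?thesis using x c by (simp add: act_pow V_def inv_pow)
qed

text \<open>Left translation by g is a lattice automorphism conjugating one pair of maps into the
  other. For c = 1 it says that V x parametrizes the conjugates of x with the exponents p and
  q.\<close>

lemma V_conj:
  assumes x: "x \<in> carrier G" and g: "g \<in> carrier G" and c: "c \<in> carrier G"
  shows "c \<in> V (inv g \<otimes> x \<otimes> g) p q \<longleftrightarrow> g \<otimes> c \<in> V x p q"
proof -
  have "g \<otimes> act (inv g \<otimes> x \<otimes> g) p c = act x p (g \<otimes> c)"
    "g \<otimes> act (inv (inv g \<otimes> x \<otimes> g)) (- q) c = act (inv x) (- q) (g \<otimes> c)"
    using assms by (simp_all add: act_def m_assoc inv_mult_group)
  moreover have "act (inv g \<otimes> x \<otimes> g) p c \<curlywedge> act (inv (inv g \<otimes> x \<otimes> g)) (- q) c = c \<longleftrightarrow>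
    g \<otimes> act (inv g \<otimes> x \<otimes> g) p c \<curlywedge> g \<otimes> act (inv (inv g \<otimes> x \<otimes> g)) (- q) c = g \<otimes> c"
    using assms by (simp add: mult_meet[symmetric])
  ultimately show ?thesis using assms by (simp only: V_def mem_Collect_eq m_closed)
qed

lemma sh_closed [simp]: "\<lbrakk>x \<in> carrier G; c \<in> carrier G\<rbrakk> \<Longrightarrow> sh x p c \<in> carrier G"
  by (simp add: sh_def)

lemma sh_pow_eq:
  assumes "x \<in> carrier G" "p < q" "c \<in> V x p q" "1 \<le> n"
  shows "sh (x [^] n) (int n * p) c = sh x p c"
proof -
  interpret ax: axis_pair "carrier G" "(\<preceq>)" "(\<curlywedge>)" "act x p" "act (inv x) (- q)" E "nat (q - p)"
    using axis_pair_act assms by blast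
  obtain k where k: "n = Suc k" using assms by (cases n) auto
  have "(act x p ^^ n) c \<curlywedge> E c = sh x p c"
    using ax.A_pow_E[of c k] assms axis_V axis_sh[of x p q] unfolding k by metis
  then show ?thesis using assms V_carrier by (simp add: act_pow sh_def)
qed

lemma V_sh: "\<lbrakk>x \<in> carrier G; p < q; c \<in> V x p q\<rbrakk> \<Longrightarrow> sh x p c \<in> V x p q"
  using axis_pair.V_sh[OF axis_pair_act, of x p q] axis_V axis_sh by metis

text \<open>On axes of x the shift of x^n coincides with that of x, whose iterate of order q - p is
  the translation by x.\<close>

lemma sh_pow_root:
  assumes x: "x \<in> carrier G" "p < q" "c \<in> V x p q" and n: "1 \<le> n"
  shows "(sh (x [^] n) (int n * p) ^^ nat (q - p)) c = act x p c"
proof -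
  have "(sh (x [^] n) (int n * p) ^^ k) c = (sh x p ^^ k) c \<and> (sh x p ^^ k) c \<in> V x p q" for k
    by (induction k) (use x n in \<open>auto intro: V_sh sh_pow_eq\<close>)
  then show ?thesis using axis_pair.sh_pow_l[OF axis_pair_act, of x p q c] axis_V axis_sh x by metis
qed

lemma axis_centralizer_act:
  assumes "x \<in> carrier G" "p < q" "y \<in> carrier G" "x \<otimes> y = y \<otimes> x"
  shows "axis_centralizer (carrier G) (\<preceq>) (\<curlywedge>) (act x p) (act (inv x) (- q)) E (nat (q - p)) (act y r)"
proof -
  interpret ax: axis_pair "carrier G" "(\<preceq>)" "(\<curlywedge>)" "act x p" "act (inv x) (- q)" E "nat (q - p)"
    using axis_pair_act assms by blast
  have "inv x \<otimes> (y \<otimes> x) \<otimes> inv x = inv x \<otimes> (x \<otimes> y) \<otimes> inv x" using assms(4) by simp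
  then have "inv x \<otimes> y = y \<otimes> inv x" using assms(1,3) by (simp add: m_assoc)
  note comm = assms(4) this
  show ?thesis
  proof unfold_locales
    fix a assume a: "a \<in> carrier G"
    then show "act y r (act x p a) = act x p (act y r a)"
      "act y r (act (inv x) (- q) a) = act (inv x) (- q) (act y r a)"
      using assms(1,3) comm by (simp_all add: act_act add.commute)
    show "a = b" if "b \<in> carrier G" "act y r a = act y r b" for b
      using act_inj[OF assms(3) a that] .
  qed (use assms in \<open>simp_all add: act_meet act_E\<close>)
qed

text \<open>A converse of \<open>sh_pow_root\<close>, for any x commuting with z. It turns
  membership in V x into a fixed-point condition on V z.\<close>

lemma V_of_sh_pow:
  assumes z: "z \<in> carrier G" "P < Q" and x: "x \<in> carrier G" "z \<otimes> x = x \<otimes> z" "p \<le> q"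
    and c: "c \<in> V z P Q" "(sh z P ^^ nat (q - p)) c = act x p c"
  shows "c \<in> V x p q"
proof -
  interpret ax: axis_centralizer "carrier G" "(\<preceq>)" "(\<curlywedge>)" "act z P" "act (inv z) (- Q)" E "nat (Q - P)" "act x p"
    using axis_centralizer_act[OF z x(1) x(2)] .
  have "act x p (act (inv x) (- q) c) = (E ^^ nat (q - p)) c"
    using act_act[of x "inv x" c p "-q"] x c V_carrier E_pow by (simp add: act_def)
  moreover have "c \<in> ax.V" "(ax.sh ^^ nat (q - p)) c = act x p c"
    using c by (simp_all only: axis_V[OF z] axis_sh[OF z])
  moreover have c': "c \<in> carrier G" "act (inv x) (- q) c \<in> carrier G" using c x V_carrier by auto
  ultimately have "act x p c \<curlywedge> act (inv x) (- q) c = c" using ax.root_axis by blast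
  then show ?thesis using c' by (simp add: V_def)
qed

end

section \<open>Bounds by powers of Delta, nondegenerate axes and uniqueness of the exponents\<close>

context garside_group begin

lemma commute_inv:
  assumes "a \<in> carrier G" "b \<in> carrier G" "a \<otimes> b = b \<otimes> a" shows "a \<otimes> inv b = inv b \<otimes> a"
proof -
  have "inv b \<otimes> (a \<otimes> b) \<otimes> inv b = inv b \<otimes> (b \<otimes> a) \<otimes> inv b" using assms(3) by simp
  then show ?thesis using assms(1,2) by (simp add: m_assoc)
qed

lemma D_mult_central:
  fixes e :: nat
  assumes e: "\<And>g. g \<in> carrier G \<Longrightarrow> \<Delta> [^] e \<otimes> g = g \<otimes> \<Delta> [^] e" and g: "g \<in> carrier G"
  shows "D (int e * k) \<otimes> g = g \<otimes> D (int e * k)"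
proof -
  have j: "(\<Delta> [^] e) [^] j \<otimes> h = h \<otimes> (\<Delta> [^] e) [^] j" if "h \<in> carrier G" for j :: nat and h
    using that e by (induction j) (simp_all add: m_assoc, metis Delta_carrier m_assoc nat_pow_closed)
  have nn: "D (int e * int j) \<otimes> h = h \<otimes> D (int e * int j)" if "h \<in> carrier G" for j h
    using j[OF that, of j] by (simp only: nat_pow_pow Delta_carrier D_int flip: of_nat_mult)
  show ?thesis
  proof (cases "0 \<le> k")
    case True then show ?thesis using nn[OF g, of "nat k"] by simp
  next
    case False
    then obtain n where "k = - int n" by (intro that[of "nat (- k)"]) simp
    then have *: "D (int e * k) = inv (D (int e * int n))" by (simp add: D_minus)
    show ?thesis unfolding * using nn[OF g, of n] g by (intro commute_inv[symmetric]) auto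
  qed
qed

lemma D_central: "\<exists>e>0. \<forall>g\<in>carrier G. \<forall>k. D (int e * k) \<otimes> g = g \<otimes> D (int e * k)"
  using central D_mult_central by blast

lemma nat_D: "(D k) [^] (n::nat) = D (int n * k)"
proof (induction n)
  case (Suc n) then show ?case using D_add[of "int n * k" k] by (simp add: algebra_simps)
qed simp

lemma le_D_bound: assumes "g \<in> carrier G" "h \<in> carrier G" shows "\<exists>k\<ge>0. g \<preceq> h \<otimes> D k"
proof -
  obtain k where k: "0 \<le> k" "D (- k) \<preceq> inv g \<otimes> h"
    using D_le_self[of "inv g \<otimes> h"] assms by auto
  then have "D (- k) \<otimes> D k \<preceq> inv g \<otimes> h \<otimes> D k" using assms le_mult_D[of "D (-k)" "inv g \<otimes> h" k] by simp
  then have "g \<preceq> h \<otimes> D k" using assms by (simp add: D_minus m_assoc)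
  then show ?thesis using k by blast
qed

lemma D_shift: assumes "c \<in> carrier G" shows "c \<otimes> D j \<otimes> D k = c \<otimes> D (j + k)"
  using assms by (simp add: D_add m_assoc)

text \<open>Every nontrivial positive element has a nontrivial common prefix with Delta. By
  induction e meets each c Delta^k only in c, and some c Delta^k lies above e.\<close>

lemma le_of_meet_E:
  assumes c: "c \<in> carrier G" and e: "e \<in> carrier G" and le: "c \<preceq> e" and m: "e \<curlywedge> E c = c"
  shows "e = c"
proof -
  have "e \<curlywedge> c \<otimes> D (int k) = c" for k
  proof (induction k)
    case 0 then show ?case using le c e by (simp add: meet_commute le_iff_meet[symmetric])
  next
    case (Suc k)
    let ?f = "c \<otimes> D (int k)"
    have f: "?f \<in> carrier G" "c \<otimes> D (int (Suc k)) = E ?f" "c \<preceq> ?f"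
      using c D_shift[OF c, of "int k" 1] le_D[OF c, of "int k"] by (auto simp: add.commute)
    let ?m = "e \<curlywedge> E ?f"
    have m': "?m \<in> carrier G" "?m \<preceq> e" "?m \<preceq> E ?f" using e f meet_le1 meet_le2 by auto
    have "e \<preceq> E e" using le_D[OF e, of 1] by simp
    then have "?m \<preceq> E e" using m' e by (meson le_trans m_closed Delta_carrier)
    then have "?m \<preceq> E (e \<curlywedge> ?f)" using m' e f by (simp add: E_meet meet_greatest)
    then have "?m \<preceq> e \<curlywedge> E c" using Suc m' e c by (intro meet_greatest) auto
    moreover have "E c \<preceq> E ?f" using f(3) le_mult_D[OF c f(1), of 1] by simp
    then have "c \<preceq> ?m" using le c e f le_D[OF c, of 1]
      by (intro meet_greatest) (auto intro: le_trans[of c "E c"])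
    ultimately show ?case using m m' c e f by (intro le_antisym) auto
  qed
  moreover obtain k where "0 \<le> k" "e \<preceq> c \<otimes> D k" using le_D_bound e c by blast
  ultimately show ?thesis using c e le_iff_meet[of e "c \<otimes> D k"] by (metis Delta_carrier int_pow_closed m_closed nonneg_int_cases)
qed

lemma V_D: "\<lbrakk>x \<in> carrier G; c \<in> V x p q\<rbrakk> \<Longrightarrow> c \<otimes> D k \<in> V x p q"
proof -
  assume x: "x \<in> carrier G" and c: "c \<in> V x p q"
  have "act y r (c \<otimes> D k) = act y r c \<otimes> D k" if "y \<in> carrier G" for y r
    using that V_carrier[OF c] D_add[of k "-r"] D_add[of "-r" k]
    by (simp add: act_def m_assoc add.commute)
  then show ?thesis using x c by (simp add: V_def meet_D[symmetric])
qed

definition NB :: "'a \<Rightarrow> int \<Rightarrow> int \<Rightarrow> 'a \<Rightarrow> 'a set" where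
  "NB x p q c = {d \<in> V x p q. c \<preceq> d \<and> d \<preceq> sh (inv x) (- q) c \<and> d \<noteq> c \<and> d \<noteq> sh (inv x) (- q) c}"

lemma axis_NB: "\<lbrakk>x \<in> carrier G; p < q\<rbrakk> \<Longrightarrow>
    axis_pair.N (carrier G) (\<preceq>) (\<curlywedge>) (act x p) (act (inv x) (- q)) E = NB x p q"
  by (simp add: axis_pair.N_def[OF axis_pair_act] NB_def axis_V axis_co fun_eq_iff)

text \<open>Shifts forward along the axes of \<open>z\<close> and translates back by the root \<open>x\<close>, so that
  points on axes of \<open>x\<close> are fixed.\<close>

definition T :: "'a \<Rightarrow> int \<Rightarrow> int \<Rightarrow> 'a \<Rightarrow> int \<Rightarrow> 'a \<Rightarrow> 'a" where
  "T x p q z P c = act (inv x) (- p) ((sh z P ^^ nat (q - p)) c)"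

lemma T_eq_iff: "\<lbrakk>x \<in> carrier G; z \<in> carrier G; c \<in> carrier G\<rbrakk> \<Longrightarrow>
  T x p q z P c = c \<longleftrightarrow> (sh z P ^^ nat (q - p)) c = act x p c"
proof -
  assume a: "x \<in> carrier G" "z \<in> carrier G" "c \<in> carrier G"
  have w: "(sh z P ^^ k) c \<in> carrier G" for k by (induction k) (use a in auto)
  have "act x p (act (inv x) (- p) ((sh z P ^^ nat (q - p)) c)) = (sh z P ^^ nat (q - p)) c"
    using a w act_act[of x "inv x" _ p "-p"] by simp
  moreover have "act (inv x) (- p) (act x p c) = c" using a act_act[of "inv x" x c "-p" p] by simp
  ultimately show ?thesis unfolding T_def by metis
qed

lemma axis_aut_T:
  assumes z: "z \<in> carrier G" "P < Q" and x: "x \<in> carrier G" "z \<otimes> x = x \<otimes> z"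
  shows "axis_aut (carrier G) (\<preceq>) (\<curlywedge>) (act z P) (act (inv z) (- Q)) E (nat (Q - P)) (T x p q z P)"
proof -
  interpret ax: axis_centralizer "carrier G" "(\<preceq>)" "(\<curlywedge>)" "act z P" "act (inv z) (- Q)" E "nat (Q - P)" "act (inv x) (- p)"
    using axis_centralizer_act[OF z _ commute_inv] x z by blast
  have "T x p q z P = (\<lambda>c. act (inv x) (- p) ((ax.sh ^^ nat (q - p)) c))"
    by (simp add: T_def axis_sh[OF z] fun_eq_iff)
  then show ?thesis using ax.axis_aut_sh_pow[of "nat (q - p)"] by simp
qed

text \<open>Membership in V x means being fixed by T, so \<open>fix_all\<close> applies with base
  point 1. A point that is not above 1 is first multiplied by a power of Delta, which preserves both
  axis sets.\<close>

lemma V_root: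
  assumes z: "z \<in> carrier G" "P < Q" and x: "x \<in> carrier G" "z \<otimes> x = x \<otimes> z" "p \<le> q"
    and one: "\<one> \<in> V z P Q" "\<one> \<in> V x p q" "T x p q z P \<one> = \<one>"
    and fixN: "\<And>d. d \<in> NB z P Q \<one> \<Longrightarrow> T x p q z P d = d"
    and rot: "\<And>d a b. \<lbrakk>d \<in> V z P Q; T x p q z P d = d; a \<in> NB z P Q d; T x p q z P a = a; b \<in> NB z P Q d\<rbrakk>
        \<Longrightarrow> T x p q z P b = b"
    and black: "\<And>c d. \<lbrakk>c \<in> V z P Q; d \<in> V z P Q; c \<preceq> d; d \<preceq> sh z P c\<rbrakk> \<Longrightarrow> d = c \<or> d = sh z P c"
  shows "V z P Q \<subseteq> V x p q"
proof
  fix e assume e: "e \<in> V z P Q"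
  interpret aut: axis_aut "carrier G" "(\<preceq>)" "(\<curlywedge>)" "act z P" "act (inv z) (- Q)" E "nat (Q - P)" "T x p q z P"
    using axis_aut_T[OF z x(1,2)] .
  obtain k where k: "0 \<le> k" "\<one> \<preceq> e \<otimes> D k" using le_D_bound[of \<one> e] V_carrier[OF e] by auto
  let ?e = "e \<otimes> D k"
  have e': "?e \<in> V z P Q" using V_D z e by blast
  have "T x p q z P ?e = ?e"
  proof (rule aut.fix_all[of len \<one>])
    show "d = c" if "c \<in> carrier G" "d \<in> carrier G" "c \<preceq> d" "d \<curlywedge> E c = c" for c d
      using le_of_meet_E that by blast
    show "len c < len d" if "c \<in> carrier G" "d \<in> carrier G" "c \<preceq> d" "c \<noteq> d" for c d
      using less_len that by blast
    show "T x p q z P d = d" if "d \<in> aut.N \<one>" for d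
      using that fixN unfolding axis_NB[OF z] by blast
    show "T x p q z P b = b" if "d \<in> aut.V" "T x p q z P d = d" "a \<in> aut.N d" "T x p q z P a = a" "b \<in> aut.N d" for d a b
      using that rot unfolding axis_NB[OF z] axis_V[OF z] by blast
    show "d = c \<or> d = aut.sh c" if "c \<in> aut.V" "d \<in> aut.V" "c \<preceq> d" "d \<preceq> aut.sh c" for c d
      using that black unfolding axis_sh[OF z] axis_V[OF z] by blast
  qed (use one e' k(2) in \<open>simp_all only: axis_V[OF z]\<close>)
  then have "(sh z P ^^ nat (q - p)) ?e = act x p ?e"
    using T_eq_iff x z V_carrier[OF e'] by blast
  then have "?e \<in> V x p q" using V_of_sh_pow[OF z x e'] by blast
  then have "?e \<otimes> D (- k) \<in> V x p q" using V_D x by blast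
  then show "e \<in> V x p q" using V_carrier[OF e] D_shift[of e k "-k"] by simp
qed

text \<open>A fixed point of sh is fixed by its iterate of order q - p, the map taking c to x c
  Delta^(-p).\<close>

lemma sh_neq:
  assumes x: "x \<in> carrier G" "p < q" and c: "c \<in> V x p q" and ne: "inv c \<otimes> x \<otimes> c \<noteq> D p"
  shows "sh x p c \<noteq> c"
proof
  assume eq: "sh x p c = c"
  have cG: "c \<in> carrier G" using c V_carrier by auto
  have "(sh x p ^^ k) c = c" for k by (induction k) (auto simp: eq)
  then have "act x p c = c" using axis_pair.sh_pow_l[OF axis_pair_act[OF x]] c by (metis axis_V axis_sh x)
  then have "inv c \<otimes> (x \<otimes> c \<otimes> D (- p)) \<otimes> D p = inv c \<otimes> c \<otimes> D p" unfolding act_def by simp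
  then show False using ne cG x by (simp add: m_assoc D_minus)
qed

lemma sh_inv_sh: assumes x: "x \<in> carrier G" "p < q" and c: "c \<in> V x p q"
  shows "sh (inv x) (- q) (sh x p c) = E c" "sh x p (sh (inv x) (- q) c) = E c"
proof -
  interpret ax: axis_pair "carrier G" "(\<preceq>)" "(\<curlywedge>)" "act x p" "act (inv x) (- q)" E "nat (q - p)"
    using axis_pair_act x by blast
  show "sh (inv x) (- q) (sh x p c) = E c" "sh x p (sh (inv x) (- q) c) = E c"
    using ax.co_sh[of c] ax.sh_co[of c] c by (simp_all add: axis_V[OF x] axis_sh[OF x] axis_co[OF x])
qed

lemma sh_inj: assumes x: "x \<in> carrier G" "p < q" and "c \<in> V x p q" "d \<in> V x p q" "sh x p c = sh x p d"
  shows "c = d"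
  using axis_pair.sh_inj[OF axis_pair_act[OF x]] assms(3-) by (simp add: axis_V[OF x] axis_sh[OF x])

lemma conj_inv_D:
  assumes "x \<in> carrier G" "c \<in> carrier G" "inv c \<otimes> inv x \<otimes> c = D k" shows "inv c \<otimes> x \<otimes> c = D (- k)"
  unfolding D_minus assms(3)[symmetric] using assms(1,2) by (simp add: inv_mult_group m_assoc)

text \<open>Since E c = sh (co c), equality would give co c = c by injectivity. But co is the shift
  of the inverse, so \<open>sh_neq\<close> excludes this.\<close>

lemma sh_neq_E:
  assumes x: "x \<in> carrier G" "p < q" and c: "c \<in> V x p q" and ne: "inv c \<otimes> x \<otimes> c \<noteq> D q"
  shows "sh x p c \<noteq> E c"
proof
  assume eq: "sh x p c = E c"
  have cG: "c \<in> carrier G" using c V_carrier by auto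
  let ?f = "sh (inv x) (- q) c"
  have c': "c \<in> V (inv x) (- q) (- p)" using V_inv c x by simp
  have f: "?f \<in> V x p q" using V_sh[OF _ _ c'] V_inv x by simp
  have "?f = c" using sh_inj[OF x f c] sh_inv_sh(2)[OF x c] eq by simp
  moreover have "?f \<noteq> c"
    using sh_neq[OF _ _ c'] ne x conj_inv_D[OF x(1) cG, of "-q"] by auto
  ultimately show False by simp
qed

text \<open>Guarantees nondegenerate axes: neither sh nor co then has a fixed point on an axis
  set.\<close>

definition nonpower :: "'a \<Rightarrow> bool" where
  "nonpower x \<longleftrightarrow> (\<forall>g\<in>carrier G. \<forall>k. inv g \<otimes> x \<otimes> g \<noteq> D k)"

lemma nonpower_inv: "\<lbrakk>x \<in> carrier G; nonpower x\<rbrakk> \<Longrightarrow> nonpower (inv x)"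
  unfolding nonpower_def using conj_inv_D by blast

text \<open>Otherwise the shift of x^n at c would be E c, although it equals the shift of x. So the
  powers of x never gain a full Delta over the rate p.\<close>

lemma not_E_le:
  assumes x: "x \<in> carrier G" "p < q" and c: "c \<in> V x p q" and ne: "inv c \<otimes> x \<otimes> c \<noteq> D q" and n: "1 \<le> n"
  shows "\<not> E c \<preceq> act (x [^] n) (int n * p) c"
proof
  have cG: "c \<in> carrier G" using c V_carrier by auto
  assume "E c \<preceq> act (x [^] n) (int n * p) c"
  then have "sh (x [^] n) (int n * p) c = E c"
    using x cG by (simp add: sh_def le_iff_meet meet_commute)
  then show False using sh_pow_eq[OF x c n] sh_neq_E[OF x c ne] by simp
qed

text \<open>The exponent p is a growth rate. The points c and c' differ by bounded powers of Delta,
  so if p' > p, the growth along the orbit of c' would eventually put x^n c Delta^(-np) above c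
  Delta, against \<open>not_E_le\<close>.\<close>

lemma V_exp_le:
  assumes x: "x \<in> carrier G" "p < q" "p' < q'" and c: "c \<in> V x p q" and c': "c' \<in> V x p' q'"
    and ne: "inv c \<otimes> x \<otimes> c \<noteq> D q"
  shows "p' \<le> p"
proof (rule ccontr)
  assume "\<not> p' \<le> p"
  then have lt: "p < p'" by simp
  have G: "c \<in> carrier G" "c' \<in> carrier G" using c c' V_carrier by auto
  obtain a1 where a1: "0 \<le> a1" "c' \<preceq> c \<otimes> D a1" using le_D_bound G by blast
  obtain a2 where a2: "0 \<le> a2" "c \<preceq> c' \<otimes> D a2" using le_D_bound G by blast
  \<comment> \<open>The gain is n (p' - p), at least n. The comparisons between c and c' cost a1 +
    a2 factors Delta, and one factor has to remain.\<close>
  define n where "n = nat (a1 + a2 + 1)"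
  have n: "1 \<le> n" "int n = a1 + a2 + 1" using a1 a2 by (auto simp: n_def)
  let ?y = "x [^] n"
  have y: "?y \<in> carrier G" using x by simp
  define s where "s = int n * p' - int n * p"
  have "int n * 1 \<le> int n * (p' - p)" using lt by (intro mult_left_mono) auto
  then have s: "1 \<le> s - a1 - a2" using n by (simp add: s_def right_diff_distrib)
  have "c' \<in> V ?y (int n * p') (int n * q')" using V_pow[OF x(1) x(3) c' n(1)] .
  then have 1: "c' \<preceq> act ?y (int n * p') c'"
    using meet_le1[of "act ?y (int n * p') c'" "act (inv ?y) (- (int n * q')) c'"] y G by (simp add: V_def)
  have s1: "E c \<preceq> c \<otimes> D (s - a1 - a2)"
    using D_mono[OF s] G by (simp add: le_mult_left inv_mult_group m_assoc)
  have s2: "c \<otimes> D (s - a1 - a2) \<preceq> c' \<otimes> D (s - a1)"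
    using le_mult_D[of c "c' \<otimes> D a2" "s - a1 - a2"] a2 G by (simp add: D_shift)
  have s3: "c' \<otimes> D (s - a1) \<preceq> act ?y (int n * p') c' \<otimes> D (s - a1)"
    using le_mult_D[OF _ _] 1 G y by simp
  have s4: "act ?y (int n * p') c' \<otimes> D (s - a1) \<preceq> act ?y (int n * p) c"
  proof -
    have "c' \<otimes> D (- a1) \<preceq> c" using le_mult_D[of c' "c \<otimes> D a1" "-a1"] a1 G by (simp add: D_shift)
    then have "?y \<otimes> (c' \<otimes> D (- a1)) \<preceq> ?y \<otimes> c" using le_mult_left G y by simp
    then have "?y \<otimes> (c' \<otimes> D (- a1)) \<otimes> D (- (int n * p)) \<preceq> ?y \<otimes> c \<otimes> D (- (int n * p))"
      using le_mult_D G y by simp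
    moreover have "?y \<otimes> (c' \<otimes> D (- a1)) \<otimes> D (- (int n * p)) = act ?y (int n * p') c' \<otimes> D (s - a1)"
    proof -
      have "D (- a1) \<otimes> D (- (int n * p)) = D (- (int n * p')) \<otimes> D (s - a1)"
        unfolding D_add[symmetric] by (rule arg_cong[of _ _ D]) (simp add: s_def)
      then show ?thesis using G y by (simp add: act_def m_assoc)
    qed
    ultimately show ?thesis by (simp add: act_def)
  qed
  have "E c \<preceq> act ?y (int n * p) c"
    by (rule le_trans[OF _ _ _ le_trans[OF _ _ _ s1 s2] le_trans[OF _ _ _ s3 s4]]) (use G y in auto)
  then show False using not_E_le[OF x(1,2) c ne n(1)] by simp
qed

lemma V_exp_unique:
  assumes x: "x \<in> carrier G" "p < q" "p' < q'" and c: "c \<in> V x p q" and c': "c' \<in> V x p' q'"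
    and np: "nonpower x"
  shows "p = p'" "q = q'"
proof -
  have G: "c \<in> carrier G" "c' \<in> carrier G" using c c' V_carrier by auto
  show "p = p'"
    using V_exp_le[OF x c c'] V_exp_le[OF x(1,3,2) c' c] np G unfolding nonpower_def by force
  have i: "c \<in> V (inv x) (- q) (- p)" "c' \<in> V (inv x) (- q') (- p')" using V_inv c c' x by auto
  have "- q = - q'"
    using V_exp_le[OF _ _ _ i] V_exp_le[OF _ _ _ i(2,1)] nonpower_inv[OF x(1) np] G x unfolding nonpower_def by force
  then show "q = q'" by simp
qed

text \<open>Powers of Delta with exponent divisible by e are central, so a conjugacy of y^n with
  Delta^k becomes the equation y^(ne) = Delta^(ek). Then \<open>not_E_le\<close> for y and for its
  inverse gives ek <= nep and neq <= ek, against p < q.\<close>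

lemma nonpower_pow:
  fixes n :: nat
  assumes y: "y \<in> carrier G" "p < q" "\<one> \<in> V y p q" "\<And>k. y \<noteq> D k" and n: "1 \<le> n"
  shows "nonpower (y [^] n)"
  unfolding nonpower_def
proof (intro ballI allI notI)
  fix g k assume g: "g \<in> carrier G" and eq: "inv g \<otimes> y [^] n \<otimes> g = D k"
  obtain e where e: "0 < e" "\<And>g k. g \<in> carrier G \<Longrightarrow> D (int e * k) \<otimes> g = g \<otimes> D (int e * k)"
    using D_central by blast
  have "g \<otimes> (inv g \<otimes> w \<otimes> g) \<otimes> inv g = w" if "w \<in> carrier G" for w
    using that g by (simp add: m_assoc)
  from this[of "y [^] n"] have "y [^] n = g \<otimes> D k \<otimes> inv g" using eq y(1) by simp
  then have "(y [^] n) [^] j = g \<otimes> (D k) [^] j \<otimes> inv g" for j :: nat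
    by (induction j) (use g in \<open>simp_all add: m_assoc\<close>)
  then have "y [^] (n * e) = g \<otimes> D (int e * k) \<otimes> inv g" using y by (simp add: nat_pow_pow nat_D)
  moreover have "g \<otimes> D (int e * k) = D (int e * k) \<otimes> g" using e(2)[OF g] by simp
  ultimately have pw: "y [^] (n * e) = D (int e * k)" using g by (simp add: m_assoc)
  have N: "1 \<le> n * e" using n e by simp
  have no: "\<not> E \<one> \<preceq> act (y [^] (n * e)) (int (n * e) * p) \<one>"
    using not_E_le[OF y(1,2,3) _ N] y(1,4) by simp
  have y': "\<one> \<in> V (inv y) (- q) (- p)" using V_inv y by simp
  have no': "\<not> E \<one> \<preceq> act (inv y [^] (n * e)) (int (n * e) * (- q)) \<one>"
    using not_E_le[OF _ _ y' _ N] y(1,2) conj_inv_D[OF y(1), of \<one>] y(4) by auto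
  have "\<not> D 1 \<preceq> D (int e * k - int (n * e) * p)"
    using no unfolding pw act_def using D_add[of "int e * k" "- (int (n*e) * p)"] by simp
  then have "int e * k - int (n * e) * p < 1" using D_mono[of 1 "int e * k - int (n * e) * p"] by (meson not_less)
  moreover have "\<not> D 1 \<preceq> D (- (int e * k) + int (n * e) * q)"
    using no' unfolding act_def inv_pow[OF y(1), symmetric] pw using D_add[of "- (int e * k)" "int (n*e) * q"]
    by (simp add: D_minus)
  then have "- (int e * k) + int (n * e) * q < 1"
    using D_mono[of 1 "- (int e * k) + int (n * e) * q"] by (meson not_less)
  moreover have "int (n * e) * p < int (n * e) * q" using y(2) N by (intro mult_strict_left_mono) auto
  ultimately show False by simp
qed

end

section \<open>Normal forms and rigidity\<close>

context garside_group begin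

lemma prefix_order_meet:
  assumes "a \<in> carrier G" "b \<in> carrier G"
  shows "Lattice.meet (prefix_order G) a b = a \<curlywedge> b"
proof -
  have g: "greatest (prefix_order G) m (Lower (prefix_order G) {a, b}) \<longleftrightarrow> m = a \<curlywedge> b" for m
  proof
    assume "greatest (prefix_order G) m (Lower (prefix_order G) {a, b})"
    then have m: "m \<in> carrier G" "m \<preceq> a" "m \<preceq> b" "\<And>u. \<lbrakk>u \<in> carrier G; u \<preceq> a; u \<preceq> b\<rbrakk> \<Longrightarrow> u \<preceq> m"
      using assms by (auto simp: greatest_def Lower_def prefix_order_def)
    show "m = a \<curlywedge> b"
      using m(1-3) m(4)[OF meet_closed[OF assms] meet_le1[OF assms] meet_le2[OF assms]] assms
      by (intro le_antisym meet_greatest) auto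
  next
    assume "m = a \<curlywedge> b"
    then show "greatest (prefix_order G) m (Lower (prefix_order G) {a, b})"
      using assms meet_le1 meet_le2 meet_greatest by (auto simp: greatest_def Lower_def prefix_order_def)
  qed
  then show ?thesis by (simp add: Lattice.meet_def Lattice.inf_def)
qed

lemma simples_iff: "s \<in> simples G \<longleftrightarrow> s \<in> positive G \<and> s \<preceq> \<Delta>"
  by (auto simp: simples_def prefix_order_def)

lemma simples_carrier: "s \<in> simples G \<Longrightarrow> s \<in> carrier G"
  by (simp add: simples_def)

lemma left_weighted_iff:
  "left_weighted G s t \<longleftrightarrow> s \<in> simples G \<and> t \<in> simples G \<and> t \<curlywedge> inv s \<otimes> \<Delta> = \<one>"
  unfolding left_weighted_def right_complement_def
  by (auto simp: prefix_order_meet simples_carrier)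

abbreviation prodl :: "'a list \<Rightarrow> 'a" where "prodl xs \<equiv> foldr (\<otimes>) xs \<one>"

lemma prodl_closed [simp]: "set xs \<subseteq> carrier G \<Longrightarrow> prodl xs \<in> carrier G"
  by (induction xs) auto

lemma prodl_pos: "set xs \<subseteq> positive G \<Longrightarrow> prodl xs \<in> positive G"
  by (induction xs) (auto intro: pos_mult)

lemma prodl_append: "\<lbrakk>set xs \<subseteq> carrier G; set ys \<subseteq> carrier G\<rbrakk> \<Longrightarrow> prodl (xs @ ys) = prodl xs \<otimes> prodl ys"
  by (induction xs) (auto simp: m_assoc)

lemma eq_one: "\<lbrakk>a \<in> positive G; a \<preceq> \<one>\<rbrakk> \<Longrightarrow> a = \<one>"
  using le_antisym[of a \<one>] by simp

lemma meet_pos: "\<lbrakk>a \<in> positive G; b \<in> positive G\<rbrakk> \<Longrightarrow> a \<curlywedge> b \<in> positive G"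
  using meet_greatest[of a b \<one>] by simp

text \<open>A common prefix of a and b Delta^j is also a prefix of a Delta^j, hence of the meet of a
  and b times Delta^j, which is Delta^j.\<close>

lemma meet_D_split:
  assumes a: "a \<in> positive G" and b: "b \<in> positive G" and m: "a \<curlywedge> b = \<one>" and j: "0 \<le> j"
  shows "a \<curlywedge> b \<otimes> D j = a \<curlywedge> D j"
proof (rule le_antisym)
  have G: "a \<in> carrier G" "b \<in> carrier G" using a b by auto
  have "a \<curlywedge> b \<otimes> D j \<preceq> a \<otimes> D j"
    using G le_D[OF G(1) j] by (intro meet_le1_trans) auto
  then have "a \<curlywedge> b \<otimes> D j \<preceq> a \<otimes> D j \<curlywedge> b \<otimes> D j"
    using G by (intro meet_greatest meet_le2) auto
  then have "a \<curlywedge> b \<otimes> D j \<preceq> D j" using G m by (simp flip: meet_D)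
  then show "a \<curlywedge> b \<otimes> D j \<preceq> a \<curlywedge> D j" using G by (intro meet_greatest meet_le1) auto
  have "D j \<preceq> b \<otimes> D j" using le_mult_D[of \<one> b j] G b by simp
  then show "a \<curlywedge> D j \<preceq> a \<curlywedge> b \<otimes> D j" using G by (intro meet_mono le_refl) auto
qed (use assms in auto)

lemma complement_simple: "s \<in> simples G \<Longrightarrow> inv s \<otimes> \<Delta> \<in> simples G"
  using conj_pos[of s] by (auto simp: simples_iff inv_mult_group m_assoc)

text \<open>The greedy property, source of uniqueness and of the infimum and supremum. Write
  Delta^(j+1) as x c Delta^j with c the complement of x and cancel x. The remaining product meets c
  trivially because its head does, and \<open>meet_D_split\<close> removes c.\<close>

lemma prodl_meet_D:
  assumes "set xs \<subseteq> simples G" "successively (left_weighted G) xs"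
  shows "prodl xs \<curlywedge> D (int k) = prodl (take k xs)"
  using assms
proof (induction xs arbitrary: k)
  case Nil
  then show ?case using D_nat_pos[of "int k"] by (simp add: le_iff_meet[symmetric])
next
  case (Cons x xs)
  have x: "x \<in> simples G" "x \<in> positive G" "x \<preceq> \<Delta>" and xs: "set xs \<subseteq> simples G"
    using Cons.prems by (auto simp: simples_iff)
  have lw: "successively (left_weighted G) xs" using Cons.prems by (cases xs) auto
  let ?X = "prodl xs" and ?c = "inv x \<otimes> \<Delta>"
  have X: "?X \<in> positive G" using xs by (intro prodl_pos) (auto simp: simples_iff)
  have c: "?c \<in> positive G" "?c \<preceq> \<Delta>" using complement_simple[OF x(1)] by (auto simp: simples_iff)
  have G: "x \<in> carrier G" "?X \<in> carrier G" "?c \<in> carrier G" using x X c by blast+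
  have m: "?X \<curlywedge> ?c = \<one>"
  proof (cases xs)
    case Nil then show ?thesis using c by (simp add: le_iff_meet[symmetric])
  next
    case (Cons y ys)
    have y: "left_weighted G x y" using Cons.prems \<open>xs = y # ys\<close> by auto
    then have yG: "y \<in> carrier G" "y \<curlywedge> ?c = \<one>" by (auto simp: left_weighted_iff simples_carrier)
    have t1: "prodl (take 1 xs) = y" using Cons yG(1) by simp
    have y_eq: "?X \<curlywedge> \<Delta> = y" using Cons.IH[OF xs lw, of 1] unfolding t1 by simp
    have "?X \<curlywedge> ?c \<preceq> ?X \<curlywedge> \<Delta>"
      by (rule meet_mono[OF G(2,3,2) Delta_carrier le_refl[OF G(2)] c(2)])
    then have "?X \<curlywedge> ?c \<preceq> y \<curlywedge> ?c"
      unfolding y_eq by (rule meet_greatest[OF yG(1) G(3) meet_closed[OF G(2,3)] _ meet_le2[OF G(2,3)]])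
    then show ?thesis unfolding yG(2) by (rule eq_one[OF meet_pos[OF X c(1)]])
  qed
  show ?case
  proof (cases k)
    case 0
    have "x \<otimes> ?X \<in> positive G" using x X pos_mult by blast
    then show ?thesis using 0 G meet_commute[of "x \<otimes> ?X" \<one>] by (simp add: le_iff_meet[symmetric])
  next
    case (Suc j)
    have "D (int (Suc j)) = x \<otimes> (?c \<otimes> D (int j))"
      using G D_add[of 1 "int j"] by (simp add: m_assoc)
    then have "prodl (x # xs) \<curlywedge> D (int k) = x \<otimes> (?X \<curlywedge> ?c \<otimes> D (int j))"
      using G Suc by (simp add: mult_meet)
    also have "\<dots> = x \<otimes> (?X \<curlywedge> D (int j))"
      using meet_D_split[OF X c(1) m] by simp
    also have "\<dots> = prodl (take k (x # xs))" using Cons.IH[OF xs lw] Suc by simp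
    finally show ?thesis .
  qed
qed

text \<open>Split off the meet of g with Delta, which is nontrivial by \<open>le_of_meet_E\<close>.
  Its maximality makes the junction with the next factor left-weighted.\<close>

lemma ex_left_weighted_list:
  assumes "g \<in> positive G"
  shows "\<exists>xs. set xs \<subseteq> simples G - {\<one>} \<and> successively (left_weighted G) xs \<and> g = prodl xs"
  using assms
proof (induction "nat (len g)" arbitrary: g rule: less_induct)
  case less
  show ?case
  proof (cases "g = \<one>")
    case True then show ?thesis by (intro exI[of _ "[]"]) auto
  next
    case False
    let ?x = "g \<curlywedge> \<Delta>"
    have g: "g \<in> carrier G" using less by auto
    have x: "?x \<in> positive G" using less by (simp add: meet_pos)
    have xle: "?x \<preceq> g" "?x \<preceq> \<Delta>" using g by (auto intro: meet_le1 meet_le2)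
    have xs: "?x \<in> simples G" using x xle by (simp add: simples_iff)
    have x1: "?x \<noteq> \<one>" using le_of_meet_E[of \<one> g] less.prems False g by auto
    let ?h = "inv ?x \<otimes> g"
    have h: "?h \<in> positive G" "?h \<in> carrier G" "g = ?x \<otimes> ?h" using xle g by auto
    have "len g = len ?x + len ?h" using h x len_mult by (metis posD)
    then have "nat (len ?h) < nat (len g)" using len_pos[OF x x1] len_ge0[OF h(1)] by simp
    from less.hyps[OF this h(1)] obtain ys where
      ys: "set ys \<subseteq> simples G - {\<one>}" "successively (left_weighted G) ys" "?h = prodl ys" by blast
    have "left_weighted G ?x y" if "ys = y # zs" for y zs
    proof -
      have y: "y \<in> simples G" "y \<in> carrier G" using ys that simples_carrier by auto
      let ?c = "inv ?x \<otimes> \<Delta>"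
      have c: "?c \<in> simples G" "?c \<in> carrier G" using complement_simple[OF xs] simples_carrier by auto
      have "?h \<curlywedge> \<Delta> = y" using prodl_meet_D[of ys 1] ys that y by auto
      then have yh: "y \<preceq> ?h" using h meet_le1[of ?h \<Delta>] by auto
      have "y \<curlywedge> ?c \<preceq> ?h" using yh y c h by (intro meet_le1_trans) auto
      then have "?x \<otimes> (y \<curlywedge> ?c) \<preceq> ?x \<otimes> ?h" using le_mult_left[of ?x "y \<curlywedge> ?c" ?h] y c h x by auto
      moreover have "y \<curlywedge> ?c \<preceq> ?c" using y c by (intro meet_le2) auto
      then have "?x \<otimes> (y \<curlywedge> ?c) \<preceq> ?x \<otimes> ?c" using le_mult_left[of ?x "y \<curlywedge> ?c" ?c] y c x by auto
      moreover have "?x \<otimes> ?c = \<Delta>" using x by auto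
      ultimately have "?x \<otimes> (y \<curlywedge> ?c) \<preceq> ?x \<otimes> \<one>" using h x y c g by (auto intro!: meet_greatest)
      then have "y \<curlywedge> ?c \<preceq> \<one>" using le_mult_left[of ?x "y \<curlywedge> ?c" \<one>] y c x by auto
      moreover have "y \<curlywedge> ?c \<in> positive G" using y(1) c(1) unfolding simples_iff by (intro meet_pos) blast+
      ultimately have "y \<curlywedge> ?c = \<one>" by (rule eq_one[rotated])
      then show ?thesis using xs y c by (simp add: left_weighted_iff)
    qed
    then have "successively (left_weighted G) (?x # ys)" using ys by (cases ys) auto
    then show ?thesis using ys xs x1 h by (intro exI[of _ "?x # ys"]) auto
  qed
qed

lemma left_weighted_list_unique:
  assumes "set xs \<subseteq> simples G - {\<one>}" "successively (left_weighted G) xs"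
    and "set ys \<subseteq> simples G - {\<one>}" "successively (left_weighted G) ys"
    and "prodl xs = prodl ys"
  shows "xs = ys"
  using assms
proof (induction xs arbitrary: ys)
  case Nil
  show ?case
  proof (cases ys)
    case (Cons y zs)
    have "\<one> \<curlywedge> \<Delta> = y"
      using Nil prodl_meet_D[of ys 1] Cons simples_carrier[of y] by auto
    moreover have "\<one> \<curlywedge> \<Delta> = \<one>" using le_iff_meet[of \<one> \<Delta>] by simp
    ultimately show ?thesis using Nil Cons by auto
  qed simp
next
  case (Cons x xs)
  have x: "x \<in> simples G" "x \<in> carrier G" "x \<noteq> \<one>" "set xs \<subseteq> simples G - {\<one>}" "set xs \<subseteq> carrier G"
    using Cons.prems simples_carrier by auto
  have px: "prodl (x # xs) \<curlywedge> \<Delta> = x"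
    using Cons.prems prodl_meet_D[of "x # xs" 1] x by auto
  obtain y zs where ys: "ys = y # zs"
  proof (cases ys)
    case Nil
    then have "\<one> \<curlywedge> \<Delta> = x" using px Cons.prems by simp
    moreover have "\<one> \<curlywedge> \<Delta> = \<one>" using le_iff_meet[of \<one> \<Delta>] by simp
    ultimately show ?thesis using x by simp
  qed auto
  have y: "y \<in> simples G" "y \<in> carrier G" "set zs \<subseteq> simples G - {\<one>}" "set zs \<subseteq> carrier G"
    using Cons.prems ys simples_carrier by auto
  have "prodl ys \<curlywedge> \<Delta> = y" using Cons.prems prodl_meet_D[of ys 1] ys y by auto
  then have xy: "x = y" using px Cons.prems by simp
  then have "prodl xs = prodl zs" using Cons.prems ys x y by simp
  moreover have "successively (left_weighted G) xs" "successively (left_weighted G) zs"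
    using Cons.prems ys by (auto simp: successively_Cons)
  ultimately show ?case using Cons.IH[of zs] x y ys xy by simp
qed

lemma is_normal_form_iff:
  "is_normal_form G x (p, xs) \<longleftrightarrow> x = D p \<otimes> prodl xs \<and> set xs \<subseteq> simples G - {\<one>, \<Delta>} \<and>
     successively (left_weighted G) xs"
  by (simp add: is_normal_form_def successively_conv_nth)

text \<open>Delta is not a prefix of the product of the factors, for the greedy property would make
  it the first factor. This determines p for the uniqueness of normal forms.\<close>

lemma normal_form_inf:
  assumes "is_normal_form G x (p, xs)" shows "D k \<preceq> x \<longleftrightarrow> k \<le> p"
proof -
  have x: "x = D p \<otimes> prodl xs" "set xs \<subseteq> simples G - {\<one>, \<Delta>}" "successively (left_weighted G) xs"
    using assms by (auto simp: is_normal_form_iff)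
  have X: "prodl xs \<in> positive G" using x by (intro prodl_pos) (auto simp: simples_iff)
  have no: "\<not> \<Delta> \<preceq> prodl xs"
  proof
    assume "\<Delta> \<preceq> prodl xs"
    then have "prodl xs \<curlywedge> \<Delta> = \<Delta>" using X le_iff_meet[of \<Delta> "prodl xs"] meet_commute by simp
    moreover have "set xs \<subseteq> simples G" using x(2) by auto
    ultimately have *: "prodl (take 1 xs) = \<Delta>" using prodl_meet_D[of xs 1] x(3) by simp
    show False
    proof (cases xs)
      case Nil then show ?thesis using * Delta_neq_one by simp
    next
      case (Cons y ys)
      then have "y \<in> carrier G" using x simples_carrier by auto
      then show ?thesis using * Cons x by auto
    qed
  qed
  have eq: "D k \<preceq> x \<longleftrightarrow> D (k - p) \<preceq> prodl xs"
    using le_mult_left[of "D p" "D (k - p)" "prodl xs"] X x D_add[of p "k - p"] by simp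
  show ?thesis
  proof (cases "k \<le> p")
    case True
    then have "D (k - p) \<preceq> \<one>" using D_mono[of "k - p" 0] by simp
    then show ?thesis using eq True X le_trans[of "D (k - p)" \<one> "prodl xs"] by simp
  next
    case False
    then have "\<Delta> \<preceq> D (k - p)" using D_mono[of 1 "k - p"] by simp
    then show ?thesis using eq False X no le_trans[of \<Delta> "D (k - p)" "prodl xs"] by auto
  qed
qed

text \<open>In a left-weighted list of nontrivial factors, Delta can be preceded only by Delta,
  since the complement of its predecessor must be trivial. So all factors Delta stand in front and
  can be absorbed into the exponent.\<close>

lemma ex_normal_form:
  assumes x: "x \<in> carrier G" shows "\<exists>p xs. is_normal_form G x (p, xs)"
proof -
  obtain k where k: "D (- k) \<preceq> x" using D_le_self x by blast
  then have "D k \<otimes> x \<in> positive G" by (simp add: D_minus)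
  then obtain xs where xs: "set xs \<subseteq> simples G - {\<one>}" "successively (left_weighted G) xs"
      "D k \<otimes> x = prodl xs" using ex_left_weighted_list by blast
  let ?t = "takeWhile ((=) \<Delta>) xs" and ?d = "dropWhile ((=) \<Delta>) xs"
  have C: "set xs \<subseteq> carrier G" using xs simples_carrier by auto
  have "prodl xs = prodl ?t \<otimes> prodl ?d"
    using C prodl_append[of ?t ?d] by (auto dest: set_takeWhileD set_dropWhileD simp: subset_iff)
  moreover have "prodl ys = D (int (length ys))" if "\<forall>y\<in>set ys. y = \<Delta>" for ys
    using that
  proof (induction ys)
    case (Cons y ys)
    then show ?case using D_add[of 1 "int (length ys)"] by simp
  qed simp
  then have "prodl ?t = D (int (length ?t))" using set_takeWhileD[of _ "(=) \<Delta>" xs] by metis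
  moreover have "prodl ?d \<in> carrier G" using C by (intro prodl_closed) (auto dest: set_dropWhileD)
  ultimately have "D (- k) \<otimes> (D k \<otimes> x) = D (- k + int (length ?t)) \<otimes> prodl ?d"
    unfolding xs(3) D_add by (simp add: m_assoc)
  then have "x = D (- k + int (length ?t)) \<otimes> prodl ?d" using x by (simp add: D_minus)
  moreover have "set ?d \<subseteq> simples G - {\<one>}" using xs by (auto dest: set_dropWhileD)
  moreover have lw: "successively (left_weighted G) ?d"
    using xs(2) successively_append_iff[of _ ?t ?d] by simp
  moreover have "\<Delta> \<notin> set ?d"
  proof -
    have "\<Delta> \<notin> set ys" if "successively (left_weighted G) ys" "ys = [] \<or> hd ys \<noteq> \<Delta>" for ys
      using that
    proof (induction ys)
      case (Cons y ys)
      have "hd ys \<noteq> \<Delta>" if "ys \<noteq> []"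
      proof
        assume "hd ys = \<Delta>"
        then have "left_weighted G y \<Delta>" using Cons.prems that by (cases ys) auto
        then have y: "y \<in> simples G" "\<Delta> \<curlywedge> inv y \<otimes> \<Delta> = \<one>" by (auto simp: left_weighted_iff)
        then have "inv y \<otimes> \<Delta> = \<one>"
          using complement_simple[OF y(1)] le_iff_meet[of "inv y \<otimes> \<Delta>" \<Delta>] meet_commute[of "inv y \<otimes> \<Delta>" \<Delta>] simples_carrier
          by (simp add: simples_iff)
        then have "y \<otimes> (inv y \<otimes> \<Delta>) = y \<otimes> \<one>" by simp
        then show False using Cons.prems y simples_carrier by simp
      qed
      then show ?case using Cons by (cases ys) auto
    qed simp
    moreover have "?d = [] \<or> hd ?d \<noteq> \<Delta>" by (metis hd_dropWhile)
    ultimately show ?thesis using lw by blast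
  qed
  ultimately show ?thesis unfolding is_normal_form_iff by blast
qed

lemma normal_form_eq:
  assumes "is_normal_form G x (p, xs)" shows "normal_form G x = (p, xs)"
  unfolding normal_form_def
proof (rule the_equality)
  show "is_normal_form G x (p, xs)" by fact
  fix nf assume nf: "is_normal_form G x nf"
  obtain p' ys where nf': "nf = (p', ys)" by (cases nf)
  have "p \<le> p'" "p' \<le> p"
    using normal_form_inf[OF assms] normal_form_inf[OF nf[unfolded nf']] by blast+
  then have p: "p' = p" by simp
  have 1: "x = D p \<otimes> prodl xs" "set xs \<subseteq> simples G - {\<one>, \<Delta>}" "successively (left_weighted G) xs"
    "x = D p \<otimes> prodl ys" "set ys \<subseteq> simples G - {\<one>, \<Delta>}" "successively (left_weighted G) ys"
    using assms nf nf' p by (auto simp: is_normal_form_iff)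
  then have C: "prodl xs \<in> carrier G" "prodl ys \<in> carrier G" using simples_carrier by (auto intro!: prodl_closed)
  then have "prodl xs = prodl ys" using 1 by simp
  then show "nf = (p, xs)" using left_weighted_list_unique[of ys xs] 1 nf' p by auto
qed

end

section \<open>Rigid conjugates of powers\<close>

context garside_group begin

lemma one_mem_V_iff:
  assumes "y \<in> carrier G"
  shows "\<one> \<in> V y p q \<longleftrightarrow> y \<otimes> D (- p) \<curlywedge> inv y \<otimes> D q = \<one>"
  using assms by (simp add: V_def act_def)

lemma simples_conj_D:
  assumes "u \<in> simples G" shows "D k \<otimes> u \<otimes> D (- k) \<in> simples G"
proof -
  have u: "u \<in> positive G" "u \<preceq> \<Delta>" using assms by (auto simp: simples_iff)
  have "inv (D k \<otimes> u \<otimes> D (- k)) \<otimes> \<Delta> = D k \<otimes> (inv u \<otimes> \<Delta>) \<otimes> D (- k)"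
    using u D_commute_\<Delta>[of "-k"] by (simp add: inv_mult_group m_assoc D_minus)
  then show ?thesis using D_conj_pos[OF u(1), of "-k"] D_conj_pos[OF u(2), of "-k"] by (simp add: simples_iff)
qed

lemma left_weighted_conj_D:
  assumes "left_weighted G s t"
  shows "left_weighted G (D k \<otimes> s \<otimes> D (- k)) (D k \<otimes> t \<otimes> D (- k))"
proof -
  have st: "s \<in> positive G" "s \<preceq> \<Delta>" "t \<in> positive G" "t \<preceq> \<Delta>" "t \<curlywedge> inv s \<otimes> \<Delta> = \<one>"
    using assms by (auto simp: left_weighted_iff simples_iff)
  have G: "s \<in> carrier G" "t \<in> carrier G" using st by auto
  have "inv (D k \<otimes> s \<otimes> D (- k)) \<otimes> \<Delta> = D k \<otimes> (inv s \<otimes> \<Delta>) \<otimes> D (- k)"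
    using G D_commute_\<Delta>[of "-k"] by (simp add: inv_mult_group m_assoc D_minus)
  then have "D k \<otimes> t \<otimes> D (- k) \<curlywedge> inv (D k \<otimes> s \<otimes> D (- k)) \<otimes> \<Delta> = D k \<otimes> (t \<curlywedge> inv s \<otimes> \<Delta>) \<otimes> D (- k)"
    using G by (simp only: mult_meet meet_D m_closed inv_closed Delta_carrier int_pow_closed)
  also have "\<dots> = \<one>" using st(5) by (simp add: D_minus)
  finally show ?thesis using simples_conj_D assms by (simp add: left_weighted_iff)
qed

lemma prodl_conj_D:
  "set xs \<subseteq> carrier G \<Longrightarrow> prodl (map (\<lambda>s. D k \<otimes> s \<otimes> D (- k)) xs) = D k \<otimes> prodl xs \<otimes> D (- k)"
  by (induction xs) (simp_all add: m_assoc D_minus)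

text \<open>If the junction is left-weighted, then \<open>xs\<close> followed by its conjugate by
  Delta^p is a left-weighted list; its greedy property at the length of \<open>xs\<close> becomes
  membership in V after cancelling the product of \<open>xs\<close>. Conversely, \<open>t\<close>
  and the complement of the last factor are prefixes of the two elements whose meet is 1. The second
  part shows that no other exponents are possible.\<close>

lemma rigid_iff_left_weighted:
  assumes nf: "is_normal_form G y (p, xs)" and ne: "xs \<noteq> []"
  defines "t \<equiv> D p \<otimes> hd xs \<otimes> D (- p)"
  shows "\<one> \<in> V y p (p + int (length xs)) \<longleftrightarrow> left_weighted G (last xs) t"
    and "\<lbrakk>\<one> \<in> V y p' q'; p' < q'; \<And>k. y \<noteq> D k\<rbrakk> \<Longrightarrow> p' = p \<and> q' = p + int (length xs)"
proof -
  define q where "q = p + int (length xs)"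
  let ?X = "prodl xs" and ?L = "D (int (length xs))"
  have xs: "y = D p \<otimes> ?X" "set xs \<subseteq> simples G - {\<one>, \<Delta>}" "successively (left_weighted G) xs"
    using nf by (auto simp: is_normal_form_iff)
  have sub: "set xs \<subseteq> simples G" "set xs \<subseteq> carrier G" "set xs \<subseteq> positive G"
    using xs(2) simples_carrier by (auto simp: simples_iff)
  have X: "?X \<in> carrier G" using sub by simp
  have y: "y \<in> carrier G" using xs(1) X by simp
  have XL: "?X \<preceq> ?L" using prodl_meet_D[OF sub(1) xs(3), of "length xs"] X by (simp add: le_iff_meet)
  let ?Y = "y \<otimes> D (- p)"
  have Y: "?Y = D p \<otimes> ?X \<otimes> D (- p)" using xs(1) X by simp
  have iq: "inv y \<otimes> D q = inv ?X \<otimes> ?L"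
    unfolding q_def D_add xs(1) using X by (simp add: inv_mult_group m_assoc)
  let ?s = "last xs"
  obtain z zs where z: "xs = z # zs" using ne by (cases xs) auto
  have s: "xs = butlast xs @ [?s]" using ne by simp
  have sS: "?s \<in> simples G" "?s \<in> carrier G" "?s \<noteq> \<one>"
    using last_in_set[OF ne] xs(2) simples_carrier by blast+
  let ?W = "prodl (butlast xs)"
  have subb: "set (butlast xs) \<subseteq> carrier G" using sub by (auto dest: in_set_butlastD)
  have X0: "?W \<in> carrier G" using subb by simp
  have "prodl [?s] = ?s" using sS by simp
  moreover have "prodl (butlast xs @ [?s]) = ?W \<otimes> prodl [?s]"
    using subb sS by (intro prodl_append) auto
  ultimately have Xs: "?X = ?W \<otimes> ?s" unfolding append_butlast_last_id[OF ne] by (simp only:)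
  have bl: "?X \<curlywedge> D (int (length xs) - 1) = ?W"
    using prodl_meet_D[OF sub(1) xs(3), of "length xs - 1"] ne by (simp add: butlast_conv_take Suc_le_eq of_nat_diff)
  have t: "t \<in> simples G" "t \<in> carrier G"
    using sub z simples_conj_D[of z p] simples_carrier unfolding t_def by auto
  have xsm: "xs @ map (\<lambda>s. D p \<otimes> s \<otimes> D (- p)) xs \<noteq> []" using ne by simp
  show "\<one> \<in> V y p (p + int (length xs)) \<longleftrightarrow> left_weighted G ?s t"
  proof
    assume lw: "left_weighted G ?s t"
    let ?\<tau> = "\<lambda>s. D p \<otimes> s \<otimes> D (- p)"
    have "successively (left_weighted G) (map ?\<tau> xs)"
      using xs(3) left_weighted_conj_D by (auto simp: successively_map elim: successively_mono)
    moreover have "hd (map ?\<tau> xs) = t" using ne by (simp add: hd_map t_def)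
    ultimately have sl: "successively (left_weighted G) (xs @ map ?\<tau> xs)"
      using xs(3) lw by (simp add: successively_append_iff)
    have ss: "set (xs @ map ?\<tau> xs) \<subseteq> simples G" using sub(1) simples_conj_D by auto
    have "prodl (xs @ map ?\<tau> xs) = ?X \<otimes> ?Y"
    proof -
      have "set (map ?\<tau> xs) \<subseteq> carrier G" using sub(2) by auto
      from prodl_append[OF sub(2) this] show ?thesis unfolding prodl_conj_D[OF sub(2)] Y .
    qed
    then have "?X \<otimes> ?Y \<curlywedge> ?L = ?X" using prodl_meet_D[OF ss sl, of "length xs"] by simp
    then have "inv ?X \<otimes> (?X \<otimes> ?Y \<curlywedge> ?L) = inv ?X \<otimes> ?X" by simp
    then have "?Y \<curlywedge> inv ?X \<otimes> ?L = \<one>" using X y by (simp add: mult_meet)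
    then show "\<one> \<in> V y p (p + int (length xs))"
      using one_mem_V_iff[OF y] iq by (simp add: q_def)
  next
    assume "\<one> \<in> V y p (p + int (length xs))"
    then have one: "?Y \<curlywedge> inv y \<otimes> D q = \<one>" using one_mem_V_iff[OF y] by (simp add: q_def)
    let ?c = "inv ?s \<otimes> \<Delta>"
    have c: "?c \<in> simples G" "?c \<in> carrier G" using complement_simple sS simples_carrier by auto
    have tY: "t \<preceq> ?Y"
    proof -
      have zc: "z \<in> carrier G" "set zs \<subseteq> positive G" using sub z by auto
      have "inv t \<otimes> ?Y = D p \<otimes> prodl zs \<otimes> D (- p)"
        using zc prodl_closed[of zs] unfolding Y t_def z
        by (simp add: inv_mult_group m_assoc D_minus subset_iff)
      then show ?thesis using D_conj_pos[OF prodl_pos[OF zc(2)], of "-p"] by simp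
    qed
    have "?W \<preceq> D (int (length xs) - 1)" unfolding bl[symmetric] using X by (intro meet_le2) auto
    then have "inv ?W \<otimes> D (int (length xs) - 1) \<in> positive G" .
    then have "D (- 1) \<otimes> (inv ?W \<otimes> D (int (length xs) - 1)) \<otimes> D 1 \<in> positive G" by (rule D_conj_pos)
    moreover have "D (int (length xs) - 1) \<otimes> D 1 = ?L"
      using D_add[of "int (length xs) - 1" 1] by simp
    ultimately have "inv \<Delta> \<otimes> (inv ?W \<otimes> ?L) \<in> positive G"
      using X0 by (simp add: m_assoc D_minus)
    moreover have "inv ?c \<otimes> (inv y \<otimes> D q) = inv \<Delta> \<otimes> (inv ?W \<otimes> ?L)"
      unfolding iq Xs using X0 sS by (simp add: inv_mult_group m_assoc)
    ultimately have cq: "?c \<preceq> inv y \<otimes> D q" by simp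
    have "t \<curlywedge> ?c \<preceq> ?Y \<curlywedge> inv y \<otimes> D q"
      using t c y tY cq by (intro meet_mono) auto
    then have "t \<curlywedge> ?c \<preceq> \<one>" unfolding one .
    moreover have "t \<curlywedge> ?c \<in> positive G" using t(1) c(1) unfolding simples_iff by (intro meet_pos) blast+
    ultimately have "t \<curlywedge> ?c = \<one>" by (rule eq_one[rotated])
    then show "left_weighted G ?s t" using t sS by (simp add: left_weighted_iff)
  qed
  assume V: "\<one> \<in> V y p' q'" and pq: "p' < q'" and npow: "\<And>k. y \<noteq> D k"
  have V': "\<one> \<in> V (inv y) (- q') (- p')" using V_inv V y by simp
  have one: "y \<otimes> D (- p') \<curlywedge> inv y \<otimes> D q' = \<one>" using one_mem_V_iff[OF y] V by simp
  have "\<one> \<preceq> y \<otimes> D (- p')" "\<one> \<preceq> inv y \<otimes> D q'"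
    unfolding one[symmetric] using y by (auto intro!: meet_le1 meet_le2 simp del: inv_one l_one one_le)
  then have a1: "D p' \<preceq> y" and a2: "y \<preceq> D q'"
    using le_mult_D[of "D p'" y "-p'"] y by (auto simp: D_minus)
  \<comment> \<open>The case n = 1 of \<open>not_E_le\<close>, here for y and below for its inverse,
    makes the exponents sharp: Delta^(p'+1) is not a prefix of y, and y is not a prefix of
    Delta^(q'-1).\<close>
  have "\<not> E \<one> \<preceq> act (y [^] (1::nat)) (int 1 * p') \<one>"
    using not_E_le[OF y pq V, of 1] npow y by simp
  then have b1: "\<not> D (p' + 1) \<preceq> y"
    using le_mult_D[of "D (p' + 1)" y "-p'"] y D_add[of "p' + 1" "-p'"] by (simp add: act_def)
  have "\<not> E \<one> \<preceq> act (inv y [^] (1::nat)) (int 1 * (- q')) \<one>"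
    using not_E_le[OF _ _ V', of 1] npow y pq conj_inv_D[of y \<one>] by auto
  then have b2: "\<not> y \<preceq> D (q' - 1)"
    using le_mult_D[of \<one> "inv y \<otimes> D (q' - 1)" 1] y D_add[of "q' - 1" 1] by (simp add: act_def m_assoc)
  have p: "p' = p" using a1 b1 normal_form_inf[OF nf] by simp
  have yX: "y \<preceq> D k \<longleftrightarrow> ?X \<preceq> D (k - p)" for k
    using le_mult_left[of "D p" ?X "D (k - p)"] X xs(1) D_add[of p "k - p"] by simp
  have "y \<preceq> D q" using yX[of q] XL by (simp add: q_def)
  have "\<not> y \<preceq> D (q - 1)"
  proof
    assume "y \<preceq> D (q - 1)"
    then have "?X \<preceq> D (int (length xs) - 1)" using yX[of "q - 1"] by (simp add: q_def)
    then have "?X = ?W" using bl X by (simp add: le_iff_meet)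
    then show False using Xs X0 sS by simp
  qed
  have "q \<le> q'"
  proof (rule ccontr)
    assume "\<not> q \<le> q'"
    then have "y \<preceq> D (q - 1)" using le_trans[OF _ _ _ a2, of "D (q - 1)"] D_mono[of q' "q - 1"] y by simp
    with \<open>\<not> y \<preceq> D (q - 1)\<close> show False ..
  qed
  moreover have "q' \<le> q"
  proof (rule ccontr)
    assume "\<not> q' \<le> q"
    then have "y \<preceq> D (q' - 1)"
      using le_trans[OF _ _ _ \<open>y \<preceq> D q\<close>, of "D (q' - 1)"] D_mono[of q "q' - 1"] y by simp
    with b2 show False ..
  qed
  ultimately show "p' = p \<and> q' = p + int (length xs)" using p by (simp add: q_def)
qed

lemma rigid_iff:
  "rigid G y \<longleftrightarrow> y \<in> carrier G \<and> ((\<exists>k. y = D k) \<or> (\<exists>p q. p < q \<and> \<one> \<in> V y p q))"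
proof (cases "y \<in> carrier G \<and> (\<forall>k. y \<noteq> D k)")
  case True
  then obtain p xs where nf: "is_normal_form G y (p, xs)" using ex_normal_form by blast
  have ne: "xs \<noteq> []"
  proof
    assume "xs = []"
    then show False using nf True by (simp add: is_normal_form_iff)
  qed
  have "rigid G y \<longleftrightarrow> left_weighted G (last xs) (D p \<otimes> hd xs \<otimes> D (- p))"
    using True normal_form_eq[OF nf]
    by (simp add: rigid_def initial_factor_def final_factor_def tau_pow_def)
  also have "\<dots> \<longleftrightarrow> \<one> \<in> V y p (p + int (length xs))"
    using rigid_iff_left_weighted(1)[OF nf ne] by simp
  also have "\<dots> \<longleftrightarrow> (\<exists>p q. p < q \<and> \<one> \<in> V y p q)"
    using rigid_iff_left_weighted(2)[OF nf ne] True ne by (metis add.right_neutral add_less_cancel_left length_greater_0_conv of_nat_0_less_iff)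
  finally show ?thesis using True by blast
qed (auto simp: rigid_def)

lemma sh_pow_commute:
  assumes z: "z \<in> carrier G" "P < Q" and y: "y \<in> carrier G" "z \<otimes> y = y \<otimes> z" and c: "c \<in> V z P Q"
  shows "act y s ((sh z P ^^ k) c) = (sh z P ^^ k) (act y s c)" "act y s c \<in> V z P Q"
    "(sh z P ^^ k) c \<in> V z P Q"
proof -
  interpret ax: axis_centralizer "carrier G" "(\<preceq>)" "(\<curlywedge>)" "act z P" "act (inv z) (- Q)" E "nat (Q - P)" "act y s"
    using axis_centralizer_act[OF z y] .
  show "act y s ((sh z P ^^ k) c) = (sh z P ^^ k) (act y s c)" "act y s c \<in> V z P Q"
    "(sh z P ^^ k) c \<in> V z P Q"
    using ax.C_sh_pow[of c k] ax.C_V[of c] ax.sh_pow_V[of c k] c by (simp_all add: axis_V[OF z] axis_sh[OF z])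
qed

lemma sh_pow_inj:
  assumes z: "z \<in> carrier G" "P < Q" and "c \<in> V z P Q" "d \<in> V z P Q" "(sh z P ^^ k) c = (sh z P ^^ k) d"
  shows "c = d"
  using axis_pair.sh_pow_inj[OF axis_pair_act[OF z]] assms(3-) by (simp add: axis_V[OF z] axis_sh[OF z])

text \<open>All powers x^k with k dividing N are compared through one common shift, that of
  x^N.\<close>

lemma V_pow_iff:
  assumes x: "x \<in> carrier G" "p < q" and k: "1 \<le> k" "1 \<le> n" and N: "N = n * k"
    and c: "c \<in> V (x [^] N) (int N * p) (int N * q)"
  shows "c \<in> V (x [^] k) (int k * p) (int k * q) \<longleftrightarrow>
    (sh (x [^] N) (int N * p) ^^ (k * nat (q - p))) c = act (x [^] k) (int k * p) c"
proof
  have lt: "int j * p < int j * q" if "1 \<le> j" for j using x that by simp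
  have "nat (int k * q - int k * p) = nat (int k * (q - p))" by (simp add: right_diff_distrib)
  then have nat: "nat (int k * q - int k * p) = k * nat (q - p)" using x by (simp add: nat_mult_distrib)
  {
    assume "c \<in> V (x [^] k) (int k * p) (int k * q)"
    from sh_pow_root[OF _ lt[OF k(1)] this k(2)]
    show "(sh (x [^] N) (int N * p) ^^ (k * nat (q - p))) c = act (x [^] k) (int k * p) c"
      using x(1) nat by (simp add: nat_pow_pow N mult.commute mult.left_commute mult.assoc)
  }
  assume "(sh (x [^] N) (int N * p) ^^ (k * nat (q - p))) c = act (x [^] k) (int k * p) c"
  then show "c \<in> V (x [^] k) (int k * p) (int k * q)"
    using x k N lt[of N] lt[OF k(1)] nat
    by (intro V_of_sh_pow[OF _ _ _ _ _ c]) (auto simp: nat_pow_mult add.commute)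
qed

text \<open>Choose N divisible by a, b and a + b, so that all three conditions concern the shift of
  x^N. Given the condition for b, those for a and for a + b differ by the translation by x^b, which
  is injective.\<close>

lemma V_pow_add:
  assumes x: "x \<in> carrier G" "p < q" and ab: "1 \<le> a" "1 \<le> b"
    and cb: "c \<in> V (x [^] b) (int b * p) (int b * q)"
  shows "c \<in> V (x [^] a) (int a * p) (int a * q) \<longleftrightarrow> c \<in> V (x [^] (a + b)) (int (a + b) * p) (int (a + b) * q)"
    (is "c \<in> ?Va \<longleftrightarrow> c \<in> ?Vab")
proof -
  define N where "N = a * b * (a + b)"
  let ?z = "x [^] N" let ?P = "int N * p" and ?Q = "int N * q" and ?r = "nat (q - p)"
  let ?S = "sh ?z ?P"
  have lt: "int b * p < int b * q" using x ab by simp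
  have "c \<in> V ((x [^] b) [^] (a * (a + b))) (int (a * (a + b)) * (int b * p)) (int (a * (a + b)) * (int b * q))"
    using V_pow[OF _ lt cb, of "a * (a + b)"] x ab by simp
  then have c: "c \<in> V ?z ?P ?Q"
    using x by (simp add: nat_pow_pow N_def mult_ac)
  have z: "?z \<in> carrier G" "?P < ?Q" using x ab by (auto simp: N_def)
  have comm: "?z \<otimes> x [^] k = x [^] k \<otimes> ?z" for k :: nat using x by (simp add: nat_pow_mult add.commute)
  have cG: "c \<in> carrier G" using c V_carrier by blast
  have b: "(?S ^^ (b * ?r)) c = act (x [^] b) (int b * p) c"
    using V_pow_iff[OF x ab(2), of "a * (a + b)" N c] cb c ab by (simp add: N_def mult.commute mult.left_commute)
  have act_ab: "act (x [^] a) (int a * p) (act (x [^] b) (int b * p) c) = act (x [^] (a + b)) (int (a + b) * p) c"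
    "act (x [^] b) (int b * p) (act (x [^] a) (int a * p) c) = act (x [^] (a + b)) (int (a + b) * p) c"
    using x cG by (simp_all add: act_act nat_pow_mult distrib_right add.commute)
  have 1: "(?S ^^ ((a + b) * ?r)) c = act (x [^] b) (int b * p) ((?S ^^ (a * ?r)) c)"
    using sh_pow_commute(1)[OF z _ comm c, of b "int b * p" "a * ?r"] x b
    by (simp add: distrib_right funpow_add)
  have 2: "act (x [^] a) (int a * p) c \<in> carrier G" "(?S ^^ (a * ?r)) c \<in> carrier G"
    using x(1) cG V_carrier[OF sh_pow_commute(3)[OF z x(1) _ c, of "a * ?r"]] comm[of 1] by auto
  have "c \<in> ?Va \<longleftrightarrow> (?S ^^ (a * ?r)) c = act (x [^] a) (int a * p) c"
    using V_pow_iff[OF x ab(1), of "b * (a + b)" N c] c ab by (simp add: N_def mult.commute mult.left_commute)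
  also have "\<dots> \<longleftrightarrow> act (x [^] b) (int b * p) ((?S ^^ (a * ?r)) c) = act (x [^] b) (int b * p) (act (x [^] a) (int a * p) c)"
    using act_inj[OF _ 2(2,1)] x by auto
  also have "\<dots> \<longleftrightarrow> (?S ^^ ((a + b) * ?r)) c = act (x [^] (a + b)) (int (a + b) * p) c"
    unfolding 1 act_ab ..
  also have "\<dots> \<longleftrightarrow> c \<in> ?Vab"
    using V_pow_iff[OF x, of "a + b" "a * b" N c] c ab by (simp add: N_def)
  finally show ?thesis .
qed

text \<open>The quotient h = d c^(-1) commutes with x^a, hence with x^(ab) and with its shift. A
  suitable iterate of that shift acts on c and d as translation by x^b, so h x^b c = x^b h
  c.\<close>

lemma conj_pow_eq:
  assumes x: "x \<in> carrier G" "p < q" and ab: "1 \<le> a" "1 \<le> b"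
    and c: "c \<in> V (x [^] a) (int a * p) (int a * q)" "c \<in> V (x [^] b) (int b * p) (int b * q)"
    and d: "d \<in> V (x [^] a) (int a * p) (int a * q)" "d \<in> V (x [^] b) (int b * p) (int b * q)"
    and eq: "inv c \<otimes> x [^] a \<otimes> c = inv d \<otimes> x [^] a \<otimes> d"
  shows "inv c \<otimes> x [^] b \<otimes> c = inv d \<otimes> x [^] b \<otimes> d"
proof -
  define N where "N = a * b"
  let ?z = "x [^] N" let ?P = "int N * p" and ?Q = "int N * q" and ?r = "nat (q - p)"
  let ?S = "sh ?z ?P"
  have lt: "int b * p < int b * q" using x ab by simp
  have in_z: "e \<in> V ?z ?P ?Q" if "e \<in> V (x [^] b) (int b * p) (int b * q)" for e
    using V_pow[OF _ lt that, of a] x ab by (simp add: nat_pow_pow N_def mult.commute mult.left_commute)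
  have z: "?z \<in> carrier G" "?P < ?Q" using x ab by (auto simp: N_def)
  have cG: "c \<in> carrier G" "d \<in> carrier G" using c d V_carrier by blast+
  define h where "h = d \<otimes> inv c"
  have h: "h \<in> carrier G" "d = h \<otimes> c" using cG by (auto simp: h_def m_assoc)
  have "d \<otimes> (inv c \<otimes> x [^] a \<otimes> c) \<otimes> inv c = d \<otimes> (inv d \<otimes> x [^] a \<otimes> d) \<otimes> inv c" using eq by simp
  then have ha: "x [^] a \<otimes> h = h \<otimes> x [^] a"
    using x cG by (simp add: h_def m_assoc)
  have "(x [^] a) [^] j \<otimes> h = h \<otimes> (x [^] a) [^] j" for j :: nat
    using ha h(1) x(1) by (induction j) (simp_all add: m_assoc, metis m_assoc nat_pow_closed)
  then have zh: "?z \<otimes> h = h \<otimes> ?z" using x by (simp add: nat_pow_pow N_def)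
  have b: "(?S ^^ (b * ?r)) e = act (x [^] b) (int b * p) e" if "e \<in> V (x [^] b) (int b * p) (int b * q)" for e
    using V_pow_iff[OF x ab(2), of a N e] in_z[OF that] that ab by (simp add: N_def mult.commute)
  have a0: "act h 0 c = d" using h cG by (simp add: act_def)
  have "act h 0 ((?S ^^ (b * ?r)) c) = (?S ^^ (b * ?r)) (act h 0 c)"
    using sh_pow_commute(1)[OF z h(1) zh in_z[OF c(2)]] .
  then have "act h 0 (act (x [^] b) (int b * p) c) = act (x [^] b) (int b * p) (h \<otimes> c)"
    using b c d a0 h by simp
  then have "h \<otimes> (x [^] b \<otimes> c) \<otimes> D (- (int b * p)) = x [^] b \<otimes> (h \<otimes> c) \<otimes> D (- (int b * p))"
    using x cG h(1) by (simp add: act_def m_assoc)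
  then have hb: "h \<otimes> (x [^] b \<otimes> c) = x [^] b \<otimes> (h \<otimes> c)"
    using x cG h(1) by (subst (asm) right_cancel) simp_all
  have "inv d \<otimes> x [^] b \<otimes> d = inv c \<otimes> (inv h \<otimes> (x [^] b \<otimes> (h \<otimes> c)))"
    unfolding h(2) using h(1) cG x by (simp add: inv_mult_group m_assoc)
  also have "\<dots> = inv c \<otimes> x [^] b \<otimes> c" unfolding hb[symmetric] using h(1) cG x by (simp add: m_assoc)
  finally show ?thesis by simp
qed

lemma conj_pow: "\<lbrakk>x \<in> carrier G; c \<in> carrier G\<rbrakk> \<Longrightarrow> (inv c \<otimes> x \<otimes> c) [^] (n::nat) = inv c \<otimes> x [^] n \<otimes> c"
  by (induction n) (simp_all add: m_assoc)

text \<open>\<open>V_exp_unique\<close> forces the exponents np and nq on every rigid conjugate of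
  x^n; it applies because no conjugate of x^n is a power of Delta.\<close>

lemma SC_pow:
  assumes x: "x \<in> carrier G" "p < q" "\<one> \<in> V x p q" "\<And>k. x \<noteq> D k" and n: "1 \<le> n"
  shows "SC G (x [^] n) = (\<lambda>c. inv c \<otimes> x [^] n \<otimes> c) ` V (x [^] n) (int n * p) (int n * q)"
proof (intro Set.set_eqI iffI)
  let ?z = "x [^] n" let ?P = "int n * p" and ?Q = "int n * q"
  have z: "?z \<in> carrier G" "?P < ?Q" using x n by auto
  have np: "nonpower ?z" using nonpower_pow[OF x n] .
  have one: "\<one> \<in> V ?z ?P ?Q" using V_pow[OF x(1-3) n] .
  fix y
  {
    assume "y \<in> SC G ?z"
    then obtain c where r: "rigid G y" and c: "c \<in> carrier G" "y = inv c \<otimes> ?z \<otimes> c"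
      by (auto simp: SC_def conjugate_def)
    have "\<nexists>k. y = D k" using np c unfolding nonpower_def by auto
    then obtain p' q' where V: "p' < q'" "\<one> \<in> V y p' q'" using r unfolding rigid_iff by blast
    then have cV: "c \<in> V ?z p' q'" using V_conj[OF z(1) c(1), of \<one>] c by simp
    then have "p' = ?P" "q' = ?Q" using V_exp_unique[OF z(1) V(1) z(2) cV one np] by auto
    then show "y \<in> (\<lambda>c. inv c \<otimes> ?z \<otimes> c) ` V ?z ?P ?Q" using cV c by auto
  }
  assume "y \<in> (\<lambda>c. inv c \<otimes> ?z \<otimes> c) ` V ?z ?P ?Q"
  then obtain c where c: "c \<in> V ?z ?P ?Q" "y = inv c \<otimes> ?z \<otimes> c" by auto
  then have cG: "c \<in> carrier G" using V_carrier by auto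
  then have "\<one> \<in> V y ?P ?Q" using V_conj[OF z(1) cG, of \<one>] c by simp
  then show "y \<in> SC G ?z" using c cG z by (auto simp: SC_def conjugate_def rigid_iff)
qed

lemma card_image_eq:
  assumes "\<And>a b. \<lbrakk>a \<in> W; b \<in> W\<rbrakk> \<Longrightarrow> f a = f b \<longleftrightarrow> g a = g b"
  shows "card (f ` W) = card (g ` W)"
proof (rule bij_betw_same_card)
  show "bij_betw (\<lambda>y. g (inv_into W f y)) (f ` W) (g ` W)"
    unfolding bij_betw_def inj_on_def using assms inv_into_into[of _ f W] f_inv_into_f[of _ f W]
    by (auto simp: image_iff) (metis imageI)+
qed

text \<open>V (x^n) and V (x^(n+L)) coincide by \<open>V_pow_add\<close>. Two of their points give
  equal conjugates of x^n iff they give equal conjugates of x^(n+L), because either equality implies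
  the one for x^L.\<close>

lemma card_SC_pow_add:
  assumes x: "x \<in> carrier G" "p < q" "\<one> \<in> V x p q" "\<And>k. x \<noteq> D k"
    and L: "1 \<le> L" "\<And>n. 1 \<le> n \<Longrightarrow> V (x [^] n) (int n * p) (int n * q) \<subseteq> V (x [^] L) (int L * p) (int L * q)"
    and n: "1 \<le> n"
  shows "card (SC G (x [^] (n + L))) = card (SC G (x [^] n))"
proof -
  let ?V = "\<lambda>k. V (x [^] k) (int k * p) (int k * q)"
  have nL: "1 \<le> n + L" using n by simp
  have VV: "?V (n + L) = ?V n"
    using V_pow_add[OF x(1,2) n L(1)] L(2)[OF n] L(2)[OF nL] by blast
  have prod: "inv c \<otimes> x [^] (n + L) \<otimes> c = (inv c \<otimes> x [^] n \<otimes> c) \<otimes> (inv c \<otimes> x [^] L \<otimes> c)"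
    if "c \<in> carrier G" for c
    using x that by (simp add: m_assoc flip: nat_pow_mult)
  have "inv c \<otimes> x [^] (n + L) \<otimes> c = inv d \<otimes> x [^] (n + L) \<otimes> d \<longleftrightarrow> inv c \<otimes> x [^] n \<otimes> c = inv d \<otimes> x [^] n \<otimes> d"
    if c: "c \<in> ?V n" and d: "d \<in> ?V n" for c d
  proof
    have G: "c \<in> carrier G" "d \<in> carrier G" using c d V_carrier by blast+
    have L': "c \<in> ?V L" "d \<in> ?V L" using c d L(2)[OF n] by auto
    have nL': "c \<in> ?V (n + L)" "d \<in> ?V (n + L)" using c d VV by auto
    {
      assume *: "inv c \<otimes> x [^] n \<otimes> c = inv d \<otimes> x [^] n \<otimes> d"
      then have "inv c \<otimes> x [^] L \<otimes> c = inv d \<otimes> x [^] L \<otimes> d"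
        using conj_pow_eq[OF x(1,2) n L(1) c L'(1) d L'(2)] by simp
      then show "inv c \<otimes> x [^] (n + L) \<otimes> c = inv d \<otimes> x [^] (n + L) \<otimes> d"
        using prod G * by simp
    }
    assume *: "inv c \<otimes> x [^] (n + L) \<otimes> c = inv d \<otimes> x [^] (n + L) \<otimes> d"
    then have "inv c \<otimes> x [^] L \<otimes> c = inv d \<otimes> x [^] L \<otimes> d"
      using conj_pow_eq[OF x(1,2) nL L(1) nL'(1) L'(1) nL'(2) L'(2)] by simp
    then show "inv c \<otimes> x [^] n \<otimes> c = inv d \<otimes> x [^] n \<otimes> d"
      using * G x right_cancel[of "inv d \<otimes> x [^] L \<otimes> d" "inv c \<otimes> x [^] n \<otimes> c" "inv d \<otimes> x [^] n \<otimes> d"]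
      unfolding prod[OF G(1)] prod[OF G(2)] by simp
  qed
  then show ?thesis unfolding SC_pow[OF x n] SC_pow[OF x nL] VV by (intro card_image_eq)
qed

text \<open>A rigid conjugate that is no power of Delta would be \<open>nonpower\<close>, although
  it is conjugate to Delta^k. Comparing lengths then fixes the exponent.\<close>

lemma SC_D: "SC G (D k) = {D k}"
proof (intro Set.set_eqI iffI)
  fix y assume "y \<in> SC G (D k)"
  then obtain g where r: "rigid G y" and g: "g \<in> carrier G" "y = inv g \<otimes> D k \<otimes> g"
    by (auto simp: SC_def conjugate_def)
  have "D k = inv (inv g) \<otimes> y \<otimes> inv g" unfolding g(2) using g(1) by (simp add: m_assoc)
  have yG: "y \<in> carrier G" using g by simp
  have len_D: "len (D j) = j * len \<Delta>" for j
  proof -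
    have nn: "len (D (int n)) = int n * len \<Delta>" for n
      by (induction n) (simp_all add: D_add len_mult distrib_right)
    then show ?thesis using len_inv[of "D (- j)"] nn[of "nat j"] nn[of "nat (- j)"]
      by (cases "0 \<le> j") (simp_all add: D_minus len_inv)
  qed
  show "y \<in> {D k}"
  proof (cases "\<exists>j. y = D j")
    case True
    then obtain j where j: "y = D j" by blast
    have "len y = len (D k)" using g by (simp add: len_mult len_inv)
    then have "j * len \<Delta> = k * len \<Delta>" using j len_D by simp
    then have "j = k" using len_pos[OF Delta_pos Delta_neq_one] by simp
    then show ?thesis using j by simp
  next
    case False
    then obtain p q where V: "p < q" "\<one> \<in> V y p q" using r unfolding rigid_iff by blast
    have "nonpower (y [^] (1::nat))" using nonpower_pow[OF yG V] False by blast
    then have "nonpower y" using yG by simp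
    then show ?thesis using \<open>D k = _\<close> g unfolding nonpower_def by (metis inv_closed)
  qed
qed (auto simp: SC_def conjugate_def rigid_iff intro!: bexI[of _ \<one>])

end

section \<open>Automorphisms of axis sets\<close>

context garside_group begin

abbreviation co :: "'a \<Rightarrow> int \<Rightarrow> 'a \<Rightarrow> 'a" where "co x q \<equiv> sh (inv x) (- q)"

lemma
  assumes z: "z \<in> carrier G" "p < q" and c: "c \<in> V z p q"
  shows V_co: "co z q c \<in> V z p q"
    and le_sh: "c \<preceq> sh z p c" and le_co: "c \<preceq> co z q c"
    and sh_le_E: "sh z p c \<preceq> E c" and co_le_E: "co z q c \<preceq> E c"
    and sh_meet_co: "sh z p c \<curlywedge> co z q c = c"
    and sh_mono: "\<lbrakk>d \<in> V z p q; c \<preceq> d\<rbrakk> \<Longrightarrow> sh z p c \<preceq> sh z p d"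
    and NB_sh: "d \<in> NB z p q c \<Longrightarrow> sh z p d \<in> NB z p q (sh z p c)"
    and sh_pow_l: "(sh z p ^^ nat (q - p)) c = act z p c"
proof -
  interpret ax: axis_pair "carrier G" "(\<preceq>)" "(\<curlywedge>)" "act z p" "act (inv z) (- q)" E "nat (q - p)"
    using axis_pair_act z .
  have cG: "c \<in> carrier G" using c V_carrier by blast
  have cV: "c \<in> ax.V" using c axis_V[OF z] by simp
  show "co z q c \<in> V z p q" "c \<preceq> sh z p c" "c \<preceq> co z q c" "sh z p c \<preceq> E c" "co z q c \<preceq> E c"
    using ax.V_co[OF cV] ax.le_sh[OF cV] ax.le_co[OF cV] ax.sh_le_E[OF cG] ax.co_le_E[OF cG]
    by (simp_all only: axis_V[OF z] axis_sh[OF z] axis_co[OF z])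
  show "(sh z p ^^ nat (q - p)) c = act z p c"
    using ax.sh_pow_l[OF cV] by (simp only: axis_sh[OF z])
  show "sh z p c \<preceq> sh z p d" if "d \<in> V z p q" "c \<preceq> d"
    using ax.sh_mono[OF cG _ that(2)] V_carrier[OF that(1)] by (simp only: axis_sh[OF z])
  show "sh z p d \<in> NB z p q (sh z p c)" if "d \<in> NB z p q c"
    using ax.N_sh[OF cV] that by (simp only: axis_sh[OF z] axis_NB[OF z])
  show "sh z p c \<curlywedge> co z q c = c"
  proof (rule le_antisym)
    have G: "sh z p c \<in> carrier G" "co z q c \<in> carrier G" using z cG by auto
    have "sh z p c \<preceq> act z p c" "co z q c \<preceq> act (inv z) (- q) c"
      unfolding sh_def using z cG by (auto intro: meet_le1)
    then have "sh z p c \<curlywedge> co z q c \<preceq> act z p c \<curlywedge> act (inv z) (- q) c"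
      using G z cG by (intro meet_mono) auto
    then show "sh z p c \<curlywedge> co z q c \<preceq> c" using c by (simp add: V_def)
    show "c \<preceq> sh z p c \<curlywedge> co z q c"
      by (rule meet_greatest[OF G cG])
        (use ax.le_sh[OF cV] ax.le_co[OF cV] in \<open>simp_all only: axis_sh[OF z] axis_co[OF z]\<close>)
  qed (use z cG in auto)
qed

lemma nonpower_neq:
  assumes z: "z \<in> carrier G" "p < q" and c: "c \<in> V z p q" and np: "nonpower z"
  shows "sh z p c \<noteq> c" "sh z p c \<noteq> E c" "co z q c \<noteq> c" "co z q c \<noteq> E c"
proof -
  have cG: "c \<in> carrier G" using c V_carrier by blast
  have c': "c \<in> V (inv z) (- q) (- p)" using V_inv z c by simp
  show "sh z p c \<noteq> c" "sh z p c \<noteq> E c"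
    using sh_neq[OF z c] sh_neq_E[OF z c] np cG unfolding nonpower_def by blast+
  show "co z q c \<noteq> c" "co z q c \<noteq> E c"
    using sh_neq[OF _ _ c'] sh_neq_E[OF _ _ c'] nonpower_inv[OF z(1) np] z cG unfolding nonpower_def by auto
qed

lemma le_complement:
  assumes "c \<in> carrier G" "d \<in> carrier G" "e \<in> carrier G"
  shows "inv c \<otimes> d \<preceq> inv c \<otimes> e \<longleftrightarrow> d \<preceq> e"
  using assms le_mult_left[of "inv c" d e] by simp

lemma simple_interval:
  assumes "c \<in> carrier G" "d \<in> carrier G" "c \<preceq> d" "d \<preceq> E c"
  shows "inv c \<otimes> d \<in> simples G"
  using assms by (simp add: simples_iff inv_mult_group m_assoc)

lemma V_pow_subset_of_no_neighbours:
  assumes x: "x \<in> carrier G" "p < q" "\<one> \<in> V x p q" and n: "1 \<le> n"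
    and NB: "\<And>c. c \<in> V (x [^] n) (int n * p) (int n * q) \<Longrightarrow> NB (x [^] n) (int n * p) (int n * q) c = {}"
    and black: "\<And>c d. \<lbrakk>c \<in> V (x [^] n) (int n * p) (int n * q); d \<in> V (x [^] n) (int n * p) (int n * q);
        c \<preceq> d; d \<preceq> sh (x [^] n) (int n * p) c\<rbrakk> \<Longrightarrow> d = c \<or> d = sh (x [^] n) (int n * p) c"
  shows "V (x [^] n) (int n * p) (int n * q) \<subseteq> V x p q"
proof (rule V_root)
  show "\<one> \<in> V (x [^] n) (int n * p) (int n * q)" using V_pow[OF x n] .
  show "T x p q (x [^] n) (int n * p) \<one> = \<one>" using T_eq_iff sh_pow_root[OF x n] x by simp
  show "x [^] n \<otimes> x = x \<otimes> x [^] n" using x by (metis nat_pow_Suc nat_pow_Suc2)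
  fix d
  show "T x p q (x [^] n) (int n * p) d = d" if "d \<in> NB (x [^] n) (int n * p) (int n * q) \<one>"
    using NB[OF V_pow[OF x n]] that by simp
  show "T x p q (x [^] n) (int n * p) b = b"
    if "d \<in> V (x [^] n) (int n * p) (int n * q)" "b \<in> NB (x [^] n) (int n * p) (int n * q) d" for b
    using NB that by simp
qed (use x n black in auto)

text \<open>Seen from c, the steps to sh c and to d are nontrivial simple elements with trivial
  meet, and both are prefixes of the simple step to sh d. So \<open>join\<close> gives sh d = E c =
  sh (co c), whence d = co c.\<close>

lemma no_neighbours:
  assumes join: "\<And>u v w. \<lbrakk>u \<in> simples G; v \<in> simples G; w \<in> simples G; u \<noteq> \<one>; v \<noteq> \<one>; u \<curlywedge> v = \<one>; u \<preceq> w; v \<preceq> w\<rbrakk>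
      \<Longrightarrow> w = \<Delta>"
    and z: "z \<in> carrier G" "p < q" and np: "nonpower z" and c: "c \<in> V z p q" and d: "d \<in> V z p q"
    and cd: "c \<preceq> d" "d \<preceq> co z q c"
  shows "d = c \<or> d = co z q c"
proof (rule ccontr)
  assume "\<not> (d = c \<or> d = co z q c)"
  then have ne: "d \<noteq> c" "d \<noteq> co z q c" by auto
  have V: "sh z p c \<in> V z p q" "sh z p d \<in> V z p q" "co z q c \<in> V z p q"
    using V_sh[OF z] V_co[OF z c] c d by auto
  note G = V_carrier[OF c] V_carrier[OF d] V[THEN V_carrier]
  let ?y = "inv c \<otimes> sh z p c" and ?s = "inv c \<otimes> d" and ?w = "inv c \<otimes> sh z p d"
  have sd: "sh z p d \<preceq> E c" using sh_mono[OF z d V(3) cd(2)] sh_inv_sh(2)[OF z c] by simp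
  have cs: "c \<preceq> sh z p c" "sh z p c \<preceq> sh z p d" "d \<preceq> sh z p d"
    using le_sh[OF z c] sh_mono[OF z c d cd(1)] le_sh[OF z d] by auto
  have dE: "d \<preceq> E c" using le_trans[OF _ _ _ cd(2) co_le_E[OF z c]] G by simp
  have "c \<preceq> sh z p d" using le_trans[OF _ _ _ cs(1,2)] G by simp
  then have simple: "?y \<in> simples G" "?s \<in> simples G" "?w \<in> simples G"
    using simple_interval[OF G(1)] G cs sd cd dE sh_le_E[OF z c] by auto
  have "sh z p c \<curlywedge> d \<preceq> sh z p c \<curlywedge> co z q c" using G cd le_refl by (intro meet_mono) auto
  then have "sh z p c \<curlywedge> d \<preceq> c" unfolding sh_meet_co[OF z c] .
  moreover have "c \<preceq> sh z p c \<curlywedge> d" using G cs(1) cd(1) by (intro meet_greatest) auto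
  ultimately have "sh z p c \<curlywedge> d = c" using G by (intro le_antisym) auto
  then have m: "?y \<curlywedge> ?s = \<one>" using G mult_meet[of "inv c" "sh z p c" d] by simp
  have "?y \<noteq> \<one>" "?s \<noteq> \<one>"
    using nonpower_neq(1)[OF z c np] ne(1) G by (metis inv_mult_cancel(2) inv_closed r_one)+
  then have "?w = \<Delta>" using join[OF simple _ _ m] le_complement G cs by auto
  then have "sh z p d = E c" using G by (metis inv_mult_cancel(2))
  then have "sh z p d = sh z p (co z q c)" using sh_inv_sh(2)[OF z c] by simp
  then show False using sh_inj[OF z d V(3)] ne by blast
qed

lemma V_pow_subset_join:
  assumes join: "\<And>u v w. \<lbrakk>u \<in> simples G; v \<in> simples G; w \<in> simples G; u \<noteq> \<one>; v \<noteq> \<one>; u \<curlywedge> v = \<one>; u \<preceq> w; v \<preceq> w\<rbrakk>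
      \<Longrightarrow> w = \<Delta>"
    and x: "x \<in> carrier G" "p < q" "\<one> \<in> V x p q" "\<And>k. x \<noteq> D k" and n: "1 \<le> n"
  shows "V (x [^] n) (int n * p) (int n * q) \<subseteq> V x p q"
proof (rule V_pow_subset_of_no_neighbours[OF x(1-3) n])
  let ?z = "x [^] n" and ?P = "int n * p" and ?Q = "int n * q"
  have z: "?z \<in> carrier G" "?P < ?Q" using x n by auto
  have np: "nonpower ?z" using nonpower_pow[OF x n] .
  fix c assume c: "c \<in> V ?z ?P ?Q"
  show "NB ?z ?P ?Q c = {}"
  proof (rule equals0I)
    fix d assume "d \<in> NB ?z ?P ?Q c"
    then have d: "d \<in> V ?z ?P ?Q" "c \<preceq> d" "d \<preceq> co ?z ?Q c" "d \<noteq> c" "d \<noteq> co ?z ?Q c"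
      unfolding NB_def by blast+
    have "d = c \<or> d = co ?z ?Q c" by (rule no_neighbours[OF join z np c d(1-3)])
    then show False using d(4,5) by blast
  qed
  fix d assume d: "d \<in> V ?z ?P ?Q" "c \<preceq> d" "d \<preceq> sh ?z ?P c"
  \<comment> \<open>The interval from c to sh c is the interval from c to co c for the inverse
    element.\<close>
  have z': "inv ?z \<in> carrier G" "- ?Q < - ?P" using z by auto
  have V': "c \<in> V (inv ?z) (- ?Q) (- ?P)" "d \<in> V (inv ?z) (- ?Q) (- ?P)" unfolding V_inv[OF z(1)] by fact+
  have co: "co (inv ?z) (- ?P) c = sh ?z ?P c" unfolding inv_inv[OF z(1)] minus_minus ..
  have d': "d \<preceq> co (inv ?z) (- ?P) c" unfolding co by fact
  have "d = c \<or> d = co (inv ?z) (- ?P) c"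
    by (rule no_neighbours[OF join z' nonpower_inv[OF z(1) np] V' d(2) d'])
  then show "d = c \<or> d = sh ?z ?P c" unfolding co .
qed

text \<open>Lets a finite order of T be read as a statement about a power of x: the map for x^6 is
  the sixth iterate of the map for x.\<close>

lemma T_pow:
  assumes x: "x \<in> carrier G" "p < q" and z: "z \<in> carrier G" "P < Q" "z \<otimes> x = x \<otimes> z" and c: "c \<in> V z P Q"
  shows "T (x [^] k) (int k * p) (int k * q) z P c = (T x p q z P ^^ k) c"
proof (induction k)
  case 0 show ?case using V_carrier[OF c] by (simp add: T_def act_def)
next
  case (Suc k)
  let ?S = "sh z P" and ?r = "nat (q - p)"
  have nat: "nat (int j * q - int j * p) = j * ?r" for j
  proof -
    have "nat (int j * q - int j * p) = nat (int j * (q - p))" by (simp add: right_diff_distrib)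
    then show ?thesis using x by (simp add: nat_mult_distrib)
  qed
  have zk: "z \<otimes> inv (x [^] k) = inv (x [^] k) \<otimes> z"
  proof -
    have "z \<otimes> x [^] k = x [^] k \<otimes> z"
      using z x(1) by (induction k) (simp_all, metis m_assoc nat_pow_closed)
    then show ?thesis using commute_inv z x by simp
  qed
  have Sc: "(?S ^^ j) c \<in> V z P Q" "(?S ^^ j) c \<in> carrier G" for j
    using sh_pow_commute(3)[OF z(1,2) one_closed _ c, of j] z V_carrier[of "(?S ^^ j) c" z P Q] by auto
  have "(T x p q z P ^^ Suc k) c = T x p q z P (act (inv (x [^] k)) (- (int k * p)) ((?S ^^ (k * ?r)) c))"
  proof -
    have "(T x p q z P ^^ k) c = act (inv (x [^] k)) (- (int k * p)) ((?S ^^ (k * ?r)) c)"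
      unfolding Suc[symmetric] by (simp only: T_def nat)
    then show ?thesis by (simp only: funpow.simps o_def)
  qed
  also have "\<dots> = act (inv x) (- p) (act (inv (x [^] k)) (- (int k * p)) ((?S ^^ ?r) ((?S ^^ (k * ?r)) c)))"
    unfolding T_def using sh_pow_commute(1)[OF z(1,2) _ zk Sc(1)] x by simp
  also have "\<dots> = act (inv (x [^] Suc k)) (- (int (Suc k) * p)) ((?S ^^ (Suc k * ?r)) c)"
  proof -
    have "inv x \<otimes> inv (x [^] k) = inv (x [^] Suc k)" using x by (simp add: inv_mult_group)
    moreover have "(?S ^^ ?r) ((?S ^^ (k * ?r)) c) = (?S ^^ (Suc k * ?r)) c" by (simp add: funpow_add)
    moreover have "- p + - (int k * p) = - (int (Suc k) * p)" by (simp add: algebra_simps)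
    ultimately show ?thesis using act_act[of "inv x" "inv (x [^] k)" _ "-p" "- (int k * p)"] x Sc(2)
      by (metis inv_closed nat_pow_closed)
  qed
  finally have "(T x p q z P ^^ Suc k) c = act (inv (x [^] Suc k)) (- (int (Suc k) * p)) ((?S ^^ (Suc k * ?r)) c)" .
  moreover have "T (x [^] Suc k) (int (Suc k) * p) (int (Suc k) * q) z P c =
    act (inv (x [^] Suc k)) (- (int (Suc k) * p)) ((?S ^^ (Suc k * ?r)) c)"
    by (simp only: T_def nat)
  ultimately show ?case by (simp only:)
qed

end

section \<open>Garside elements of length three\<close>

lemma funpow6_card3:
  assumes S: "finite S" "card S \<le> 3" and f: "\<And>a. a \<in> S \<Longrightarrow> f a \<in> S" "inj_on f S" and a: "a \<in> S"
  shows "(f ^^ 6) a = a"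
proof -
  have mem: "(f ^^ k) a \<in> S" for k by (induction k) (use a f in auto)
  have "\<not> inj_on (\<lambda>k. (f ^^ k) a) {..3::nat}"
  proof
    assume "inj_on (\<lambda>k. (f ^^ k) a) {..3::nat}"
    then have "card ((\<lambda>k. (f ^^ k) a) ` {..3::nat}) = 4" by (simp add: card_image)
    moreover have "card ((\<lambda>k. (f ^^ k) a) ` {..3::nat}) \<le> card S" using mem S by (intro card_mono) auto
    ultimately show False using S by simp
  qed
  then obtain i j where ij: "i < j" "j \<le> 3" "(f ^^ i) a = (f ^^ j) a"
    unfolding inj_on_def by (metis atMost_iff linorder_neqE_nat)
  have inj: "b = c" if "(f ^^ k) b = (f ^^ k) c" "b \<in> S" "c \<in> S" for k b c
    using that
  proof (induction k arbitrary: b c)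
    case (Suc k)
    then have "(f ^^ k) (f b) = (f ^^ k) (f c)" by (simp add: funpow_swap1)
    then have "f b = f c" using Suc.IH Suc.prems f by blast
    then show ?case using f(2) Suc.prems by (auto simp: inj_on_def)
  qed simp
  have "(f ^^ i) a = (f ^^ i) ((f ^^ (j - i)) a)"
    using ij by (simp flip: funpow_add[THEN fun_cong, unfolded o_def])
  then have per: "(f ^^ (j - i)) a = a" using inj a mem by metis
  have "((f ^^ (j - i)) ^^ m) a = a" for m by (induction m) (simp_all add: per)
  then have m: "(f ^^ (m * (j - i))) a = a" for m by (simp add: funpow_mult mult.commute)
  \<comment> \<open>Among four iterates two coincide, so the orbit closes after 1, 2 or 3 steps, and
    6 is a multiple of each.\<close>
  have "j - i = 1 \<or> j - i = 2 \<or> j - i = 3" using ij by auto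
  then show ?thesis using m[of 6] m[of 3] m[of 2] by auto
qed

text \<open>The last two axioms concern a triangle, an element r of length 2 with three atoms below
  it: its atoms are cyclically ordered, b following a when a b = r. In \<open>cyclic_shift\<close>,
  s, t and u lie above an atom y outside r and above a, b and c; the conclusion, equivalent to s
  y^(-1) t = Delta, says that the order survives a shift along y.\<close>

locale garside_rank3 = garside_group +
  assumes len_Delta: "len \<Delta> = 3"
    and finite_simples: "finite (simples G)"
    and card_atoms: "\<lbrakk>r \<in> simples G; len r = 2\<rbrakk> \<Longrightarrow> card {a \<in> simples G. len a = 1 \<and> inv a \<otimes> r \<in> positive G} \<le> 3"
    and cyclic: "\<lbrakk>{r, a, b, c} \<subseteq> simples G; len r = 2; len a = 1; len b = 1; len c = 1;
        {inv a \<otimes> r, inv b \<otimes> r, inv c \<otimes> r} \<subseteq> positive G; a \<noteq> b; a \<noteq> c; b \<noteq> c\<rbrakk>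
        \<Longrightarrow> a \<otimes> b = r \<or> a \<otimes> c = r"
    and cyclic_shift: "\<lbrakk>{r, a, b, c, y, s, t, u} \<subseteq> simples G; len r = 2; len a = 1; len b = 1; len c = 1;
        {inv a \<otimes> r, inv b \<otimes> r, inv c \<otimes> r} \<subseteq> positive G; a \<noteq> b; a \<noteq> c; b \<noteq> c; a \<otimes> b = r;
        len y = 1; inv y \<otimes> r \<notin> positive G; len s = 2; len t = 2; len u = 2;
        {inv y \<otimes> s, inv y \<otimes> t, inv y \<otimes> u, inv a \<otimes> s, inv b \<otimes> t, inv c \<otimes> u} \<subseteq> positive G\<rbrakk>
        \<Longrightarrow> y \<otimes> inv s \<otimes> \<Delta> = t"
begin

text \<open>The chains c, sh c, sh a, c Delta and c, a, co c, c Delta are strict, and their ends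
  differ in length by 3. So every step has length 1.\<close>

lemma NB_len:
  assumes z: "z \<in> carrier G" "p < q" and np: "nonpower z" and c: "c \<in> V z p q" and a: "a \<in> NB z p q c"
  shows "len a = len c + 1" "len (sh z p c) = len c + 1" "len (co z q c) = len c + 2"
    "len (sh z p a) = len c + 2"
    "inv c \<otimes> a \<in> simples G" "inv c \<otimes> sh z p c \<in> simples G" "inv c \<otimes> co z q c \<in> simples G"
    "inv c \<otimes> sh z p a \<in> simples G"
    "a \<preceq> sh z p a" "sh z p c \<preceq> sh z p a" "a \<preceq> co z q c" "a \<in> V z p q" "a \<in> carrier G"
proof -
  have a': "a \<in> V z p q" "c \<preceq> a" "a \<preceq> co z q c" "a \<noteq> c" "a \<noteq> co z q c"
    using a unfolding NB_def by blast+
  have V: "sh z p c \<in> V z p q" "sh z p a \<in> V z p q" "co z q c \<in> V z p q"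
    using V_sh[OF z c] V_sh[OF z a'(1)] V_co[OF z c] by auto
  note G = V_carrier[OF c] V_carrier[OF a'(1)] V[THEN V_carrier]
  have EG: "E c \<in> carrier G" using G by simp
  have le: "c \<preceq> sh z p c" "sh z p c \<preceq> sh z p a" "co z q c \<preceq> E c" "a \<preceq> sh z p a"
    using le_sh[OF z c] sh_mono[OF z c a'(1,2)] co_le_E[OF z c] le_sh[OF z a'(1)] by blast+
  have sE: "sh z p a \<preceq> E c" using sh_mono[OF z a'(1) V(3) a'(3)] sh_inv_sh(2)[OF z c] by simp
  have ne: "sh z p c \<noteq> c" "sh z p c \<noteq> sh z p a" "sh z p a \<noteq> E c" "co z q c \<noteq> E c"
    using nonpower_neq[OF z c np] sh_inj[OF z c a'(1)] sh_inj[OF z a'(1) V(3)] a'(4,5) sh_inv_sh(2)[OF z c] by metis+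
  have lE: "len (E c) = len c + 3" using G by (simp add: len_mult len_Delta)
  have l1: "len c < len (sh z p c)" by (rule less_len[OF G(1,3) le(1) ne(1)[symmetric]])
  have l2: "len (sh z p c) < len (sh z p a)" by (rule less_len[OF G(3,4) le(2) ne(2)])
  have l3: "len (sh z p a) < len (E c)" by (rule less_len[OF G(4) EG sE ne(3)])
  have l4: "len c < len a" by (rule less_len[OF G(1,2) a'(2) a'(4)[symmetric]])
  have l5: "len a < len (co z q c)" by (rule less_len[OF G(2,5) a'(3,5)])
  have l6: "len (co z q c) < len (E c)" by (rule less_len[OF G(5) EG le(3) ne(4)])
  show "len a = len c + 1" "len (sh z p c) = len c + 1" "len (co z q c) = len c + 2" "len (sh z p a) = len c + 2"
    using l1 l2 l3 l4 l5 l6 lE by linarith+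
  have t1: "a \<preceq> E c" by (rule le_trans[OF G(2,5) EG a'(3) le(3)])
  have t2: "c \<preceq> sh z p a" by (rule le_trans[OF G(1,3,4) le(1,2)])
  show "inv c \<otimes> a \<in> simples G" "inv c \<otimes> sh z p c \<in> simples G" "inv c \<otimes> co z q c \<in> simples G"
    "inv c \<otimes> sh z p a \<in> simples G"
    using simple_interval[OF G(1,2) a'(2) t1] simple_interval[OF G(1,3) le(1) sh_le_E[OF z c]]
      simple_interval[OF G(1,5) le_co[OF z c] le(3)] simple_interval[OF G(1,4) t2 sE] by blast+
  show "a \<preceq> sh z p a" "sh z p c \<preceq> sh z p a" "a \<preceq> co z q c" "a \<in> V z p q" "a \<in> carrier G"
    using le a' G by blast+
qed

lemma len_diff: "\<lbrakk>c \<in> carrier G; d \<in> carrier G\<rbrakk> \<Longrightarrow> len (inv c \<otimes> d) = len d - len c"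
  by (simp add: len_mult len_inv)

text \<open>Relative to the axis point \<open>d\<close>, the neighbour \<open>b\<close> follows \<open>a\<close> in the cyclic order
  of the atoms below \<open>d\<^sup>-\<^sup>1 co d\<close>.\<close>

definition follows :: "'a \<Rightarrow> int \<Rightarrow> int \<Rightarrow> 'a \<Rightarrow> 'a \<Rightarrow> 'a \<Rightarrow> bool" where
  "follows z p q d a b \<longleftrightarrow> inv d \<otimes> a \<otimes> (inv d \<otimes> b) = inv d \<otimes> co z q d"

text \<open>Put y = d^(-1) sh d, s = d^(-1) sh a and t = d^(-1) sh b. Seen from sh d the shifted
  neighbours are y^(-1) s and y^(-1) t and the end is y^(-1) Delta, so the claim is s y^(-1) t =
  Delta. The third neighbour g ensures that d^(-1) co d is a triangle.\<close>

lemma follows_sh: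
  assumes z: "z \<in> carrier G" "p < q" and np: "nonpower z" and d: "d \<in> V z p q"
    and N: "a \<in> NB z p q d" "b \<in> NB z p q d" "g \<in> NB z p q d" "a \<noteq> b" "a \<noteq> g" "b \<noteq> g"
    and f: "follows z p q d a b"
  shows "follows z p q (sh z p d) (sh z p a) (sh z p b)"
proof -
  have dG: "d \<in> carrier G" using d V_carrier by blast
  have G: "sh z p d \<in> carrier G" "co z q d \<in> carrier G" "sh z p a \<in> carrier G" "sh z p b \<in> carrier G"
     "sh z p g \<in> carrier G" "a \<in> carrier G" "b \<in> carrier G" "g \<in> carrier G"
    using z dG NB_len(13)[OF z np d] N(1-3) by auto
  note L = NB_len[OF z np d N(1)] NB_len[OF z np d N(2)] NB_len[OF z np d N(3)]
  let ?i = "\<lambda>e. inv d \<otimes> e"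
  let ?y = "?i (sh z p d)" and ?r = "?i (co z q d)"
  have inj: "?i e = ?i e' \<longleftrightarrow> e = e'" if "e \<in> carrier G" "e' \<in> carrier G" for e e'
    using that dG by simp
  have nle: "\<not> sh z p d \<preceq> co z q d"
  proof
    assume "sh z p d \<preceq> co z q d"
    then have "sh z p d = d" using sh_meet_co[OF z d] G le_iff_meet by metis
    then show False using nonpower_neq(1)[OF z d np] by blast
  qed
  have "?y \<otimes> inv (?i (sh z p a)) \<otimes> \<Delta> = ?i (sh z p b)"
  proof (rule cyclic_shift[of ?r "?i a" "?i b" "?i g" ?y _ _ "?i (sh z p g)"])
    show "?i a \<otimes> ?i b = ?r" using f by (simp add: follows_def)
    show "inv ?y \<otimes> ?r \<notin> positive G" using nle le_complement dG G by blast
    show "{inv ?y \<otimes> ?i (sh z p a), inv ?y \<otimes> ?i (sh z p b), inv ?y \<otimes> ?i (sh z p g),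
        inv (?i a) \<otimes> ?i (sh z p a), inv (?i b) \<otimes> ?i (sh z p b), inv (?i g) \<otimes> ?i (sh z p g)} \<subseteq> positive G"
      using L le_complement dG G by blast
    show "{inv (?i a) \<otimes> ?r, inv (?i b) \<otimes> ?r, inv (?i g) \<otimes> ?r} \<subseteq> positive G"
      using L le_complement dG G by blast
    show "{?r, ?i a, ?i b, ?i g, ?y, ?i (sh z p a), ?i (sh z p b), ?i (sh z p g)} \<subseteq> simples G"
      using L by blast
    show "?i a \<noteq> ?i b" "?i a \<noteq> ?i g" "?i b \<noteq> ?i g" using inj N(4-6) G by blast+
  qed (use L len_diff dG G in simp_all)
  then have "d \<otimes> (inv d \<otimes> sh z p a \<otimes> inv ?y \<otimes> (?y \<otimes> inv (?i (sh z p a)) \<otimes> \<Delta>)) =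
     d \<otimes> (inv d \<otimes> sh z p a \<otimes> inv ?y \<otimes> ?i (sh z p b))" by simp
  then have "E d = sh z p a \<otimes> (inv (sh z p d) \<otimes> sh z p b)"
    using dG G by (simp add: inv_mult_group m_assoc)
  then show ?thesis
    unfolding follows_def sh_inv_sh(1)[OF z d] using dG G by (simp add: m_assoc)
qed

lemma follows_act:
  assumes "y \<in> carrier G" "z \<in> carrier G" "z \<otimes> y = y \<otimes> z" "d \<in> carrier G" "a \<in> carrier G" "b \<in> carrier G"
    and f: "follows z p q d a b"
  shows "follows z p q (act y s d) (act y s a) (act y s b)"
proof -
  have "z \<otimes> inv y = inv y \<otimes> z" using commute_inv assms by blast
  then have yz: "inv z \<otimes> y = y \<otimes> inv z"
    using commute_inv[of y z] assms by simp
  have cG: "co z q d \<in> carrier G" using assms by simp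
  have "act y s (co z q d) = act y s (act (inv z) (- q) d) \<curlywedge> act y s (E d)"
    unfolding sh_def using assms by (simp add: act_meet)
  also have "\<dots> = co z q (act y s d)"
    unfolding sh_def using assms yz by (simp add: act_act act_E add.commute)
  finally have co: "co z q (act y s d) = act y s (co z q d)" ..
  have i: "inv (act y s d) \<otimes> act y s e = D s \<otimes> (inv d \<otimes> e) \<otimes> D (- s)" if "e \<in> carrier G" for e
    using that assms by (simp add: act_def inv_mult_group m_assoc D_minus)
  have "D s \<otimes> (inv d \<otimes> a) \<otimes> D (- s) \<otimes> (D s \<otimes> (inv d \<otimes> b) \<otimes> D (- s)) =
    D s \<otimes> (inv d \<otimes> a \<otimes> (inv d \<otimes> b)) \<otimes> D (- s)"
    using assms by (simp add: m_assoc D_minus)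
  then show ?thesis
    unfolding follows_def co i[OF assms(5)] i[OF assms(6)] i[OF cG] using f by (simp add: follows_def)
qed

lemma follows_sh_pow:
  assumes z: "z \<in> carrier G" "p < q" and np: "nonpower z" and d: "d \<in> V z p q"
    and N: "a \<in> NB z p q d" "b \<in> NB z p q d" "g \<in> NB z p q d" "a \<noteq> b" "a \<noteq> g" "b \<noteq> g"
    and f: "follows z p q d a b"
  shows "follows z p q ((sh z p ^^ k) d) ((sh z p ^^ k) a) ((sh z p ^^ k) b)"
proof -
  let ?S = "\<lambda>e. (sh z p ^^ k) e"
  have "follows z p q (?S d) (?S a) (?S b) \<and> ?S d \<in> V z p q \<and> ?S a \<in> NB z p q (?S d) \<and>
    ?S b \<in> NB z p q (?S d) \<and> ?S g \<in> NB z p q (?S d) \<and> ?S a \<noteq> ?S b \<and> ?S a \<noteq> ?S g \<and> ?S b \<noteq> ?S g"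
  proof (induction k)
    case 0 then show ?case using d N f by simp
  next
    case (Suc k)
    let ?S = "\<lambda>e. (sh z p ^^ k) e"
    have IH: "follows z p q (?S d) (?S a) (?S b)" "?S d \<in> V z p q" "?S a \<in> NB z p q (?S d)"
      "?S b \<in> NB z p q (?S d)" "?S g \<in> NB z p q (?S d)" "?S a \<noteq> ?S b" "?S a \<noteq> ?S g" "?S b \<noteq> ?S g"
      using Suc by blast+
    then have "?S a \<in> V z p q" "?S b \<in> V z p q" "?S g \<in> V z p q" unfolding NB_def by blast+
    then have "sh z p (?S a) \<noteq> sh z p (?S b)" "sh z p (?S a) \<noteq> sh z p (?S g)" "sh z p (?S b) \<noteq> sh z p (?S g)"
      using sh_inj[OF z] IH(6-8) by blast+
    then show ?case
      using follows_sh[OF z np IH(2-8,1)] V_sh[OF z IH(2)] NB_sh[OF z IH(2)] IH(3-5)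
      by (simp only: funpow.simps o_def) blast
  qed
  then show ?thesis by blast
qed

text \<open>Translation by d^(-1) embeds the neighbours into the atoms below an element of length
  2.\<close>

lemma finite_NB:
  assumes z: "z \<in> carrier G" "p < q" and np: "nonpower z" and d: "d \<in> V z p q"
  shows "finite (NB z p q d) \<and> card (NB z p q d) \<le> 3"
proof (cases "NB z p q d = {}")
  case False
  then obtain a where a: "a \<in> NB z p q d" by blast
  have dG: "d \<in> carrier G" using d V_carrier by blast
  let ?r = "inv d \<otimes> co z q d"
  let ?A = "{a \<in> simples G. len a = 1 \<and> inv a \<otimes> ?r \<in> positive G}"
  have cG: "co z q d \<in> carrier G" using z dG by simp
  have r: "?r \<in> simples G" "len ?r = 2"
    using NB_len[OF z np d a] len_diff[OF dG cG] by auto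
  have sub: "(\<lambda>a. inv d \<otimes> a) ` NB z p q d \<subseteq> ?A"
  proof
    fix e assume "e \<in> (\<lambda>a. inv d \<otimes> a) ` NB z p q d"
    then obtain b where b: "b \<in> NB z p q d" "e = inv d \<otimes> b" by blast
    note B = NB_len[OF z np d b(1)]
    show "e \<in> ?A"
      using B(5) len_diff[OF dG B(13)] B(1) le_complement[OF dG B(13) cG] B(11) unfolding b(2) by simp
  qed
  have inj: "inj_on (\<lambda>a. inv d \<otimes> a) (NB z p q d)"
  proof (rule inj_onI)
    fix a b assume ab: "a \<in> NB z p q d" "b \<in> NB z p q d" "inv d \<otimes> a = inv d \<otimes> b"
    then show "a = b" using dG NB_len(13)[OF z np d ab(1)] NB_len(13)[OF z np d ab(2)] by simp
  qed
  have fin: "finite ?A" using finite_simples by simp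
  have "card (NB z p q d) = card ((\<lambda>a. inv d \<otimes> a) ` NB z p q d)" using inj by (simp add: card_image)
  also have "\<dots> \<le> card ?A" using sub fin by (rule card_mono[rotated])
  finally show ?thesis
    using card_atoms[OF r] finite_imageD[OF finite_subset[OF sub fin] inj] by simp
qed simp

text \<open>The sixth iterate of T fixes the at most three neighbours of 1. For the propagation,
  suppose U fixes d and its neighbour a but moves b. Then a, b and U b are distinct, so the
  successor of a is b or U b; U preserves successors of a, and a successor is unique, hence b = U
  b.\<close>

lemma V_pow_subset_V_pow6:
  assumes x: "x \<in> carrier G" "p < q" "\<one> \<in> V x p q" "\<And>k. x \<noteq> D k" and n: "1 \<le> n"
    and N: "N = n * 6"
    and black: "\<And>c d. \<lbrakk>c \<in> V (x [^] N) (int N * p) (int N * q); d \<in> V (x [^] N) (int N * p) (int N * q);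
        c \<preceq> d; d \<preceq> sh (x [^] N) (int N * p) c\<rbrakk> \<Longrightarrow> d = c \<or> d = sh (x [^] N) (int N * p) c"
  shows "V (x [^] N) (int N * p) (int N * q) \<subseteq> V (x [^] (6::nat)) (int 6 * p) (int 6 * q)"
proof -
  let ?z = "x [^] N" and ?P = "int N * p" and ?Q = "int N * q" and ?y = "x [^] (6::nat)"
  have N1: "1 \<le> N" using N n by simp
  have z: "?z \<in> carrier G" "?P < ?Q" using x N1 by auto
  have np: "nonpower ?z" using nonpower_pow[OF x N1] .
  have one: "\<one> \<in> V ?z ?P ?Q" using V_pow[OF x(1-3) N1] .
  have comm: "?z \<otimes> x [^] k = x [^] k \<otimes> ?z" for k :: nat using x(1) by (simp add: nat_pow_mult add.commute)
  have zx: "?z \<otimes> x = x \<otimes> ?z" using comm[of 1] x(1) by simp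
  have y: "?y \<in> carrier G" "int 6 * p \<le> int 6 * q" "int 6 * p < int 6 * q" using x by auto
  let ?U = "T ?y (int 6 * p) (int 6 * q) ?z ?P" and ?T = "T x p q ?z ?P"
  have UT: "?U c = (?T ^^ 6) c" if "c \<in> V ?z ?P ?Q" for c using T_pow[OF x(1,2) z zx that, of 6] .
  have T1: "?T \<one> = \<one>" using T_eq_iff[OF x(1) z(1)] sh_pow_root[OF x(1-3) N1] by simp
  interpret aT: axis_aut "carrier G" "(\<preceq>)" "(\<curlywedge>)" "act ?z ?P" "act (inv ?z) (- ?Q)" E "nat (?Q - ?P)" ?T
    using axis_aut_T[OF z x(1) zx] .
  interpret aU: axis_aut "carrier G" "(\<preceq>)" "(\<curlywedge>)" "act ?z ?P" "act (inv ?z) (- ?Q)" E "nat (?Q - ?P)" ?U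
    using axis_aut_T[OF z y(1) comm] .
  show ?thesis
  proof (rule V_root[OF z y(1) comm y(2) one])
    show "\<one> \<in> V ?y (int 6 * p) (int 6 * q)" using V_pow[OF x(1-3), of 6] by simp
    have "(?T ^^ k) \<one> = \<one>" for k by (induction k) (simp_all add: T1)
    then show "?U \<one> = \<one>" using UT[OF one] by simp
    show "?U d = d" if d: "d \<in> NB ?z ?P ?Q \<one>" for d
    proof -
      have dV: "d \<in> V ?z ?P ?Q" using d unfolding NB_def by blast
      have "(?T ^^ 6) d = d"
      proof (rule funpow6_card3[OF _ _ _ _ d])
        show "?T a \<in> NB ?z ?P ?Q \<one>" if "a \<in> NB ?z ?P ?Q \<one>" for a
          using aT.U_N[of \<one> a] one T1 that by (simp only: axis_V[OF z] axis_NB[OF z])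
        show "inj_on ?T (NB ?z ?P ?Q \<one>)"
          using aT.U_inj unfolding axis_V[OF z] NB_def by (auto intro!: inj_onI)
      qed (use finite_NB[OF z np one] in auto)
      then show ?thesis using UT[OF dV] by simp
    qed
    fix d a b assume d: "d \<in> V ?z ?P ?Q" "?U d = d" and a: "a \<in> NB ?z ?P ?Q d" "?U a = a" and b: "b \<in> NB ?z ?P ?Q d"
    have ab: "a \<in> V ?z ?P ?Q" "b \<in> V ?z ?P ?Q" using a b unfolding NB_def by blast+
    have Ub: "?U b \<in> NB ?z ?P ?Q d"
      using aU.U_N[of d b] d b by (simp only: axis_V[OF z] axis_NB[OF z])
    have UbV: "?U b \<in> V ?z ?P ?Q" using Ub unfolding NB_def by blast
    have U_inj: "e = e'" if "e \<in> V ?z ?P ?Q" "e' \<in> V ?z ?P ?Q" "?U e = ?U e'" for e e'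
      using aU.U_inj[of e e'] that by (simp only: axis_V[OF z])
    show "?U b = b"
    proof (rule ccontr)
      assume nb: "?U b \<noteq> b"
      have ne: "a \<noteq> b" "a \<noteq> ?U b" using nb a(2) U_inj[OF ab] by auto
      have dG: "d \<in> carrier G" using d V_carrier by blast
      let ?i = "\<lambda>e. inv d \<otimes> e"
      note La = NB_len[OF z np d(1) a(1)] and Lb = NB_len[OF z np d(1) b] and Lu = NB_len[OF z np d(1) Ub]
      have cG: "co ?z ?Q d \<in> carrier G" using z dG by simp
      have U_follows: "follows ?z ?P ?Q d a (?U e)"
        if e: "e \<in> NB ?z ?P ?Q d" "e' \<in> NB ?z ?P ?Q d" "a \<noteq> e" "a \<noteq> e'" "e \<noteq> e'" "follows ?z ?P ?Q d a e" for e e'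
      proof -
        let ?S = "sh ?z ?P ^^ nat (int 6 * q - int 6 * p)"
        have "follows ?z ?P ?Q (?S d) (?S a) (?S e)"
          by (rule follows_sh_pow[OF z np d(1) a(1) e(1-5) e(6)])
        moreover have "?z \<otimes> inv ?y = inv ?y \<otimes> ?z" using commute_inv[OF z(1) y(1) comm] .
        moreover have "?S c \<in> carrier G" if "c \<in> V ?z ?P ?Q" for c
          using V_carrier[OF sh_pow_commute(3)[OF z one_closed _ that]] z by simp
        moreover have "e \<in> V ?z ?P ?Q" using e unfolding NB_def by blast
        ultimately have "follows ?z ?P ?Q (?U d) (?U a) (?U e)"
          unfolding T_def using d ab y z by (intro follows_act) auto
        then show ?thesis using d a by simp
      qed
      have "?i a \<otimes> ?i b = ?i (co ?z ?Q d) \<or> ?i a \<otimes> ?i (?U b) = ?i (co ?z ?Q d)"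
      proof (rule cyclic)
        show "{inv (?i a) \<otimes> ?i (co ?z ?Q d), inv (?i b) \<otimes> ?i (co ?z ?Q d), inv (?i (?U b)) \<otimes> ?i (co ?z ?Q d)} \<subseteq> positive G"
          using La(11,13) Lb(11,13) Lu(11,13) le_complement[OF dG _ cG] by blast
        show "?i a \<noteq> ?i b" "?i a \<noteq> ?i (?U b)" "?i b \<noteq> ?i (?U b)"
          using ne nb dG La(13) Lb(13) Lu(13) by auto
      qed (use La(1,3,5,7,13) Lb(1,5,13) Lu(1,5,13) len_diff[OF dG] cG in simp_all)
      then consider "follows ?z ?P ?Q d a b" | "follows ?z ?P ?Q d a (?U b)"
        unfolding follows_def by blast
      then show False
      proof cases
        case 1
        then have "follows ?z ?P ?Q d a (?U b)" using U_follows[OF b Ub ne nb[symmetric]] by blast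
        then have "?i a \<otimes> ?i b = ?i a \<otimes> ?i (?U b)" using 1 unfolding follows_def by simp
        then show False using nb dG La(13) Lb(13) Lu(13) by simp
      next
        case 2
        then have "follows ?z ?P ?Q d a (?U (?U b))" using U_follows[OF Ub b ne(2,1) nb] by blast
        then have "?i a \<otimes> ?i (?U b) = ?i a \<otimes> ?i (?U (?U b))" using 2 unfolding follows_def by simp
        moreover have "?U (?U b) \<in> carrier G"
          using aU.U_V[of "?U b"] UbV V_carrier by (simp only: axis_V[OF z]) blast
        ultimately have "?U b = ?U (?U b)" using dG La(13) Lu(13) by simp
        then show False using U_inj[OF ab(2) UbV] nb by simp
      qed
    qed
  qed (use black in blast)
qed

lemma len_sh_pow:
  assumes "\<And>k. k < m \<Longrightarrow> len ((sh z p ^^ Suc k) c) = len ((sh z p ^^ k) c) + 1"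
  shows "len ((sh z p ^^ m) c) = len c + int m"
  using assms by (induction m) auto

text \<open>If some interval from c to co c has an interior point, the length count shows that no
  interval from d to sh d has one. Otherwise the inverse of x is used, for which the two kinds of
  intervals are exchanged.\<close>

lemma V_pow_subset_rank3:
  assumes x: "x \<in> carrier G" "p < q" "\<one> \<in> V x p q" "\<And>k. x \<noteq> D k" and n: "1 \<le> n"
  shows "V (x [^] n) (int n * p) (int n * q) \<subseteq> V (x [^] (6::nat)) (int 6 * p) (int 6 * q)"
proof -
  define N where "N = n * 6"
  let ?z = "x [^] N" and ?P = "int N * p" and ?Q = "int N * q"
  have N1: "1 \<le> N" using n by (simp add: N_def)
  have z: "?z \<in> carrier G" "?P < ?Q" using x N1 by auto
  have np: "nonpower ?z" using nonpower_pow[OF x N1] .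
  have x': "inv x \<in> carrier G" "- q < - p" "\<one> \<in> V (inv x) (- q) (- p)" "\<And>k. inv x \<noteq> D k"
  proof -
    show "inv x \<noteq> D k" for k
    proof
      assume "inv x = D k"
      then have "x = D (- k)" using inv_inv[OF x(1)] D_minus by metis
      then show False using x(4) by blast
    qed
  qed (use x V_inv in auto)
  have nq: "int k * (- p) = - (int k * p)" "int k * (- q) = - (int k * q)" for k :: nat by simp_all
  have Vinv: "V (inv x [^] k) (int k * (- q)) (int k * (- p)) = V (x [^] k) (int k * p) (int k * q)" for k
    unfolding nq inv_pow[OF x(1), symmetric] by (rule V_inv) (use x in simp)
  have sub: "V (x [^] n) (int n * p) (int n * q) \<subseteq> V ?z ?P ?Q"
  proof
    fix c assume "c \<in> V (x [^] n) (int n * p) (int n * q)"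
    from V_pow[OF _ _ this, of 6] show "c \<in> V ?z ?P ?Q"
      using x n by (simp add: nat_pow_pow N_def mult_ac)
  qed
  have "V ?z ?P ?Q \<subseteq> V (x [^] (6::nat)) (int 6 * p) (int 6 * q)"
  proof (cases "\<exists>c\<in>V ?z ?P ?Q. NB ?z ?P ?Q c \<noteq> {}")
    case True
    then obtain c a where c: "c \<in> V ?z ?P ?Q" and a: "a \<in> NB ?z ?P ?Q c" by blast
    show ?thesis
    proof (rule V_pow_subset_V_pow6[OF x n N_def], rule ccontr)
      fix d e assume d: "d \<in> V ?z ?P ?Q" "e \<in> V ?z ?P ?Q" "d \<preceq> e" "e \<preceq> sh ?z ?P d"
        and "\<not> (e = d \<or> e = sh ?z ?P d)"
      then have ne: "e \<noteq> d" "e \<noteq> sh ?z ?P d" by auto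
      let ?S = "sh ?z ?P"
      have SN: "(?S ^^ k) c \<in> V ?z ?P ?Q \<and> (?S ^^ k) a \<in> NB ?z ?P ?Q ((?S ^^ k) c)" for k
        by (induction k) (use c a V_sh[OF z] NB_sh[OF z] in auto)
      have 1: "len ((?S ^^ nat (?Q - ?P)) c) = len c + int (nat (?Q - ?P))"
        by (intro len_sh_pow) (simp add: NB_len(2)[OF z np conjunct1[OF SN] conjunct2[OF SN]])
      have Sd: "(?S ^^ k) d \<in> V ?z ?P ?Q \<and> (?S ^^ k) e \<in> V ?z ?P ?Q \<and> (?S ^^ k) d \<preceq> (?S ^^ k) e \<and>
          (?S ^^ k) e \<preceq> (?S ^^ Suc k) d \<and> (?S ^^ k) e \<noteq> (?S ^^ k) d \<and> (?S ^^ k) e \<noteq> (?S ^^ Suc k) d" for k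
      proof (induction k)
        case 0 then show ?case using d ne by simp
      next
        case (Suc k)
        let ?d = "(?S ^^ k) d" and ?e = "(?S ^^ k) e"
        have IH: "?d \<in> V ?z ?P ?Q" "?e \<in> V ?z ?P ?Q" "?d \<preceq> ?e" "?e \<preceq> ?S ?d" "?e \<noteq> ?d" "?e \<noteq> ?S ?d"
          using Suc by auto
        have V': "?S ?d \<in> V ?z ?P ?Q" "?S ?e \<in> V ?z ?P ?Q" using V_sh[OF z] IH by auto
        show ?case
          using V' sh_mono[OF z IH(1,2,3)] sh_mono[OF z IH(2) V'(1) IH(4)]
            sh_inj[OF z IH(2,1)] sh_inj[OF z IH(2) V'(1)] IH(5,6) by auto
      qed
      have step: "len ((?S ^^ k) d) + 2 \<le> len ((?S ^^ Suc k) d)" for k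
      proof -
        have G: "(?S ^^ k) d \<in> carrier G" "(?S ^^ k) e \<in> carrier G" "(?S ^^ Suc k) d \<in> carrier G"
          using Sd[of k] Sd[of "Suc k"] V_carrier by blast+
        have "len ((?S ^^ k) d) < len ((?S ^^ k) e)" using Sd[of k] by (intro less_len G) auto
        moreover have "len ((?S ^^ k) e) < len ((?S ^^ Suc k) d)" using Sd[of k] by (intro less_len G) blast+
        ultimately show ?thesis by linarith
      qed
      have 2: "len ((?S ^^ m) d) \<ge> len d + 2 * int m" for m
      proof (induction m)
        case (Suc m) then show ?case using step[of m] by simp
      qed simp
      have act_len: "len (act ?z ?P e) - len e = len (act ?z ?P \<one>)" if "e \<in> carrier G" for e
        using that z by (simp add: act_def len_mult)
      \<comment> \<open>The translation changes all lengths by the same amount. Along the axis of c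
        this amount is Q - P; along the axis of d it is at least 2 (Q - P).\<close>
      have "len (act ?z ?P \<one>) = int (nat (?Q - ?P))"
        using 1 act_len[of c] V_carrier[OF c] sh_pow_l[OF z c] by simp
      moreover have "len (act ?z ?P \<one>) \<ge> 2 * int (nat (?Q - ?P))"
        using 2[of "nat (?Q - ?P)"] act_len[of d] V_carrier[OF d(1)] sh_pow_l[OF z d(1)] by simp
      moreover have "0 < int (nat (?Q - ?P))" using z(2) by simp
      ultimately show False by linarith
    qed
  next
    case False
    have "V (inv x [^] N) (int N * (- q)) (int N * (- p)) \<subseteq> V (inv x [^] (6::nat)) (int 6 * (- q)) (int 6 * (- p))"
    proof (rule V_pow_subset_V_pow6[OF x' n N_def])
      fix c d assume "c \<in> V (inv x [^] N) (int N * (- q)) (int N * (- p))"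
        "d \<in> V (inv x [^] N) (int N * (- q)) (int N * (- p))" "c \<preceq> d" "d \<preceq> sh (inv x [^] N) (int N * (- q)) c"
      then have cd: "c \<in> V ?z ?P ?Q" "d \<in> V ?z ?P ?Q" "c \<preceq> d" "d \<preceq> co ?z ?Q c"
        unfolding Vinv by (simp_all only: nq inv_pow[OF x(1)])
      then have "d = c \<or> d = co ?z ?Q c" using False unfolding NB_def by blast
      then show "d = c \<or> d = sh (inv x [^] N) (int N * (- q)) c" by (simp only: nq inv_pow[OF x(1)])
    qed
    then show ?thesis unfolding Vinv .
  qed
  then show ?thesis using sub by blast
qed

end

section \<open>Presented groups\<close>

lemma word_cong_lists: "(u, v) \<in> word_cong A R \<Longrightarrow> u \<in> lists A \<and> v \<in> lists A"
  by (induction rule: word_cong.induct) auto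

lemma word_cong_context:
  "(u, v) \<in> word_cong A R \<Longrightarrow> p \<in> lists A \<Longrightarrow> q \<in> lists A \<Longrightarrow> (p @ u @ q, p @ v @ q) \<in> word_cong A R"
proof (induction rule: word_cong.induct)
  case (refl u) then show ?case by (intro word_cong.refl) auto
next
  case (rel u v p' q')
  then have "((p @ p') @ u @ (q' @ q), (p @ p') @ v @ (q' @ q)) \<in> word_cong A R"
    by (intro word_cong.rel) auto
  then show ?case by simp
next
  case (sym u v) then show ?case using word_cong.sym by blast
next
  case (trans u v w) then show ?case using word_cong.trans by blast
qed

lemma word_cong_append:
  assumes "(u, u') \<in> word_cong A R" "(v, v') \<in> word_cong A R"
  shows "(u @ v, u' @ v') \<in> word_cong A R"
proof -
  note L = word_cong_lists[OF assms(1)] word_cong_lists[OF assms(2)]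
  have "(u @ v, u' @ v) \<in> word_cong A R" using word_cong_context[OF assms(1), of "[]" v] L by simp
  moreover have "(u' @ v, u' @ v') \<in> word_cong A R" using word_cong_context[OF assms(2), of u' "[]"] L by simp
  ultimately show ?thesis by (rule word_cong.trans)
qed

lemma equiv_word_cong: "equiv (lists A) (word_cong A R)"
proof -
  have "word_cong A R \<subseteq> lists A \<times> lists A" using word_cong_lists by fastforce
  moreover have "refl_on (lists A) (word_cong A R)" by (rule refl_onI) (rule word_cong.refl)
  moreover have "sym (word_cong A R)" by (rule symI) (rule word_cong.sym)
  moreover have "trans (word_cong A R)" by (rule transI) (rule word_cong.trans)
  ultimately show ?thesis by (simp add: equiv_def)
qed

text \<open>The universal property in the form of a letter action. It makes both the length and the
  action on normal forms independent of the representing word.\<close>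

lemma word_cong_invariant:
  assumes "(u, v) \<in> word_cong A R" "x \<in> X"
    and closed: "\<And>a x. a \<in> A \<Longrightarrow> x \<in> X \<Longrightarrow> f a x \<in> X"
    and rel: "\<And>u v x. (u, v) \<in> R \<Longrightarrow> u \<in> lists A \<Longrightarrow> v \<in> lists A \<Longrightarrow> x \<in> X \<Longrightarrow> foldr f u x = foldr f v x"
  shows "foldr f u x = foldr f v x"
  using assms(1,2)
proof (induction arbitrary: x rule: word_cong.induct)
  case (rel u v p q)
  have "foldr f q x \<in> X" using \<open>q \<in> lists A\<close> \<open>x \<in> X\<close> by (induction q) (auto intro: closed)
  then show ?case using assms(4)[OF rel(1-3)] by simp
qed auto

locale word_group =
  fixes A :: "'a set" and R :: "('a list \<times> 'a list) set" and d :: "'a list"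
  assumes d_lists: "d \<in> lists A"
begin

abbreviation "W \<equiv> lists (A \<times> (UNIV :: bool set))"
abbreviation "GC \<equiv> group_cong A R"
abbreviation "G \<equiv> presented_garside A R d"
abbreviation mulG (infixl "\<cdot>" 70) where "x \<cdot> y \<equiv> x \<otimes>\<^bsub>G\<^esub> y"
abbreviation invG ("inv\<^sub>G _" [81] 80) where "inv\<^sub>G x \<equiv> inv\<^bsub>G\<^esub> x"

definition cl where "cl w = GC `` {w}"

lemma equiv_GC: "equiv W GC" unfolding group_cong_def by (rule equiv_word_cong)

lemma cl_eq_iff: "u \<in> W \<Longrightarrow> v \<in> W \<Longrightarrow> cl u = cl v \<longleftrightarrow> (u, v) \<in> GC"
  unfolding cl_def using eq_equiv_class_iff[OF equiv_GC] .

lemma cl_carrier [simp]: "w \<in> W \<Longrightarrow> cl w \<in> carrier G"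
  by (auto simp: presented_garside_def cl_def quotient_def)

lemma carrierE: assumes "g \<in> carrier G" obtains w where "w \<in> W" "g = cl w"
  using assms by (auto simp: presented_garside_def cl_def quotient_def)

lemma GC_append: "(u, u') \<in> GC \<Longrightarrow> (v, v') \<in> GC \<Longrightarrow> (u @ v, u' @ v') \<in> GC"
  unfolding group_cong_def by (rule word_cong_append)

lemma GC_W: "(u, v) \<in> GC \<Longrightarrow> u \<in> W \<and> v \<in> W"
  unfolding group_cong_def by (rule word_cong_lists)

lemma cl_mult: assumes "u \<in> W" "v \<in> W" shows "cl u \<cdot> cl v = cl (u @ v)"
proof -
  have "GC `` {u' @ v'} = cl (u @ v)" if "u' \<in> cl u" "v' \<in> cl v" for u' v'
  proof -
    have "(u, u') \<in> GC" "(v, v') \<in> GC" using that by (auto simp: cl_def)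
    then have uv: "(u @ v, u' @ v') \<in> GC" by (rule GC_append)
    then have "cl (u @ v) = cl (u' @ v')" using GC_W[OF uv] cl_eq_iff by blast
    then show ?thesis by (simp add: cl_def)
  qed
  moreover have "u \<in> cl u" "v \<in> cl v"
    using assms equiv_GC by (auto simp: cl_def equiv_def refl_on_def)
  ultimately show ?thesis by (auto simp: presented_garside_def)
qed

lemma cl_one: "\<one>\<^bsub>G\<^esub> = cl []" by (simp add: presented_garside_def cl_def)

lemma cl_cancel: "(a, b) \<in> A \<times> UNIV \<Longrightarrow> cl [(a, b), (a, \<not> b)] = cl []"
proof -
  assume ab: "(a, b) \<in> A \<times> (UNIV :: bool set)"
  have "([] @ [(a, b), (a, \<not> b)] @ [], [] @ [] @ []) \<in> GC"
    unfolding group_cong_def using ab by (intro word_cong.rel) auto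
  then show ?thesis using ab cl_eq_iff[of "[(a, b), (a, \<not> b)]" "[]"] by simp
qed

lemma cl_append_inverse:
  "w \<in> W \<Longrightarrow> cl (rev (map (\<lambda>(a, b). (a, \<not> b)) w) @ w) = cl []"
proof (induction w)
  case (Cons x w)
  obtain a b where x: "x = (a, b)" by (cases x)
  let ?r = "rev (map (\<lambda>(a, b). (a, \<not> b)) w)"
  have w: "w \<in> W" "a \<in> A" using Cons.prems x by auto
  have r: "?r \<in> W" using w by (auto simp: in_lists_conv_set)
  have "cl (?r @ [(a, \<not> b), (a, \<not> \<not> b)] @ w) = cl ?r \<cdot> (cl [(a, \<not> b), (a, \<not> \<not> b)] \<cdot> cl w)"
    using r w by (subst cl_mult; simp add: cl_mult)
  also have "\<dots> = cl ?r \<cdot> (cl [] \<cdot> cl w)" using cl_cancel[of a "\<not> b"] w by simp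
  also have "\<dots> = cl (?r @ w)" using r w by (simp add: cl_mult)
  finally show ?case using Cons x by simp
qed simp

lemma group_G: "group G"
proof (rule groupI)
  show "\<one>\<^bsub>G\<^esub> \<in> carrier G" by (simp add: cl_one)
  fix x assume "x \<in> carrier G"
  then obtain u where u: "u \<in> W" "x = cl u" by (rule carrierE)
  show "\<one>\<^bsub>G\<^esub> \<cdot> x = x" using u by (simp add: cl_one cl_mult)
  have "rev (map (\<lambda>(a, b). (a, \<not> b)) u) \<in> W" using u by (auto simp: in_lists_conv_set)
  then show "\<exists>y\<in>carrier G. y \<cdot> x = \<one>\<^bsub>G\<^esub>"
    using u cl_append_inverse[OF u(1)]
    by (intro bexI[of _ "cl (rev (map (\<lambda>(a, b). (a, \<not> b)) u))"]) (simp_all add: cl_mult cl_one)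
  fix y assume "y \<in> carrier G"
  then obtain v where v: "v \<in> W" "y = cl v" by (rule carrierE)
  then show "x \<cdot> y \<in> carrier G" using u by (simp add: cl_mult)
  fix z assume "z \<in> carrier G"
  then obtain w where w: "w \<in> W" "z = cl w" by (rule carrierE)
  show "x \<cdot> y \<cdot> z = x \<cdot> (y \<cdot> z)" using u v w by (simp add: cl_mult)
qed

definition gen where "gen w = cl (pos_word w)"

lemma pos_word_W [simp]: "w \<in> lists A \<Longrightarrow> pos_word w \<in> W"
  by (auto simp: pos_word_def in_lists_conv_set)

lemma gen_carrier [simp]: "w \<in> lists A \<Longrightarrow> gen w \<in> carrier G" by (simp add: gen_def)

lemma gen_append: "u \<in> lists A \<Longrightarrow> v \<in> lists A \<Longrightarrow> gen (u @ v) = gen u \<cdot> gen v"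
  by (simp add: gen_def cl_mult) (simp add: pos_word_def)

lemma gen_Nil: "gen [] = \<one>\<^bsub>G\<^esub>" by (simp add: gen_def cl_one pos_word_def)

lemma positive_G: "positive G = gen ` lists A"
  by (simp add: presented_garside_def gen_def cl_def)

lemma Delta_G: "\<Delta>\<^bsub>G\<^esub> = gen d"
  by (simp add: presented_garside_def gen_def cl_def)

lemma gen_cong: "(u, v) \<in> word_cong A R \<Longrightarrow> gen u = gen v"
proof (induction rule: word_cong.induct)
  case (rel u v p q)
  have "(pos_word p @ pos_word u @ pos_word q, pos_word p @ pos_word v @ pos_word q) \<in> GC"
    unfolding group_cong_def using rel pos_word_W by (intro word_cong.rel) auto
  moreover have "pos_word (a @ b) = pos_word a @ pos_word b" for a b :: "'a list" by (simp add: pos_word_def)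
  ultimately show ?case
    using rel cl_eq_iff[OF pos_word_W pos_word_W, of "p @ u @ q" "p @ v @ q"] by (simp add: gen_def)
qed auto

lemma inverse_letter: assumes "a \<in> A" shows "cl [(a, False)] = inv\<^sub>G gen [a]"
proof -
  have "cl [(a, False)] \<cdot> gen [a] = \<one>\<^bsub>G\<^esub>"
    using assms cl_cancel[of a False] by (simp add: gen_def pos_word_def cl_mult cl_one)
  then show ?thesis using assms group.inv_equality[OF group_G] by simp
qed

lemma carrier_induct [consumes 1, case_names one pos inverse]:
  assumes g: "g \<in> carrier G" and one: "P \<one>\<^bsub>G\<^esub>"
    and pos: "\<And>a h. \<lbrakk>a \<in> A; h \<in> carrier G; P h\<rbrakk> \<Longrightarrow> P (gen [a] \<cdot> h)"
    and inverse: "\<And>a h. \<lbrakk>a \<in> A; h \<in> carrier G; P h\<rbrakk> \<Longrightarrow> P (inv\<^sub>G gen [a] \<cdot> h)"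
  shows "P g"
proof -
  obtain w where w: "w \<in> W" "g = cl w" using g by (rule carrierE)
  have "P (cl w)" using w(1)
  proof (induction w rule: list.induct)
    case Nil then show ?case using one by (simp add: cl_one)
  next
    case (Cons x w)
    obtain a b where x: "x = (a, b)" by (cases x)
    have a: "a \<in> A" "w \<in> W" using Cons.prems x by auto
    have "cl (x # w) = cl [(a, b)] \<cdot> cl w" using a x by (simp add: cl_mult)
    moreover have "cl [(a, b)] = (if b then gen [a] else inv\<^sub>G gen [a])"
      using a inverse_letter by (simp add: gen_def pos_word_def)
    ultimately show ?case using a Cons pos inverse by simp
  qed
  then show ?thesis using w by simp
qed

text \<open>The exponent sum of a chosen representative; for homogeneous relations every
  representative gives the same value.\<close>

definition len :: "('a \<times> bool) list set \<Rightarrow> int" where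
  "len g = foldr (\<lambda>(a, b) n. n + (if b then 1 else - 1)) (SOME w. w \<in> g) 0"

lemma len_cl:
  assumes homog: "\<And>u v. (u, v) \<in> R \<Longrightarrow> length u = length v" and w: "w \<in> W"
  shows "len (cl w) = foldr (\<lambda>(a, b) n. n + (if b then 1 else - 1)) w 0"
proof -
  let ?f = "\<lambda>(a :: 'a, b) n. n + (if b then 1 else - 1 :: int)"
  have pos: "foldr ?f (pos_word u) n = n + int (length u)" for u n
    by (induction u) (auto simp: pos_word_def)
  have "w \<in> cl w" using w equiv_GC by (auto simp: cl_def equiv_def refl_on_def)
  then have "(SOME u. u \<in> cl w) \<in> cl w" by (rule someI)
  then have "(w, SOME u. u \<in> cl w) \<in> GC" by (simp add: cl_def)
  then have "foldr ?f w 0 = foldr ?f (SOME u. u \<in> cl w) 0"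
    unfolding group_cong_def
    by (rule word_cong_invariant[where X = UNIV]) (auto simp: pos homog)
  then show ?thesis by (simp add: len_def)
qed

lemma len_gen:
  assumes homog: "\<And>u v. (u, v) \<in> R \<Longrightarrow> length u = length v" and w: "w \<in> lists A"
  shows "len (gen w) = int (length w)"
proof -
  have "foldr (\<lambda>(a, b) n. n + (if b then 1 else - 1)) (pos_word u) n = n + int (length u)"
    for u :: "'a list" and n :: int
    by (induction u) (auto simp: pos_word_def)
  then show ?thesis unfolding gen_def using len_cl[OF homog] w by simp
qed

lemma len_mult:
  assumes homog: "\<And>u v. (u, v) \<in> R \<Longrightarrow> length u = length v" and g: "g \<in> carrier G" "h \<in> carrier G"
  shows "len (g \<cdot> h) = len g + len h"
proof -
  obtain u where u: "u \<in> W" "g = cl u" using g(1) by (rule carrierE)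
  obtain v where v: "v \<in> W" "h = cl v" using g(2) by (rule carrierE)
  have "foldr (\<lambda>(a :: 'a, b) n. n + (if b then 1 else - 1)) u (n + m) =
      foldr (\<lambda>(a, b) n. n + (if b then 1 else - 1)) u n + m" for n m :: int
    by (induction u) auto
  from this[of 0 "foldr (\<lambda>(a :: 'a, b) n. n + (if b then 1 else - 1)) v 0"] show ?thesis
    using u v by (simp add: cl_mult len_cl[OF homog])
qed

end

section \<open>Garside germs\<close>

text \<open>An abstract lattice of simple elements under prefixes. The product is partial, being
  defined when it is again simple; \<open>cmp\<close> is the right complement in \<open>dl\<close>,
  the future Delta. Conjugation by Delta is \<open>cmp\<close> applied twice, so
  \<open>cmp_ord\<close> states that its order divides \<open>ord\<close>.\<close>

locale germ =
  fixes S :: "'s set" and mul :: "'s \<Rightarrow> 's \<Rightarrow> 's option" and e dl :: 's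
    and cmp :: "'s \<Rightarrow> 's" and mt :: "'s \<Rightarrow> 's \<Rightarrow> 's" and ord :: nat
  assumes e_S [simp]: "e \<in> S" and dl_S [simp]: "dl \<in> S" and cmp_S [simp]: "s \<in> S \<Longrightarrow> cmp s \<in> S"
    and mt_S [simp]: "\<lbrakk>s \<in> S; t \<in> S\<rbrakk> \<Longrightarrow> mt s t \<in> S"
    and mul_S: "\<lbrakk>s \<in> S; t \<in> S; mul s t = Some u\<rbrakk> \<Longrightarrow> u \<in> S"
    and e_mul [simp]: "s \<in> S \<Longrightarrow> mul e s = Some s" and mul_e [simp]: "s \<in> S \<Longrightarrow> mul s e = Some s"
    and assoc: "\<lbrakk>s \<in> S; t \<in> S; u \<in> S\<rbrakk> \<Longrightarrow>
      Option.bind (mul s t) (\<lambda>x. mul x u) = Option.bind (mul t u) (mul s)"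
    and cancel: "\<lbrakk>s \<in> S; t \<in> S; t' \<in> S; mul s t = Some x; mul s t' = Some x\<rbrakk> \<Longrightarrow> t = t'"
    and mul_cmp [simp]: "s \<in> S \<Longrightarrow> mul s (cmp s) = Some dl"
    and unit: "\<lbrakk>s \<in> S; t \<in> S; mul s t = Some e\<rbrakk> \<Longrightarrow> s = e"
    and mt_le: "\<lbrakk>s \<in> S; t \<in> S\<rbrakk> \<Longrightarrow> \<exists>u\<in>S. mul (mt s t) u = Some s"
      "\<lbrakk>s \<in> S; t \<in> S\<rbrakk> \<Longrightarrow> \<exists>u\<in>S. mul (mt s t) u = Some t"
    and mt_greatest: "\<lbrakk>r \<in> S; s \<in> S; t \<in> S; \<exists>u\<in>S. mul r u = Some s; \<exists>u\<in>S. mul r u = Some t\<rbrakk>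
      \<Longrightarrow> \<exists>u\<in>S. mul r u = Some (mt s t)"
    and join: "\<lbrakk>s \<in> S; t \<in> S\<rbrakk> \<Longrightarrow> \<exists>j\<in>S. (\<exists>u\<in>S. mul s u = Some j) \<and> (\<exists>u\<in>S. mul t u = Some j) \<and>
      (\<forall>w\<in>S. (\<exists>u\<in>S. mul s u = Some w) \<longrightarrow> (\<exists>u\<in>S. mul t u = Some w) \<longrightarrow> (\<exists>u\<in>S. mul j u = Some w))"
    and cmp_ord: "s \<in> S \<Longrightarrow> (cmp ^^ (2 * ord)) s = s" and ord_pos: "0 < ord"
    and e_neq_dl: "e \<noteq> dl"
begin

definition le (infix "\<preceq>" 50) where "s \<preceq> t \<longleftrightarrow> (\<exists>u\<in>S. mul s u = Some t)"

lemma leI: "u \<in> S \<Longrightarrow> mul s u = Some t \<Longrightarrow> s \<preceq> t" by (auto simp: le_def)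

lemma assoc_left:
  assumes "s \<in> S" "t \<in> S" "u \<in> S" "mul s t = Some x" "mul x u = Some y"
  obtains z where "z \<in> S" "mul t u = Some z" "mul s z = Some y"
proof -
  have b: "Option.bind (mul t u) (mul s) = Some y"
    unfolding assoc[OF assms(1-3), symmetric] assms(4) by (simp add: assms(5))
  then obtain z where z: "mul t u = Some z" "mul s z = Some y" by (cases "mul t u") simp_all
  then show ?thesis using that[OF mul_S[OF assms(2,3) z(1)]] by blast
qed

lemma assoc_right:
  assumes "s \<in> S" "t \<in> S" "u \<in> S" "mul t u = Some z" "mul s z = Some y"
  obtains x where "x \<in> S" "mul s t = Some x" "mul x u = Some y"
proof -
  have b: "Option.bind (mul s t) (\<lambda>x. mul x u) = Some y"
    unfolding assoc[OF assms(1-3)] assms(4) by (simp add: assms(5))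
  then obtain x where x: "mul s t = Some x" "mul x u = Some y" by (cases "mul s t") simp_all
  then show ?thesis using that[OF mul_S[OF assms(1,2) x(1)]] by blast
qed

lemma le_refl: "s \<in> S \<Longrightarrow> s \<preceq> s" using leI[of e s s] by simp

lemma le_trans: assumes "s \<in> S" "t \<in> S" "u \<in> S" "s \<preceq> t" "t \<preceq> u" shows "s \<preceq> u"
  using assms by (metis assoc_left le_def)

lemma unit2: "\<lbrakk>s \<in> S; t \<in> S; mul s t = Some e\<rbrakk> \<Longrightarrow> t = e"
  using unit[of s t] by auto

lemma le_antisym: assumes "s \<in> S" "t \<in> S" "s \<preceq> t" "t \<preceq> s" shows "s = t"
proof -
  obtain u v where uv: "u \<in> S" "mul s u = Some t" "v \<in> S" "mul t v = Some s" using assms by (auto simp: le_def)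
  obtain w where w: "w \<in> S" "mul u v = Some w" "mul s w = Some s" using assoc_left[OF assms(1) uv(1,3,2,4)] .
  then have "w = e" using cancel[of s w e] assms by simp
  then have "u = e" using unit w uv by blast
  then show ?thesis using uv assms by simp
qed

lemma mul_le_mul:
  assumes "t \<in> S" "f \<in> S" "g \<in> S" "mul t f = Some a" "mul t g = Some b"
  shows "a \<preceq> b \<longleftrightarrow> f \<preceq> g"
proof
  assume "a \<preceq> b"
  then obtain u where u: "u \<in> S" "mul a u = Some b" by (auto simp: le_def)
  obtain z where "z \<in> S" "mul f u = Some z" "mul t z = Some b" using assoc_left[OF assms(1,2) u(1) assms(4) u(2)] .
  then show "f \<preceq> g" using cancel[of t z g b] assms u leI by blast
next
  assume "f \<preceq> g"
  then obtain u where u: "u \<in> S" "mul f u = Some g" by (auto simp: le_def)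
  obtain z where "z \<in> S" "mul t f = Some z" "mul z u = Some b" using assoc_right[OF assms(1,2) u(1,2) assms(5)] .
  then show "a \<preceq> b" using u leI assms by simp
qed

lemma mul_defined_iff: assumes "s \<in> S" "t \<in> S" shows "(\<exists>u\<in>S. mul s t = Some u) \<longleftrightarrow> t \<preceq> cmp s"
proof
  assume "\<exists>u\<in>S. mul s t = Some u"
  then obtain u where u: "u \<in> S" "mul s t = Some u" by blast
  obtain z where z: "z \<in> S" "mul t (cmp u) = Some z" "mul s z = Some dl"
    using assoc_left[OF assms cmp_S[OF u(1)] u(2) mul_cmp[OF u(1)]] .
  then have "z = cmp s" using cancel[of s z "cmp s" dl] assms by simp
  then show "t \<preceq> cmp s" using z u leI cmp_S by blast
next
  assume "t \<preceq> cmp s"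
  then obtain u where u: "u \<in> S" "mul t u = Some (cmp s)" by (auto simp: le_def)
  show "\<exists>u\<in>S. mul s t = Some u" using assoc_right[OF assms u mul_cmp[OF assms(1)]] by blast
qed

lemma mul_cmp_mul: assumes "s \<in> S" "t \<in> S" "mul s t = Some u" shows "mul t (cmp u) = Some (cmp s)"
proof -
  have u: "u \<in> S" using assms mul_S by blast
  obtain z where z: "z \<in> S" "mul t (cmp u) = Some z" "mul s z = Some dl"
    using assoc_left[OF assms(1,2) cmp_S[OF u] assms(3) mul_cmp[OF u]] .
  then show ?thesis using cancel[of s z "cmp s" dl] assms by simp
qed

lemma cmp_e: "cmp e = dl" using mul_cmp[of e] e_mul[of "cmp e"] by simp

lemma cmp_dl: "cmp dl = e" using cancel[of dl "cmp dl" e dl] by simp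

lemma e_le: "s \<in> S \<Longrightarrow> e \<preceq> s" using leI[of s e s] by simp

lemma le_dl: "s \<in> S \<Longrightarrow> s \<preceq> dl" using leI[of "cmp s" s dl] by simp

lemma mt_le1: "\<lbrakk>s \<in> S; t \<in> S\<rbrakk> \<Longrightarrow> mt s t \<preceq> s"
  unfolding le_def by (rule mt_le(1))

lemma mt_le2: "\<lbrakk>s \<in> S; t \<in> S\<rbrakk> \<Longrightarrow> mt s t \<preceq> t"
  unfolding le_def by (rule mt_le(2))

lemma mt_ge: "\<lbrakk>r \<in> S; s \<in> S; t \<in> S; r \<preceq> s; r \<preceq> t\<rbrakk> \<Longrightarrow> r \<preceq> mt s t"
  unfolding le_def by (rule mt_greatest)

lemma mt_absorb: "\<lbrakk>s \<in> S; t \<in> S; t \<preceq> s\<rbrakk> \<Longrightarrow> mt s t = t"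
  by (intro le_antisym mt_ge le_refl mt_le2) auto

lemma le_e: "\<lbrakk>s \<in> S; s \<preceq> e\<rbrakk> \<Longrightarrow> s = e"
  using le_antisym e_le e_S by blast

lemma mt_e: "s \<in> S \<Longrightarrow> mt e s = e"
  using mt_le1[of e s] le_e by simp

section \<open>Left multiplication of lists of simple elements\<close>

definition ld where "ld f x = (THE u. u \<in> S \<and> mul f u = Some x)"

lemma ld_eq: "\<lbrakk>f \<in> S; u \<in> S; mul f u = Some x\<rbrakk> \<Longrightarrow> ld f x = u"
  unfolding ld_def using cancel by (intro the_equality) auto

lemma ld: assumes "f \<in> S" "f \<preceq> x" shows "ld f x \<in> S" "mul f (ld f x) = Some x"
  using assms ld_eq by (auto simp: le_def)

text \<open>One pass of the normal form algorithm: s absorbs as large a prefix f of x as possible,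
  and what is left of x is passed on to the tail.\<close>

fun act :: "'s \<Rightarrow> 's list \<Rightarrow> 's list" where
  "act s [] = (if s = e then [] else [s])"
| "act s (x # xs) = (let f = mt (cmp s) x in the (mul s f) # act (ld f x) xs)"

lemma act_step:
  assumes "s \<in> S" "x \<in> S"
  obtains f y r where "f = mt (cmp s) x" "f \<in> S" "y \<in> S" "r \<in> S" "mul s f = Some y" "mul f r = Some x"
    "act s (x # xs) = y # act r xs"
proof -
  let ?f = "mt (cmp s) x"
  have f: "?f \<in> S" "?f \<preceq> cmp s" "?f \<preceq> x" using assms mt_le1 mt_le2 by auto
  obtain y where y: "y \<in> S" "mul s ?f = Some y" using mul_defined_iff[OF assms(1) f(1)] f(2) by blast
  show ?thesis using that[of ?f y "ld ?f x"] f y ld[OF f(1,3)] by simp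
qed

lemma act_closed: "\<lbrakk>s \<in> S; set xs \<subseteq> S\<rbrakk> \<Longrightarrow> set (act s xs) \<subseteq> S"
proof (induction xs arbitrary: s)
  case (Cons x xs)
  obtain f y r where *: "y \<in> S" "r \<in> S" "act s (x # xs) = y # act r xs"
    using act_step[of s x] Cons.prems by (metis list.set_intros(1) subsetD)
  then show ?case using Cons by simp
qed simp

lemma act_e: "set xs \<subseteq> S \<Longrightarrow> act e xs = xs"
proof (induction xs)
  case (Cons x xs)
  then have "mt (cmp e) x = x" using cmp_e mt_absorb le_dl by simp
  moreover have "ld x x = e" using Cons by (intro ld_eq) auto
  ultimately show ?case using Cons by simp
qed simp

text \<open>Let t absorb g, let s then absorb h from t g, and let u = s t absorb f directly. Then h
  = t f: on the one hand t f is a prefix of t g that s can absorb; on the other hand h = t k, and k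
  is a prefix of x that u can absorb, so k is below f. Cancellation matches the remainders.\<close>

lemma act_mul:
  assumes "s \<in> S" "t \<in> S" "mul s t = Some u" "set xs \<subseteq> S"
  shows "act s (act t xs) = act u xs"
  using assms
proof (induction xs arbitrary: s t u)
  case Nil
  have u: "u \<in> S" using Nil mul_S by blast
  show ?case
  proof (cases "t = e")
    case True then show ?thesis using Nil by simp
  next
    case False
    have "t \<preceq> cmp s" using mul_defined_iff[of s t] Nil u by blast
    then have "mt (cmp s) t = t" using mt_absorb Nil by simp
    moreover have "ld t t = e" using Nil by (intro ld_eq) auto
    moreover have "u \<noteq> e" using unit unit2 Nil False by blast
    ultimately show ?thesis using Nil False by simp
  qed
next
  case (Cons x xs)
  have u: "u \<in> S" using Cons mul_S by blast
  have x: "x \<in> S" "set xs \<subseteq> S" using Cons by auto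
  obtain g y r where g: "g = mt (cmp t) x" "g \<in> S" "y \<in> S" "r \<in> S" "mul t g = Some y" "mul g r = Some x"
    "act t (x # xs) = y # act r xs" using act_step[OF Cons.prems(2) x(1)] .
  obtain h z q where h: "h = mt (cmp s) y" "h \<in> S" "z \<in> S" "q \<in> S" "mul s h = Some z" "mul h q = Some y"
    "act s (y # act r xs) = z # act q (act r xs)" using act_step[OF Cons.prems(1) g(3)] .
  obtain f w p where f: "f = mt (cmp u) x" "f \<in> S" "w \<in> S" "p \<in> S" "mul u f = Some w" "mul f p = Some x"
    "act u (x # xs) = w # act p xs" using act_step[OF u x(1)] .
  obtain tf where tf: "tf \<in> S" "mul t f = Some tf" "mul s tf = Some w"
    using assoc_left[OF Cons.prems(1,2) f(2) Cons.prems(3) f(5)] .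
  have "f \<preceq> cmp t" using mul_defined_iff[of t f] Cons.prems tf f by blast
  moreover have "f \<preceq> x" using f leI by blast
  ultimately have fg: "f \<preceq> g" unfolding g(1) using Cons.prems x f by (intro mt_ge) auto
  have "tf \<preceq> cmp s" using mul_defined_iff[of s tf] Cons.prems tf f by blast
  moreover have "tf \<preceq> y" using mul_le_mul[OF Cons.prems(2) f(2) g(2) tf(2) g(5)] fg by simp
  ultimately have tfh: "tf \<preceq> h" unfolding h(1) using tf g Cons.prems by (intro mt_ge) auto
  have "t \<preceq> cmp s" using mul_defined_iff[of s t] Cons.prems u by blast
  moreover have "t \<preceq> y" using g leI by blast
  ultimately have "t \<preceq> h" unfolding h(1) using g Cons.prems by (intro mt_ge) auto
  then obtain k where k: "k \<in> S" "mul t k = Some h" by (auto simp: le_def)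
  have hs: "h \<preceq> cmp s" "h \<preceq> y" using h(1) mt_le1 mt_le2 Cons.prems g by auto
  have "k \<preceq> g" using mul_le_mul[OF Cons.prems(2) k(1) g(2) k(2) g(5)] hs by simp
  then have kx: "k \<preceq> x" using le_trans[OF k(1) g(2) x(1)] g leI by blast
  have "k \<preceq> cmp u"
    using mul_le_mul[OF Cons.prems(2) k(1) cmp_S[OF u] k(2) mul_cmp_mul[OF Cons.prems(1-3)]] hs by simp
  then have "k \<preceq> f" unfolding f(1) using k u x kx by (intro mt_ge) auto
  then have "h \<preceq> tf" using mul_le_mul[OF Cons.prems(2) k(1) f(2) k(2) tf(2)] by simp
  then have eq: "h = tf" using tfh le_antisym h tf by blast
  have zw: "z = w" using eq tf h by simp
  obtain v where v: "v \<in> S" "mul f v = Some g" using fg by (auto simp: le_def)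
  obtain tf' where "tf' \<in> S" "mul t f = Some tf'" "mul tf' v = Some y"
    using assoc_right[OF Cons.prems(2) f(2) v(1,2) g(5)] .
  then have "mul h v = Some y" using eq tf by simp
  then have qv: "q = v" using cancel[of h q v y] h v by blast
  obtain p' where p': "p' \<in> S" "mul v r = Some p'" "mul f p' = Some x"
    using assoc_left[OF f(2) v(1) g(4) v(2) g(6)] .
  then have pp: "p' = p" using cancel[of f p' p x] f by blast
  have "act q (act r xs) = act p xs" using Cons.IH[of v r p] p' v g x qv pp by simp
  then show ?case using g h f zw by simp
qed

abbreviation lw where "lw x y \<equiv> mt (cmp x) y = e"

definition NL where "NL xs \<longleftrightarrow> set xs \<subseteq> S - {e} \<and> successively lw xs"

lemma NL_Cons: "NL (x # xs) \<Longrightarrow> x \<in> S \<and> x \<noteq> e \<and> NL xs \<and> (xs \<noteq> [] \<longrightarrow> lw x (hd xs))"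
  by (cases xs) (auto simp: NL_def)

lemma NL_S: "NL xs \<Longrightarrow> set xs \<subseteq> S" by (auto simp: NL_def)

text \<open>Describes the new head uniformly, with e in the role of a missing old head.\<close>

lemma act_hd:
  assumes "NL xs" "r \<in> S" "xs \<noteq> [] \<longrightarrow> z = hd xs" "xs = [] \<longrightarrow> z = e" "act r xs \<noteq> []"
  obtains z' where "z' \<in> S" "z' \<preceq> z" "mul r z' = Some (hd (act r xs))"
proof (cases xs)
  case Nil
  then have "hd (act r xs) = r" using assms by (auto split: if_splits)
  then show ?thesis using that[of e] assms Nil le_refl by simp
next
  case (Cons y ys)
  have y: "y \<in> S" using assms Cons NL_Cons by blast
  obtain f w q where "f = mt (cmp r) y" "f \<in> S" "w \<in> S" "q \<in> S" "mul r f = Some w" "mul f q = Some y"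
    "act r (y # ys) = w # act q ys" using act_step[OF assms(2) y] .
  then show ?thesis using that[of f] assms Cons leI by simp
qed

text \<open>Let g be the common prefix of the complement of the new head y and of the factor after
  it. The join of g and r is r z'' with z'' below both the old next factor and the complement of x,
  so z'' = e. Thus g is below r, f g is a prefix of x that s can still absorb, and maximality of f
  gives g = e.\<close>

lemma NL_act: "\<lbrakk>s \<in> S; NL xs\<rbrakk> \<Longrightarrow> NL (act s xs)"
proof (induction xs arbitrary: s)
  case Nil then show ?case by (auto simp: NL_def)
next
  case (Cons x xs)
  have x: "x \<in> S" "x \<noteq> e" "NL xs" "xs \<noteq> [] \<longrightarrow> lw x (hd xs)" using Cons.prems NL_Cons by auto
  obtain f y r where f: "f = mt (cmp s) x" "f \<in> S" "y \<in> S" "r \<in> S" "mul s f = Some y" "mul f r = Some x"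
    "act s (x # xs) = y # act r xs" using act_step[OF Cons.prems(1) x(1)] .
  have IH: "NL (act r xs)" using Cons.IH f x by blast
  have y: "y \<noteq> e"
  proof
    assume "y = e"
    then have "s = e" "f = e" using unit unit2 f Cons.prems by blast+
    then show False using f(1) mt_absorb[of dl x] le_dl x by (simp add: cmp_e)
  qed
  have "lw y (hd (act r xs))" if ne: "act r xs \<noteq> []"
  proof -
    define z where "z = (if xs = [] then e else hd xs)"
    have z: "z \<in> S" "lw x z"
      using x NL_S[OF x(3)] mt_absorb[of "cmp x" e] e_le by (auto simp: z_def)
    let ?h = "hd (act r xs)"
    obtain z' where z': "z' \<in> S" "z' \<preceq> z" "mul r z' = Some ?h"
      using act_hd[OF x(3) f(4), of z] ne by (auto simp: z_def)
    have h: "?h \<in> S" using z' f mul_S by blast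
    let ?g = "mt (cmp y) ?h"
    have g: "?g \<in> S" "?g \<preceq> cmp y" "?g \<preceq> ?h" using f h mt_le1 mt_le2 by auto
    obtain yg where yg: "yg \<in> S" "mul y ?g = Some yg" using mul_defined_iff[OF f(3) g(1)] g(2) by blast
    obtain fg where fg: "fg \<in> S" "mul f ?g = Some fg" "mul s fg = Some yg"
      using assoc_left[OF Cons.prems(1) f(2) g(1) f(5) yg(2)] .
    obtain j where j: "j \<in> S" "?g \<preceq> j" "r \<preceq> j" "\<And>w. w \<in> S \<Longrightarrow> ?g \<preceq> w \<Longrightarrow> r \<preceq> w \<Longrightarrow> j \<preceq> w"
      using join[OF g(1) f(4)] unfolding le_def by blast
    have "?g \<preceq> cmp f" "r \<preceq> cmp f" using mul_defined_iff[of f] f fg g x by blast+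
    then have "j \<preceq> cmp f" using j f by simp
    then obtain fj where fj: "fj \<in> S" "mul f j = Some fj" using mul_defined_iff[OF f(2) j(1)] by blast
    have jh: "j \<preceq> ?h" using j(4)[OF h g(3)] z' leI by blast
    obtain z'' where z'': "z'' \<in> S" "mul r z'' = Some j" using j(3) by (auto simp: le_def)
    have "z'' \<preceq> z'" using mul_le_mul[OF f(4) z''(1) z'(1) z''(2) z'(3)] jh by simp
    then have z''z: "z'' \<preceq> z" using le_trans z' z z'' by blast
    obtain xz where xz: "xz \<in> S" "mul f r = Some xz" "mul xz z'' = Some fj"
      using assoc_right[OF f(2,4) z''(1,2) fj(2)] .
    then have "z'' \<preceq> cmp x" using mul_defined_iff[OF x(1) z''(1)] f(6) fj by auto
    then have "z'' \<preceq> mt (cmp x) z" using z''z z'' z x by (intro mt_ge) auto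
    then have "z'' = e" using z le_e z'' by simp
    then have "j = r" using z'' f by simp
    then have "?g \<preceq> r" using j by simp
    then have "fg \<preceq> x" using mul_le_mul[OF f(2) g(1) f(4) fg(2) f(6)] by simp
    moreover have "fg \<preceq> cmp s" using mul_defined_iff[of s fg] Cons.prems fg yg by blast
    ultimately have "fg \<preceq> f" unfolding f(1) using fg x Cons.prems by (intro mt_ge) auto
    then have "?g \<preceq> e" using mul_le_mul[OF f(2) g(1) e_S fg(2) mul_e[OF f(2)]] by simp
    then show ?thesis using le_e g by blast
  qed
  then have "successively lw (y # act r xs)"
    using IH by (cases "act r xs") (auto simp: NL_def)
  then show ?case using IH y f by (auto simp: NL_def)
qed

lemma act_NL: "NL (x # xs) \<Longrightarrow> act x xs = x # xs"
proof (induction xs arbitrary: x)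
  case Nil then show ?case using NL_Cons by fastforce
next
  case (Cons y ys)
  have x: "x \<in> S" "lw x y" "NL (y # ys)" using NL_Cons[OF Cons.prems] by auto
  have y: "y \<in> S" using NL_Cons[OF x(3)] by auto
  have "ld e y = y" using y by (intro ld_eq) auto
  then show ?case using x y Cons.IH[OF x(3)] by simp
qed

section \<open>Powers of Delta and permutations of normal forms\<close>

definition tau where "tau s = cmp (cmp s)"

lemma tau_S [simp]: "s \<in> S \<Longrightarrow> tau s \<in> S" by (simp add: tau_def)

text \<open>From s cmp s = dl = cmp s tau s, the map tau is conjugation by dl and hence
  multiplicative. The proof only moves complements across products.\<close>

lemma tau_mul: assumes "s \<in> S" "t \<in> S" "mul s t = Some u" shows "mul (tau s) (tau t) = Some (tau u)"
proof -
  have u: "u \<in> S" using assms mul_S by blast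
  have t: "mul t (cmp u) = Some (cmp s)" using mul_cmp_mul[OF assms] .
  have us: "mul (cmp u) (tau s) = Some (cmp t)"
    using mul_cmp_mul[OF assms(2) cmp_S[OF u] t] by (simp add: tau_def)
  have "mul (cmp t) (tau t) = Some dl" using mul_cmp[of "cmp t"] assms by (simp add: tau_def)
  then obtain z where z: "z \<in> S" "mul (tau s) (tau t) = Some z" "mul (cmp u) z = Some dl"
    using assoc_left[OF cmp_S[OF u] _ _ us] assms by (metis tau_S)
  then have "z = tau u" using cancel[of "cmp u" z "tau u" dl] mul_cmp[of "cmp u"] u by (simp add: tau_def)
  then show ?thesis using z by simp
qed

lemma tau_pow_S [simp]: "s \<in> S \<Longrightarrow> (tau ^^ k) s \<in> S" by (induction k) auto

lemma tau_pow_mul: "\<lbrakk>s \<in> S; t \<in> S; mul s t = Some u\<rbrakk> \<Longrightarrow> mul ((tau ^^ k) s) ((tau ^^ k) t) = Some ((tau ^^ k) u)"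
  by (induction k) (auto intro: tau_mul)

lemma tau_ord: "s \<in> S \<Longrightarrow> (tau ^^ ord) s = s"
proof -
  have "tau = cmp ^^ 2" by (simp add: tau_def fun_eq_iff numeral_2_eq_2)
  then have "tau ^^ ord = cmp ^^ (2 * ord)" by (simp add: funpow_mult)
  then show "s \<in> S \<Longrightarrow> (tau ^^ ord) s = s" using cmp_ord by simp
qed

text \<open>Integer powers of tau; since tau has finite order, reduction modulo \<open>ord\<close>
  covers negative exponents.\<close>

definition taup :: "int \<Rightarrow> 's \<Rightarrow> 's" where "taup p = tau ^^ nat (p mod int ord)"

lemma taup_S [simp]: "s \<in> S \<Longrightarrow> taup p s \<in> S" by (simp add: taup_def)

lemma taup_0 [simp]: "taup 0 s = s" by (simp add: taup_def)

lemma taup_mul: "\<lbrakk>s \<in> S; t \<in> S; mul s t = Some u\<rbrakk> \<Longrightarrow> mul (taup p s) (taup p t) = Some (taup p u)"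
  unfolding taup_def by (rule tau_pow_mul)

lemma taup_Suc: assumes "s \<in> S" shows "taup (p + 1) s = tau (taup p s)"
proof -
  let ?m = "p mod int ord"
  have m: "0 \<le> ?m" "?m < int ord" using ord_pos by auto
  have "tau (taup p s) = (tau ^^ Suc (nat ?m)) s" by (simp add: taup_def)
  moreover have "(tau ^^ Suc (nat ?m)) s = taup (p + 1) s"
  proof (cases "?m + 1 = int ord")
    case True
    then have "(p + 1) mod int ord = 0" by (metis mod_add_left_eq mod_self)
    moreover have "Suc (nat ?m) = ord" using True m by linarith
    ultimately show ?thesis using tau_ord[OF assms] by (simp add: taup_def del: funpow.simps)
  next
    case False
    then have "(?m + 1) mod int ord = ?m + 1" using m by (intro mod_pos_pos_trivial) linarith+
    then have "(p + 1) mod int ord = ?m + 1" by (simp only: mod_add_left_eq)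
    moreover have "nat (?m + 1) = Suc (nat ?m)" using m by linarith
    ultimately show ?thesis by (simp add: taup_def)
  qed
  ultimately show ?thesis by simp
qed

lemma tau_dl: "tau dl = dl" by (simp add: tau_def cmp_dl cmp_e)

lemma taup_dl: "taup p dl = dl"
proof -
  have "(tau ^^ k) dl = dl" for k by (induction k) (auto simp: tau_dl)
  then show ?thesis by (simp add: taup_def)
qed

lemma act_dl: assumes "s \<in> S" shows "act s (dl # xs) = dl # act (tau s) xs"
proof -
  have "mt (cmp s) dl = cmp s"
    using assms by (intro le_antisym mt_ge le_refl mt_le1 le_dl) auto
  moreover have "ld (cmp s) dl = tau s" using assms mul_cmp[of "cmp s"] by (intro ld_eq) (auto simp: tau_def)
  ultimately show ?thesis using assms by simp
qed

fun norm :: "int \<Rightarrow> 's list \<Rightarrow> int \<times> 's list" where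
  "norm p [] = (p, [])"
| "norm p (x # xs) = (if x = dl then norm (p + 1) xs else (p, x # xs))"

text \<open>The pair \<open>(p, xs)\<close> stands for \<open>\<Delta>\<^sup>p x\<^sub>1 \<cdots> x\<^sub>r\<close>, and \<open>st s\<close> for left multiplication by \<open>s\<close>.\<close>

definition st where "st s = (\<lambda>(p, xs). norm p (act (taup p s) xs))"

definition NF :: "(int \<times> 's list) set" where "NF = {(p, xs). NL xs \<and> dl \<notin> set xs}"

text \<open>Passing s over a leading dl turns it into tau s, exactly the twist that comes from
  raising the exponent by 1.\<close>

lemma norm_act: "\<lbrakk>s \<in> S; set xs \<subseteq> S\<rbrakk> \<Longrightarrow> norm p (act (taup p s) xs) = st s (norm p xs)"
proof (induction xs arbitrary: p)
  case Nil then show ?case by (simp add: st_def)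
next
  case (Cons x xs)
  show ?case
  proof (cases "x = dl")
    case True
    have "norm p (act (taup p s) (x # xs)) = norm (p + 1) (act (taup (p + 1) s) xs)"
      using True Cons.prems act_dl[of "taup p s" xs] taup_Suc[of s p] by simp
    then show ?thesis using Cons True by simp
  next
    case False then show ?thesis by (simp add: st_def)
  qed
qed

lemma st_mul:
  assumes "s \<in> S" "t \<in> S" "mul s t = Some u" "set xs \<subseteq> S"
  shows "st s (st t (p, xs)) = st u (p, xs)"
proof -
  have "st s (st t (p, xs)) = st s (norm p (act (taup p t) xs))" by (simp add: st_def)
  also have "\<dots> = norm p (act (taup p s) (act (taup p t) xs))"
    using norm_act[of s "act (taup p t) xs" p] act_closed assms by simp
  also have "\<dots> = st u (p, xs)"
    using act_mul[OF _ _ taup_mul[OF assms(1-3)] assms(4)] assms by (simp add: st_def)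
  finally show ?thesis .
qed

lemma lw_dl: "x \<in> S \<Longrightarrow> lw x dl \<Longrightarrow> x = dl"
proof -
  assume x: "x \<in> S" "lw x dl"
  have "mt (cmp x) dl = cmp x" using x(1) by (intro le_antisym mt_ge le_refl mt_le1 le_dl) auto
  then have "mul x e = Some dl" using x mul_cmp[OF x(1)] by simp
  then show "x = dl" using x by simp
qed

lemma NL_dl: "NL (x # xs) \<Longrightarrow> x \<noteq> dl \<Longrightarrow> dl \<notin> set (x # xs)"
proof (induction xs arbitrary: x)
  case (Cons y ys)
  have x: "x \<in> S" "lw x y" "NL (y # ys)" using NL_Cons[OF Cons.prems(1)] by auto
  then have "y \<noteq> dl" using lw_dl[OF x(1)] Cons.prems(2) by blast
  then show ?case using Cons.IH[OF x(3)] Cons.prems by auto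
qed auto

lemma norm_NF: "NL xs \<Longrightarrow> norm p xs \<in> NF"
proof (induction xs arbitrary: p)
  case Nil then show ?case by (simp add: NF_def)
next
  case (Cons x xs) then show ?case using NL_Cons[OF Cons.prems] NL_dl[OF Cons.prems] by (auto simp: NF_def)
qed

lemma st_NF: "\<lbrakk>s \<in> S; v \<in> NF\<rbrakk> \<Longrightarrow> st s v \<in> NF"
proof -
  assume s: "s \<in> S" and "v \<in> NF"
  then obtain p xs where v: "v = (p, xs)" "NL xs" by (auto simp: NF_def)
  then show "st s v \<in> NF" using norm_NF[OF NL_act[OF taup_S[OF s] v(2)]] by (simp add: st_def)
qed

lemma NF_S: "(p, xs) \<in> NF \<Longrightarrow> set xs \<subseteq> S" by (auto simp: NF_def NL_def)

lemma st_e: "v \<in> NF \<Longrightarrow> st e v = v"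
proof (cases v)
  case (Pair p xs)
  assume v: "v \<in> NF"
  have "(tau ^^ k) e = e" for k
  proof (induction k)
    case (Suc k) then show ?case by (simp add: tau_def cmp_e cmp_dl)
  qed simp
  then have "taup p e = e" by (simp add: taup_def)
  moreover have "norm p xs = (p, xs)" using v Pair by (cases xs) (auto simp: NF_def)
  moreover have "act e xs = xs" using act_e NF_S v Pair by blast
  ultimately show ?thesis using Pair by (simp add: st_def)
qed

lemma st_dl: "(p, xs) \<in> NF \<Longrightarrow> st dl (p, xs) = (p + 1, xs)"
proof -
  assume v: "(p, xs) \<in> NF"
  have "act dl xs = dl # xs"
  proof (cases xs)
    case Nil then show ?thesis using e_neq_dl by auto
  next
    case (Cons x ys)
    then have N: "NL (x # ys)" "x \<in> S" using v NL_Cons by (auto simp: NF_def)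
    moreover have "ld e x = x" using N by (intro ld_eq) auto
    ultimately show ?thesis using Cons act_NL by (simp add: cmp_dl mt_e)
  qed
  moreover have "norm (p + 1) xs = (p + 1, xs)" using v by (cases xs) (auto simp: NF_def)
  ultimately show ?thesis by (simp add: st_def taup_dl)
qed

text \<open>Multiplying by a complement yields \<open>st dl\<close>, which merely raises the
  exponent by 1. The left complement gives injectivity, the right one surjectivity.\<close>

lemma bij_st: assumes "s \<in> S" shows "bij_betw (st s) NF NF"
proof (rule bij_betw_imageI)
  \<comment> \<open>One application short of the full order, so cmp t = s and t is the left
    complement of s.\<close>
  define t where "t = (cmp ^^ (2 * ord - 1)) s"
  have "(cmp ^^ k) s \<in> S" for k by (induction k) (use assms in auto)
  then have t: "t \<in> S" by (simp add: t_def)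
  have "cmp t = s" using ord_pos cmp_ord[OF assms]
    by (cases "2 * ord") (auto simp: t_def)
  then have mt: "mul t s = Some dl" using mul_cmp[OF t] by simp
  show "inj_on (st s) NF"
  proof (rule inj_onI)
    fix v w assume vw: "v \<in> NF" "w \<in> NF" "st s v = st s w"
    have "st t (st s u) = st dl u" if "u \<in> NF" for u
      using that by (cases u) (auto intro!: st_mul[OF t assms mt] dest: NF_S)
    then have "st dl v = st dl w" using vw by metis
    then show "v = w" using vw by (cases v, cases w) (auto simp: st_dl)
  qed
  show "st s ` NF = NF"
  proof
    show "st s ` NF \<subseteq> NF" using st_NF assms by blast
    show "NF \<subseteq> st s ` NF"
    proof
      fix v assume v: "v \<in> NF"
      obtain p xs where pxs: "v = (p, xs)" by (cases v)
      have w: "(p - 1, xs) \<in> NF" using v pxs by (auto simp: NF_def)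
      have "st s (st (cmp s) (p - 1, xs)) = v"
        using st_mul[OF assms cmp_S[OF assms] mul_cmp[OF assms] NF_S[OF w]] st_dl[OF w] pxs by simp
      then show "v \<in> st s ` NF" using st_NF[OF cmp_S[OF assms] w] by (metis imageI)
    qed
  qed
qed

lemma norm_eq: "norm p xs = (p', ys) \<Longrightarrow> p \<le> p' \<and> xs = replicate (nat (p' - p)) dl @ ys"
proof (induction xs arbitrary: p)
  case (Cons x xs)
  show ?case
  proof (cases "x = dl")
    case True
    then have IH: "p + 1 \<le> p'" "xs = replicate (nat (p' - (p + 1))) dl @ ys" using Cons by auto
    moreover have "nat (p' - p) = Suc (nat (p' - (p + 1)))" using IH by linarith
    ultimately show ?thesis using True by simp
  qed (use Cons in auto)
qed auto

lemma norm_inj: "norm p xs = norm p ys \<Longrightarrow> xs = ys"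
  using norm_eq[of p xs "fst (norm p ys)" "snd (norm p ys)"] norm_eq[of p ys "fst (norm p ys)" "snd (norm p ys)"]
  by simp

text \<open>Serves to check a defining relation inside the germ, where both sides have to be the
  same simple element.\<close>

fun gprod :: "('a \<Rightarrow> 's) \<Rightarrow> 'a list \<Rightarrow> 's option" where
  "gprod at [] = Some e"
| "gprod at (a # w) = Option.bind (gprod at w) (mul (at a))"

lemma gprod_S: "(\<And>a. a \<in> set w \<Longrightarrow> at a \<in> S) \<Longrightarrow> gprod at w = Some s \<Longrightarrow> s \<in> S"
proof (induction w arbitrary: s)
  case (Cons a w)
  then obtain t where "gprod at w = Some t" "mul (at a) t = Some s" by (cases "gprod at w") auto
  then show ?case using Cons mul_S by (metis list.set_intros)
qed auto

lemma foldr_st: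
  "(\<And>a. a \<in> set w \<Longrightarrow> at a \<in> S) \<Longrightarrow> gprod at w = Some s \<Longrightarrow> v \<in> NF \<Longrightarrow> foldr (\<lambda>a. st (at a)) w v = st s v"
proof (induction w arbitrary: s)
  case Nil
  then have "s = e" by simp
  then show ?case using st_e[OF Nil(3)] by simp
next
  case (Cons a w)
  then obtain t where t: "gprod at w = Some t" "mul (at a) t = Some s" by (cases "gprod at w") auto
  obtain p xs where v: "v = (p, xs)" by (cases v)
  have "t \<in> S" using gprod_S[OF _ t(1)] Cons.prems by auto
  then show ?case using Cons.IH[OF _ t(1)] Cons.prems st_mul[OF _ _ t(2)] NF_S v by auto
qed

end

section \<open>Presented groups whose simple elements form a germ\<close>

locale germ_presentation = germ S mul e dl cmp mt ord + word_group A R d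
  for S :: "'s set" and mul e dl cmp mt ord and A :: "'a set" and R d +
  fixes rep :: "'s \<Rightarrow> 'a list" and at :: "'a \<Rightarrow> 's"
  assumes homog: "(u, v) \<in> R \<Longrightarrow> length u = length v"
    and at_S [simp]: "a \<in> A \<Longrightarrow> at a \<in> S"
    and rep_A [simp]: "s \<in> S \<Longrightarrow> rep s \<in> lists A"
    and gprod_rep: "s \<in> S \<Longrightarrow> gprod at (rep s) = Some s"
    and gprod_rel: "\<lbrakk>(u, v) \<in> R; u \<in> lists A; v \<in> lists A\<rbrakk> \<Longrightarrow> gprod at u = gprod at v \<and> gprod at u \<noteq> None"
    and rep_at: "a \<in> A \<Longrightarrow> gen (rep (at a)) = gen [a]"
    and rep_mul: "\<lbrakk>s \<in> S; t \<in> S; mul s t = Some x\<rbrakk> \<Longrightarrow> gen (rep s) \<otimes>\<^bsub>G\<^esub> gen (rep t) = gen (rep x)"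
    and rep_dl: "gen (rep dl) = gen d"
begin

text \<open>Inverse letters act by the inverse permutation of NF, available by
  \<open>bij_st\<close>.\<close>

definition phi where "phi = (\<lambda>(a, b). if b then st (at a) else inv_into NF (st (at a)))"

definition gact where "gact g v = foldr phi (SOME w. w \<in> g) v"

lemma phi_NF: "a \<in> A \<times> UNIV \<Longrightarrow> v \<in> NF \<Longrightarrow> phi a v \<in> NF"
proof -
  assume a: "a \<in> A \<times> (UNIV :: bool set)" and v: "v \<in> NF"
  obtain x b where x: "a = (x, b)" "x \<in> A" using a by auto
  have bij: "bij_betw (st (at x)) NF NF" using bij_st x by simp
  show "phi a v \<in> NF"
    using bij_betwE[OF bij] bij_betwE[OF bij_betw_inv_into[OF bij]] v x by (simp add: phi_def)
qed

lemma foldr_phi_pos_word: "foldr phi (pos_word w) v = foldr (\<lambda>a. st (at a)) w v"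
  by (induction w) (auto simp: pos_word_def phi_def)

text \<open>The action respects a defining relation because both sides have the same product s in
  the germ and hence both act as \<open>st s\<close>.\<close>

lemma gact_cl: assumes w: "w \<in> W" and v: "v \<in> NF" shows "gact (cl w) v = foldr phi w v"
proof -
  have "w \<in> cl w" using w equiv_GC by (auto simp: cl_def equiv_def refl_on_def)
  then have "(SOME u. u \<in> cl w) \<in> cl w" by (rule someI)
  then have "(w, SOME u. u \<in> cl w) \<in> GC" by (simp add: cl_def)
  then have "foldr phi w v = foldr phi (SOME u. u \<in> cl w) v"
    unfolding group_cong_def
  proof (rule word_cong_invariant[where X = NF])
    fix u u' x assume rel: "(u, u') \<in> {(pos_word u, pos_word v) |u v. (u, v) \<in> R} \<union> {([(a, b), (a, \<not> b)], []) |a b. a \<in> A}"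
      and W: "u \<in> W" "u' \<in> W" and x: "x \<in> NF"
    show "foldr phi u x = foldr phi u' x"
      using rel
    proof
      assume "(u, u') \<in> {(pos_word u, pos_word v) |u v. (u, v) \<in> R}"
      then obtain r r' where r: "u = pos_word r" "u' = pos_word r'" "(r, r') \<in> R" by blast
      have A: "r \<in> lists A" "r' \<in> lists A" using W r by (auto simp: pos_word_def in_lists_conv_set)
      have g: "gprod at r = gprod at r' \<and> gprod at r \<noteq> None" by (rule gprod_rel[OF r(3) A])
      then obtain s where s: "gprod at r = Some s" by blast
      then have s: "gprod at r = Some s" "gprod at r' = Some s" using g by simp_all
      have "foldr (\<lambda>a. st (at a)) r x = st s x" "foldr (\<lambda>a. st (at a)) r' x = st s x"
        using foldr_st[OF _ s(1) x] foldr_st[OF _ s(2) x] A by auto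
      then show ?thesis using r by (simp add: foldr_phi_pos_word)
    next
      assume "(u, u') \<in> {([(a, b), (a, \<not> b)], []) |a b. a \<in> A}"
      then obtain a b where ab: "u = [(a, b), (a, \<not> b)]" "u' = []" "a \<in> A" by blast
      have bij: "bij_betw (st (at a)) NF NF" using bij_st ab by simp
      then show ?thesis using ab x
        by (cases b) (simp_all add: phi_def bij_betw_inv_into_left bij_betw_inv_into_right)
    qed
  qed (use v phi_NF in auto)
  then show ?thesis by (simp add: gact_def)
qed

lemma gact_mult: assumes "g \<in> carrier G" "h \<in> carrier G" "v \<in> NF"
  shows "gact (g \<cdot> h) v = gact g (gact h v)"
proof -
  obtain u w where uw: "u \<in> W" "g = cl u" "w \<in> W" "h = cl w" using assms carrierE by metis
  have "foldr phi w v \<in> NF" using uw(3) by (induction w) (use assms phi_NF in auto)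
  then show ?thesis using uw assms by (simp add: cl_mult gact_cl)
qed

definition elt where "elt s = gen (rep s)"

lemma elt_carrier [simp]: "s \<in> S \<Longrightarrow> elt s \<in> carrier G" by (simp add: elt_def)

lemma elt_mul: "\<lbrakk>s \<in> S; t \<in> S; mul s t = Some u\<rbrakk> \<Longrightarrow> elt s \<cdot> elt t = elt u"
  unfolding elt_def by (rule rep_mul)

lemma elt_pos [simp]: "s \<in> S \<Longrightarrow> elt s \<in> positive G" by (simp add: elt_def positive_G)

interpretation Gr: group G by (rule group_G)

lemma elt_e: "elt e = \<one>\<^bsub>G\<^esub>"
proof -
  have "elt e \<cdot> elt e = elt e" using elt_mul[of e e e] by simp
  then show ?thesis using Gr.l_cancel_one[of "elt e" "elt e"] by simp
qed

lemma elt_dl: "elt dl = \<Delta>\<^bsub>G\<^esub>" by (simp add: elt_def Delta_G rep_dl)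

lemma gact_elt: assumes "s \<in> S" "v \<in> NF" shows "gact (elt s) v = st s v"
proof -
  have "rep s \<in> lists A" using assms by simp
  then have "\<And>a. a \<in> set (rep s) \<Longrightarrow> at a \<in> S" by auto
  then have "foldr (\<lambda>a. st (at a)) (rep s) v = st s v" by (rule foldr_st[OF _ gprod_rep[OF assms(1)] assms(2)])
  then show ?thesis
    unfolding elt_def gen_def using assms gact_cl[of "pos_word (rep s)" v] by (simp add: foldr_phi_pos_word)
qed

definition prodE where "prodE xs = foldr (\<lambda>s g. elt s \<cdot> g) xs \<one>\<^bsub>G\<^esub>"

lemma prodE_simps [simp]: "prodE [] = \<one>\<^bsub>G\<^esub>" "prodE (x # xs) = elt x \<cdot> prodE xs"
  by (simp_all add: prodE_def)

lemma pos_mult: "g \<in> positive G \<Longrightarrow> h \<in> positive G \<Longrightarrow> g \<cdot> h \<in> positive G"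
proof -
  assume "g \<in> positive G" "h \<in> positive G"
  then obtain u v where uv: "u \<in> lists A" "g = gen u" "v \<in> lists A" "h = gen v" unfolding positive_G by blast
  then have "g \<cdot> h = gen (u @ v)" by (simp add: gen_append)
  then show "g \<cdot> h \<in> positive G" unfolding positive_G using uv by simp
qed

lemma one_pos: "\<one>\<^bsub>G\<^esub> \<in> positive G"
  unfolding positive_G gen_Nil[symmetric] by simp

lemma pos_carrier: "g \<in> positive G \<Longrightarrow> g \<in> carrier G"
  unfolding positive_G using gen_carrier by blast

lemma prodE_pos: "set xs \<subseteq> S \<Longrightarrow> prodE xs \<in> positive G"
  by (induction xs) (auto simp: one_pos intro: pos_mult)

lemma prodE_carrier [simp]: "set xs \<subseteq> S \<Longrightarrow> prodE xs \<in> carrier G"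
  using prodE_pos pos_carrier by blast

lemma prodE_act: "s \<in> S \<Longrightarrow> set xs \<subseteq> S \<Longrightarrow> prodE (act s xs) = elt s \<cdot> prodE xs"
proof (induction xs arbitrary: s)
  case Nil then show ?case by (auto simp: elt_e)
next
  case (Cons x xs)
  have x: "x \<in> S" "set xs \<subseteq> S" using Cons by auto
  obtain f y r where f: "f \<in> S" "y \<in> S" "r \<in> S" "mul s f = Some y" "mul f r = Some x" "act s (x # xs) = y # act r xs"
    using act_step[OF Cons.prems(1) x(1)] by metis
  have "elt y \<cdot> elt r = elt s \<cdot> elt x"
    unfolding elt_mul[OF Cons.prems(1) f(1,4), symmetric] elt_mul[OF f(1,3,5), symmetric]
    using f Cons.prems by (simp add: Gr.m_assoc)
  then have "elt y \<cdot> (elt r \<cdot> prodE xs) = elt s \<cdot> (elt x \<cdot> prodE xs)"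
    using f x Cons.prems by (simp add: Gr.m_assoc[symmetric])
  then show ?case unfolding f(6) using Cons.IH[OF f(3) x(2)] by simp
qed

lemma pos_NL: assumes "g \<in> positive G" obtains xs where "NL xs" "g = prodE xs"
proof -
  obtain w where w: "w \<in> lists A" "g = gen w" using assms unfolding positive_G by blast
  have "\<exists>xs. NL xs \<and> gen w = prodE xs" using w(1)
  proof (induction w rule: list.induct)
    case Nil then show ?case by (intro exI[of _ "[]"]) (auto simp: gen_Nil NL_def)
  next
    case (Cons a w)
    then obtain xs where xs: "NL xs" "gen w = prodE xs" by auto
    have a: "a \<in> A" "w \<in> lists A" using Cons by auto
    have "gen (a # w) = elt (at a) \<cdot> gen w"
      using gen_append[of "[a]" w] a rep_at by (simp add: elt_def)
    then have "gen (a # w) = prodE (act (at a) xs)" using prodE_act a xs NL_S by simp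
    then show ?case using NL_act xs a at_S by blast
  qed
  then show ?thesis using w that by blast
qed

lemma nil_NF: "(0, []) \<in> NF" by (simp add: NF_def NL_def)

text \<open>Acting on the empty normal form recovers the normal form of an element. Hence distinct
  normal lists represent distinct elements of the group.\<close>

lemma gact_prodE: "NL xs \<Longrightarrow> gact (prodE xs) (0, []) = norm 0 xs"
proof (induction xs)
  case Nil
  have "gact (elt e) (0, []) = (0, [])" using gact_elt[of e "(0, [])"] st_e nil_NF by simp
  then show ?case by (simp add: elt_e)
next
  case (Cons x xs)
  have x: "x \<in> S" "NL xs" "set xs \<subseteq> S" using NL_Cons[OF Cons.prems] NL_S by auto
  have "gact (prodE (x # xs)) (0, []) = st x (norm 0 xs)"
    using Cons x gact_mult nil_NF gact_elt[OF x(1) norm_NF[OF x(2)]] by simp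
  also have "\<dots> = norm 0 (act (taup 0 x) xs)" using norm_act[OF x(1,3), of 0] by simp
  also have "\<dots> = norm 0 (x # xs)" using act_NL[OF Cons.prems] by simp
  finally show ?case .
qed

lemma prodE_inj: "NL xs \<Longrightarrow> NL ys \<Longrightarrow> prodE xs = prodE ys \<Longrightarrow> xs = ys"
  using gact_prodE norm_inj by metis

lemma NL_single: "s \<in> S \<Longrightarrow> s \<noteq> e \<Longrightarrow> NL [s]" by (simp add: NL_def)

lemma elt_inj: assumes "s \<in> S" "t \<in> S" "elt s = elt t" shows "s = t"
proof -
  let ?f = "\<lambda>s. if s = e then [] else [s]"
  have "NL (?f u)" if "u \<in> S" for u using that NL_single by (simp add: NL_def)
  moreover have "prodE (?f u) = elt u" if "u \<in> S" for u using that by (simp add: elt_e)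
  ultimately have "?f s = ?f t" using assms by (intro prodE_inj) simp_all
  then show ?thesis by (simp split: if_splits)
qed

lemma elt_tau: assumes "s \<in> S" shows "elt s \<cdot> elt dl = elt dl \<cdot> elt (tau s)"
proof -
  have "mul (cmp s) (tau s) = Some dl" unfolding tau_def by (rule mul_cmp[OF cmp_S[OF assms]])
  from elt_mul[OF cmp_S[OF assms] tau_S[OF assms] this]
  have e2: "elt (cmp s) \<cdot> elt (tau s) = elt dl" .
  have e1: "elt s \<cdot> elt (cmp s) = elt dl" by (rule elt_mul[OF assms cmp_S[OF assms] mul_cmp[OF assms]])
  have "elt s \<cdot> (elt (cmp s) \<cdot> elt (tau s)) = (elt s \<cdot> elt (cmp s)) \<cdot> elt (tau s)"
    using assms by (simp add: Gr.m_assoc)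
  then show ?thesis unfolding e1 e2 .
qed

lemma elt_dl_pow: assumes "s \<in> S" shows "elt s \<cdot> elt dl [^]\<^bsub>G\<^esub> k = elt dl [^]\<^bsub>G\<^esub> k \<cdot> elt ((tau ^^ k) s)"
proof (induction k)
  case 0 then show ?case using assms by simp
next
  case (Suc k)
  have "elt s \<cdot> elt dl [^]\<^bsub>G\<^esub> Suc k = elt dl [^]\<^bsub>G\<^esub> k \<cdot> (elt ((tau ^^ k) s) \<cdot> elt dl)"
    using Suc assms by (simp add: Gr.m_assoc[symmetric])
  then show ?case using elt_tau[of "(tau ^^ k) s"] assms by (simp add: Gr.m_assoc)
qed

lemma gen_letter: "a \<in> A \<Longrightarrow> gen [a] = elt (at a)" by (simp add: elt_def rep_at)

lemma dl_pow_central: assumes "g \<in> carrier G" shows "elt dl [^]\<^bsub>G\<^esub> ord \<cdot> g = g \<cdot> elt dl [^]\<^bsub>G\<^esub> ord"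
  using assms
proof (induction rule: carrier_induct)
  case one then show ?case by simp
next
  case (pos a h)
  let ?z = "elt dl [^]\<^bsub>G\<^esub> ord" and ?s = "elt (at a)"
  have c: "?s \<cdot> ?z = ?z \<cdot> ?s" using elt_dl_pow[of "at a" ord] tau_ord pos by simp
  have G: "?s \<in> carrier G" "?z \<in> carrier G" "h \<in> carrier G" using pos by auto
  have "?z \<cdot> (?s \<cdot> h) = ?s \<cdot> (?z \<cdot> h)" using G c by (metis Gr.m_assoc)
  then show ?case using G pos by (simp add: gen_letter Gr.m_assoc)
next
  case (inverse a h)
  let ?z = "elt dl [^]\<^bsub>G\<^esub> ord" and ?s = "elt (at a)"
  have c: "?s \<cdot> ?z = ?z \<cdot> ?s" using elt_dl_pow[of "at a" ord] tau_ord inverse by simp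
  have G: "?s \<in> carrier G" "?z \<in> carrier G" "h \<in> carrier G" using inverse by auto
  have "?z \<cdot> inv\<^sub>G ?s = inv\<^sub>G ?s \<cdot> (?s \<cdot> ?z) \<cdot> inv\<^sub>G ?s"
    using G by (simp add: Gr.m_assoc[symmetric])
  also have "\<dots> = inv\<^sub>G ?s \<cdot> ?z" unfolding c using G by (simp add: Gr.m_assoc)
  finally have c': "?z \<cdot> inv\<^sub>G ?s = inv\<^sub>G ?s \<cdot> ?z" .
  have "?z \<cdot> (inv\<^sub>G ?s \<cdot> h) = inv\<^sub>G ?s \<cdot> (?z \<cdot> h)" using G c' by (metis Gr.inv_closed Gr.m_assoc)
  then show ?case using G inverse by (simp add: gen_letter Gr.m_assoc)
qed

lemma left_cmp: assumes "s \<in> S" obtains t where "t \<in> S" "elt t \<cdot> elt s = elt dl"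
proof -
  define t where "t = (cmp ^^ (2 * ord - 1)) s"
  have "(cmp ^^ k) s \<in> S" for k by (induction k) (use assms in auto)
  then have t: "t \<in> S" by (simp add: t_def)
  have "cmp t = s" using ord_pos cmp_ord[OF assms] by (cases "2 * ord") (auto simp: t_def)
  then show ?thesis using that[OF t] elt_mul[OF t assms, of dl] mul_cmp[OF t] by simp
qed

text \<open>An inverse letter costs one Delta, since Delta a^(-1) is the simple element t with t a =
  Delta. The exponent is enlarged to a multiple of \<open>ord\<close> so that the power of Delta
  moves freely past simple elements.\<close>

lemma dominated: assumes "g \<in> carrier G" shows "\<exists>k::nat. elt dl [^]\<^bsub>G\<^esub> k \<cdot> g \<in> positive G"
  using assms
proof (induction rule: carrier_induct)
  case one then show ?case using one_pos by (intro exI[of _ 0]) simp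
next
  case (pos a h)
  let ?d = "elt dl" and ?s = "elt (at a)"
  obtain k where k: "?d [^]\<^bsub>G\<^esub> (k::nat) \<cdot> h \<in> positive G" using pos by blast
  have G: "?s \<in> carrier G" "h \<in> carrier G" using pos by auto
  have "(tau ^^ (k * (ord - 1))) (at a) \<in> S" using pos by simp
  have pw: "((tau ^^ ord) ^^ j) (at a) = at a" for j by (induction j) (use pos tau_ord in auto)
  have tk: "(tau ^^ (ord * k)) (at a) = at a" using pw[of k] by (simp add: funpow_mult)
  have dk: "?d [^]\<^bsub>G\<^esub> (j::nat) \<in> positive G" for j by (induction j) (auto simp: one_pos intro: pos_mult)
  have a: "?d [^]\<^bsub>G\<^esub> (ord * k) \<cdot> (?s \<cdot> h) = ?s \<cdot> (?d [^]\<^bsub>G\<^esub> (ord * k) \<cdot> h)"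
    using elt_dl_pow[of "at a" "ord * k"] tk G pos by (metis Gr.m_assoc Gr.nat_pow_closed at_S dl_S elt_carrier)
  have "?d [^]\<^bsub>G\<^esub> (ord * k) = ?d [^]\<^bsub>G\<^esub> (ord * k - k) \<cdot> ?d [^]\<^bsub>G\<^esub> k"
    using ord_pos Gr.nat_pow_mult[of ?d "ord * k - k" k] by simp
  then have b: "?d [^]\<^bsub>G\<^esub> (ord * k) \<cdot> h = ?d [^]\<^bsub>G\<^esub> (ord * k - k) \<cdot> (?d [^]\<^bsub>G\<^esub> k \<cdot> h)"
    using G by (simp add: Gr.m_assoc)
  have "?d [^]\<^bsub>G\<^esub> (ord * k) \<cdot> (?s \<cdot> h) \<in> positive G"
    unfolding a b by (rule pos_mult[OF elt_pos[OF at_S[OF pos(1)]] pos_mult[OF dk k]])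
  then show ?case unfolding gen_letter[OF pos(1)] by blast
next
  case (inverse a h)
  let ?d = "elt dl" and ?s = "elt (at a)"
  obtain k where k: "?d [^]\<^bsub>G\<^esub> (k::nat) \<cdot> h \<in> positive G" using inverse by blast
  have G: "?s \<in> carrier G" "h \<in> carrier G" using inverse by auto
  obtain t where t: "t \<in> S" "elt t \<cdot> ?s = ?d" using left_cmp[of "at a"] inverse by auto
  then have "?d \<cdot> inv\<^sub>G ?s = elt t" using G by (metis Gr.inv_solve_right elt_carrier dl_S)
  moreover define n where "n = ord * k"
  have pw: "((tau ^^ ord) ^^ j) t = t" for j by (induction j) (use t tau_ord in auto)
  have tk: "(tau ^^ n) t = t" using pw[of k] by (simp add: funpow_mult n_def)
  have dk: "?d [^]\<^bsub>G\<^esub> (j::nat) \<in> positive G" for j by (induction j) (auto simp: one_pos intro: pos_mult)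
  ultimately have "?d [^]\<^bsub>G\<^esub> Suc n \<cdot> (inv\<^sub>G ?s \<cdot> h) = ?d [^]\<^bsub>G\<^esub> n \<cdot> (elt t \<cdot> h)"
    using G by (simp add: Gr.m_assoc) (metis Gr.m_assoc Gr.inv_closed dl_S elt_carrier)
  also have "\<dots> = elt t \<cdot> (?d [^]\<^bsub>G\<^esub> n \<cdot> h)"
    using elt_dl_pow[OF t(1), of n] tk G t by (metis Gr.m_assoc Gr.nat_pow_closed dl_S elt_carrier)
  also have "?d [^]\<^bsub>G\<^esub> n = ?d [^]\<^bsub>G\<^esub> (n - k) \<cdot> ?d [^]\<^bsub>G\<^esub> k"
    using ord_pos Gr.nat_pow_mult[of ?d "n - k" k] by (simp add: n_def)
  also have "\<dots> \<cdot> h = ?d [^]\<^bsub>G\<^esub> (n - k) \<cdot> (?d [^]\<^bsub>G\<^esub> k \<cdot> h)" using G by (simp add: Gr.m_assoc)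
  also have "elt t \<cdot> \<dots> \<in> positive G" by (rule pos_mult[OF elt_pos[OF t(1)] pos_mult[OF dk k]])
  finally show ?case unfolding gen_letter[OF inverse(1)] by blast
qed

lemma dl_conj_pos: assumes "g \<in> positive G" shows "inv\<^sub>G elt dl \<cdot> g \<cdot> elt dl \<in> positive G"
proof -
  obtain xs where xs: "NL xs" "g = prodE xs" using assms by (rule pos_NL)
  have "set xs \<subseteq> S \<Longrightarrow> prodE xs \<cdot> elt dl = elt dl \<cdot> prodE (map tau xs)"
  proof (induction xs)
    case (Cons x xs)
    then have x: "x \<in> S" "set xs \<subseteq> S" "set (map tau xs) \<subseteq> S" by auto
    have "prodE (x # xs) \<cdot> elt dl = elt x \<cdot> elt dl \<cdot> prodE (map tau xs)"
      using Cons x by (simp add: Gr.m_assoc)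
    then show ?case using x by (simp add: elt_tau Gr.m_assoc del: set_map)
  qed simp
  then have eq: "g \<cdot> elt dl = elt dl \<cdot> prodE (map tau xs)" using xs NL_S by blast
  have tS: "set (map tau xs) \<subseteq> S" using NL_S[OF xs(1)] by auto
  have "inv\<^sub>G elt dl \<cdot> g \<cdot> elt dl = inv\<^sub>G elt dl \<cdot> (elt dl \<cdot> prodE (map tau xs))"
    unfolding eq[symmetric] using pos_carrier[OF assms] by (simp add: Gr.m_assoc)
  also have "\<dots> = prodE (map tau xs)" using prodE_carrier[OF tS] by (simp add: Gr.m_assoc[symmetric])
  finally show ?thesis using prodE_pos[OF tS] by simp
qed

text \<open>The first factor of the normal form is the greatest simple prefix: if g = s r, then
  acting with s on the normal list of r gives, by uniqueness, the normal list of g, and its first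
  factor begins with s.\<close>

lemma head: assumes "g \<in> positive G"
  obtains h r where "h \<in> S" "r \<in> positive G" "g = elt h \<cdot> r"
    "\<And>s r. \<lbrakk>s \<in> S; r \<in> positive G; g = elt s \<cdot> r\<rbrakk> \<Longrightarrow> s \<preceq> h"
proof -
  obtain xs where xs: "NL xs" "g = prodE xs" using assms by (rule pos_NL)
  define h where "h = (if xs = [] then e else hd xs)"
  have h: "h \<in> S" using NL_S[OF xs(1)] by (cases xs) (auto simp: h_def)
  have "g = elt h \<cdot> prodE (tl xs)" using xs NL_S[OF xs(1)] by (cases xs) (auto simp: h_def elt_e)
  moreover have "prodE (tl xs) \<in> positive G" using NL_S[OF xs(1)] by (cases xs) (auto intro!: prodE_pos simp: one_pos)
  moreover have "s \<preceq> h" if s: "s \<in> S" "r \<in> positive G" "g = elt s \<cdot> r" for s r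
  proof -
    obtain ys where ys: "NL ys" "r = prodE ys" using s(2) by (rule pos_NL)
    have "prodE (act s ys) = prodE xs" using prodE_act s ys NL_S xs by simp
    then have eq: "act s ys = xs" using prodE_inj NL_act s ys xs by blast
    show ?thesis
    proof (cases ys)
      case Nil
      then show ?thesis using eq s le_refl by (auto simp: h_def split: if_splits)
    next
      case (Cons y zs)
      then have y: "y \<in> S" using ys NL_Cons by blast
      obtain f w q where f: "f \<in> S" "mul s f = Some w" "act s (y # zs) = w # act q zs"
        using act_step[OF s(1) y] by metis
      then have "xs = w # act q zs" using eq unfolding Cons by (simp only:)
      then show ?thesis using f leI by (simp add: h_def)
    qed
  qed
  ultimately show ?thesis using that h by blast
qed

text \<open>The prefix order of the group restricts to that of the germ. The greatest simple prefix
  h of \<open>elt t\<close> lies above s, and it lies below t because the normal list of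
  \<open>elt t\<close> has at most one factor.\<close>

lemma elt_le_iff: assumes "s \<in> S" "t \<in> S" shows "inv\<^sub>G elt s \<cdot> elt t \<in> positive G \<longleftrightarrow> s \<preceq> t"
proof
  assume p: "inv\<^sub>G elt s \<cdot> elt t \<in> positive G"
  obtain h r where h: "h \<in> S" "r \<in> positive G" "elt t = elt h \<cdot> r"
    "\<And>s r. \<lbrakk>s \<in> S; r \<in> positive G; elt t = elt s \<cdot> r\<rbrakk> \<Longrightarrow> s \<preceq> h" using head[OF elt_pos[OF assms(2)]] by metis
  obtain ys where ys: "NL ys" "r = prodE ys" using h(2) by (rule pos_NL)
  have "elt t = elt s \<cdot> (inv\<^sub>G elt s \<cdot> elt t)" using assms by (simp add: Gr.m_assoc[symmetric])
  then have sh: "s \<preceq> h" using h(4) p assms by blast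
  have "act h ys = (if t = e then [] else [t])"
  proof (rule prodE_inj)
    show "NL (act h ys)" using NL_act[OF h(1) ys(1)] .
    show "NL (if t = e then [] else [t])" using NL_single assms(2) by (auto simp: NL_def)
    have "prodE (act h ys) = elt t" using prodE_act[OF h(1) NL_S[OF ys(1)]] h(3) ys(2) by simp
    then show "prodE (act h ys) = prodE (if t = e then [] else [t])" using assms(2) by (simp add: elt_e)
  qed
  then have "h \<preceq> t"
  proof (cases ys)
    case Nil
    then show ?thesis using \<open>act h ys = _\<close> assms le_refl by (auto split: if_splits)
  next
    case (Cons y zs)
    then have y: "y \<in> S" using ys NL_Cons by blast
    obtain f w q where "f \<in> S" "w \<in> S" "mul h f = Some w" "act h (y # zs) = w # act q zs"
      using act_step[OF h(1) y] by metis
    then show ?thesis using \<open>act h ys = _\<close> Cons leI by (auto split: if_splits)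
  qed
  then show "s \<preceq> t" using le_trans sh assms h by blast
next
  assume "s \<preceq> t"
  then obtain u where "u \<in> S" "mul s u = Some t" by (auto simp: le_def)
  then have "elt t = elt s \<cdot> elt u" using elt_mul assms by simp
  then show "inv\<^sub>G elt s \<cdot> elt t \<in> positive G" using assms \<open>u \<in> S\<close> by (simp add: Gr.m_assoc[symmetric])
qed

text \<open>Take c with y c equal to the join j of d' and y in the germ. If d' is a prefix of y w,
  then d' and y are below the greatest simple prefix of y w, hence so is j.\<close>

lemma simple_lcm: assumes d: "d' \<in> S" and y: "y \<in> S"
  obtains c where "c \<in> S" "\<And>w. w \<in> positive G \<Longrightarrow>
    inv\<^sub>G elt d' \<cdot> (elt y \<cdot> w) \<in> positive G \<longleftrightarrow> inv\<^sub>G elt c \<cdot> w \<in> positive G"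
proof -
  obtain j where j: "j \<in> S" "d' \<preceq> j" "y \<preceq> j" "\<And>w. w \<in> S \<Longrightarrow> d' \<preceq> w \<Longrightarrow> y \<preceq> w \<Longrightarrow> j \<preceq> w"
    using join[OF d y] unfolding le_def by blast
  obtain c where c: "c \<in> S" "mul y c = Some j" using j by (auto simp: le_def)
  obtain z where z: "z \<in> S" "mul d' z = Some j" using j by (auto simp: le_def)
  have yc: "elt y \<cdot> elt c = elt j" and dz: "elt d' \<cdot> elt z = elt j" using elt_mul c z d y by auto
  have canc: "a \<cdot> (inv\<^sub>G a \<cdot> b) = b" "inv\<^sub>G a \<cdot> (a \<cdot> b) = b"
    if "a \<in> carrier G" "b \<in> carrier G" for a b
    using that by (simp_all add: Gr.m_assoc[symmetric])
  have "inv\<^sub>G elt d' \<cdot> (elt y \<cdot> w) \<in> positive G \<longleftrightarrow> inv\<^sub>G elt c \<cdot> w \<in> positive G"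
    if w: "w \<in> positive G" for w
  proof
    have wG: "w \<in> carrier G" using w pos_carrier by blast
    {
      assume a: "inv\<^sub>G elt d' \<cdot> (elt y \<cdot> w) \<in> positive G"
      have yw: "elt y \<cdot> w \<in> positive G" using y w pos_mult by simp
      obtain h r where h: "h \<in> S" "r \<in> positive G" "elt y \<cdot> w = elt h \<cdot> r"
        "\<And>s r. \<lbrakk>s \<in> S; r \<in> positive G; elt y \<cdot> w = elt s \<cdot> r\<rbrakk> \<Longrightarrow> s \<preceq> h" using head[OF yw] by metis
      have "y \<preceq> h" using h(4)[OF y w] by simp
      moreover have "d' \<preceq> h" using h(4)[OF d a] canc d y wG by simp
      ultimately have "j \<preceq> h" using j h by blast
      then obtain k where k: "k \<in> S" "mul j k = Some h" by (auto simp: le_def)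
      have rG: "r \<in> carrier G" using h pos_carrier by blast
      have "elt y \<cdot> w = elt y \<cdot> (elt c \<cdot> (elt k \<cdot> r))"
        using h(3) elt_mul[OF j(1) k] yc y c k rG j by (simp add: Gr.m_assoc[symmetric])
      then have "w = elt c \<cdot> (elt k \<cdot> r)" using y c k rG wG by simp
      then show "inv\<^sub>G elt c \<cdot> w \<in> positive G" using c k rG h canc pos_mult by simp
    }
    assume b: "inv\<^sub>G elt c \<cdot> w \<in> positive G"
    let ?r = "inv\<^sub>G elt c \<cdot> w"
    have rG: "?r \<in> carrier G" using c wG by simp
    have "elt y \<cdot> w = elt y \<cdot> (elt c \<cdot> ?r)" using canc c wG by simp
    also have "\<dots> = elt d' \<cdot> (elt z \<cdot> ?r)"
      using yc dz y c z d rG by (metis Gr.m_assoc elt_carrier)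
    finally show "inv\<^sub>G elt d' \<cdot> (elt y \<cdot> w) \<in> positive G"
      using canc d z rG b pos_mult by simp
  qed
  then show ?thesis using that c by blast
qed

lemma simple_list_lcm:
  assumes "set ys \<subseteq> S" "d' \<in> S"
  shows "\<exists>c\<in>S. \<forall>w\<in>positive G. inv\<^sub>G elt d' \<cdot> (prodE ys \<cdot> w) \<in> positive G \<longleftrightarrow> inv\<^sub>G elt c \<cdot> w \<in> positive G"
  using assms
proof (induction ys arbitrary: d')
  case Nil then show ?case using pos_carrier by (intro bexI[of _ d']) auto
next
  case (Cons y ys)
  then have y: "y \<in> S" "set ys \<subseteq> S" by auto
  obtain c1 where c1: "c1 \<in> S" "\<And>w. w \<in> positive G \<Longrightarrow>
    inv\<^sub>G elt d' \<cdot> (elt y \<cdot> w) \<in> positive G \<longleftrightarrow> inv\<^sub>G elt c1 \<cdot> w \<in> positive G"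
    using simple_lcm[OF Cons.prems(2) y(1)] by metis
  obtain c where c: "c \<in> S" "\<And>w. w \<in> positive G \<Longrightarrow>
    inv\<^sub>G elt c1 \<cdot> (prodE ys \<cdot> w) \<in> positive G \<longleftrightarrow> inv\<^sub>G elt c \<cdot> w \<in> positive G"
    using Cons.IH[OF y(2) c1(1)] by blast
  have "inv\<^sub>G elt d' \<cdot> (prodE (y # ys) \<cdot> w) \<in> positive G \<longleftrightarrow> inv\<^sub>G elt c \<cdot> w \<in> positive G"
    if w: "w \<in> positive G" for w
    using c1(2)[of "prodE ys \<cdot> w"] c(2)[OF w] pos_mult prodE_pos[OF y(2)] w y pos_carrier
    by (simp add: Gr.m_assoc)
  then show ?case using c by blast
qed

text \<open>Fills a rectangle of lcm squares: \<open>simple_list_lcm\<close> completes one row along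
  the factors of Y, and this induction adds one row for each factor of \<open>ds\<close>.\<close>

lemma list_lcm:
  assumes "set ds \<subseteq> S" "Y \<in> positive G"
  shows "\<exists>c\<in>positive G. \<forall>w\<in>positive G. inv\<^sub>G prodE ds \<cdot> (Y \<cdot> w) \<in> positive G \<longleftrightarrow> inv\<^sub>G c \<cdot> w \<in> positive G"
  using assms
proof (induction ds arbitrary: Y)
  case Nil
  then show ?case using one_pos pos_carrier pos_mult by (intro bexI[of _ "\<one>\<^bsub>G\<^esub>"]) auto
next
  case (Cons x ds)
  then have x: "x \<in> S" "set ds \<subseteq> S" by auto
  have canc: "a \<cdot> (inv\<^sub>G a \<cdot> b) = b" "inv\<^sub>G a \<cdot> (a \<cdot> b) = b"
    if "a \<in> carrier G" "b \<in> carrier G" for a b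
    using that by (simp_all add: Gr.m_assoc[symmetric])
  obtain ys where ys: "NL ys" "Y = prodE ys" using Cons.prems(2) by (rule pos_NL)
  obtain c where c: "c \<in> S" "\<And>w. w \<in> positive G \<Longrightarrow>
    inv\<^sub>G elt x \<cdot> (Y \<cdot> w) \<in> positive G \<longleftrightarrow> inv\<^sub>G elt c \<cdot> w \<in> positive G"
    using simple_list_lcm[OF NL_S[OF ys(1)] x(1)] ys by blast
  let ?Y = "inv\<^sub>G elt x \<cdot> (Y \<cdot> elt c)"
  have Y': "?Y \<in> positive G" using c one_pos by simp
  have G: "Y \<in> carrier G" "elt c \<in> carrier G" "elt x \<in> carrier G" "prodE ds \<in> carrier G" "?Y \<in> carrier G"
    using Cons.prems pos_carrier c x by auto
  obtain b where b: "b \<in> positive G" "\<And>w. w \<in> positive G \<Longrightarrow>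
    inv\<^sub>G prodE ds \<cdot> (?Y \<cdot> w) \<in> positive G \<longleftrightarrow> inv\<^sub>G b \<cdot> w \<in> positive G"
    using Cons.IH[OF x(2) Y'] by blast
  have bG: "b \<in> carrier G" using b pos_carrier by blast
  have "inv\<^sub>G prodE (x # ds) \<cdot> (Y \<cdot> w) \<in> positive G \<longleftrightarrow> inv\<^sub>G (elt c \<cdot> b) \<cdot> w \<in> positive G"
    if w: "w \<in> positive G" for w
  proof -
    have wG: "w \<in> carrier G" using w pos_carrier by blast
    let ?v = "inv\<^sub>G elt c \<cdot> w"
    have vG: "?v \<in> carrier G" using G wG by simp
    have eq1: "inv\<^sub>G prodE (x # ds) \<cdot> (Y \<cdot> w) = inv\<^sub>G prodE ds \<cdot> (inv\<^sub>G elt x \<cdot> (Y \<cdot> w))"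
      using G wG by (simp add: Gr.inv_mult_group Gr.m_assoc)
    have eq2: "inv\<^sub>G elt x \<cdot> (Y \<cdot> w) = ?Y \<cdot> ?v"
      using G wG vG canc(1)[OF G(2) wG] by (simp add: Gr.m_assoc)
    have eq3: "inv\<^sub>G (elt c \<cdot> b) \<cdot> w = inv\<^sub>G b \<cdot> ?v"
      using G wG bG by (simp add: Gr.inv_mult_group Gr.m_assoc)
    show ?thesis
    proof
      assume a: "inv\<^sub>G prodE (x # ds) \<cdot> (Y \<cdot> w) \<in> positive G"
      have "prodE ds \<cdot> (inv\<^sub>G prodE (x # ds) \<cdot> (Y \<cdot> w)) \<in> positive G"
        by (rule pos_mult[OF prodE_pos[OF x(2)] a])
      then have "inv\<^sub>G elt x \<cdot> (Y \<cdot> w) \<in> positive G" unfolding eq1 using canc(1) G wG by simp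
      then have "?v \<in> positive G" using c(2)[OF w] by simp
      then show "inv\<^sub>G (elt c \<cdot> b) \<cdot> w \<in> positive G" using a b(2)[of ?v] unfolding eq1 eq2 eq3 by blast
    next
      assume a: "inv\<^sub>G (elt c \<cdot> b) \<cdot> w \<in> positive G"
      then have "b \<cdot> (inv\<^sub>G b \<cdot> ?v) \<in> positive G" unfolding eq3 using pos_mult b(1) by blast
      then have "?v \<in> positive G" using canc(1)[OF bG vG] by simp
      then show "inv\<^sub>G prodE (x # ds) \<cdot> (Y \<cdot> w) \<in> positive G"
        using a b(2)[of ?v] unfolding eq1 eq2 eq3 by blast
    qed
  qed
  moreover have "elt c \<cdot> b \<in> positive G" using b c pos_mult by simp
  ultimately show ?case by blast
qed

lemma garside_group_G: "garside_group G len"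
proof (unfold_locales)
  show "positive G \<subseteq> carrier G" using pos_carrier by blast
  show "\<one>\<^bsub>G\<^esub> \<in> positive G" by (rule one_pos)
  show "a \<cdot> b \<in> positive G" if "a \<in> positive G" "b \<in> positive G" for a b using pos_mult that .
  show D: "\<Delta>\<^bsub>G\<^esub> \<in> positive G" using elt_pos[OF dl_S] by (simp add: elt_dl)
  show "\<Delta>\<^bsub>G\<^esub> \<noteq> \<one>\<^bsub>G\<^esub>" using elt_inj[of dl e] e_neq_dl by (auto simp: elt_e elt_dl)
  show "inv\<^sub>G \<Delta>\<^bsub>G\<^esub> \<cdot> p \<cdot> \<Delta>\<^bsub>G\<^esub> \<in> positive G" if "p \<in> positive G" for p
    using dl_conj_pos[OF that] by (simp add: elt_dl)
  show "\<exists>e::nat. 0 < e \<and> (\<forall>g\<in>carrier G. \<Delta>\<^bsub>G\<^esub> [^]\<^bsub>G\<^esub> e \<cdot> g = g \<cdot> \<Delta>\<^bsub>G\<^esub> [^]\<^bsub>G\<^esub> e)"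
    using dl_pow_central ord_pos by (auto simp: elt_dl)
  show "\<exists>k::nat. \<Delta>\<^bsub>G\<^esub> [^]\<^bsub>G\<^esub> k \<cdot> g \<in> positive G" if "g \<in> carrier G" for g
    using dominated[OF that] by (simp add: elt_dl)
  show "len (a \<cdot> b) = len a + len b" if "a \<in> carrier G" "b \<in> carrier G" for a b
    using len_mult[OF homog that] .
  show "0 < len p" if "p \<in> positive G" "p \<noteq> \<one>\<^bsub>G\<^esub>" for p
  proof -
    obtain w where w: "w \<in> lists A" "p = gen w" using \<open>p \<in> positive G\<close> unfolding positive_G by blast
    then have "w \<noteq> []" using \<open>p \<noteq> \<one>\<^bsub>G\<^esub>\<close> by (auto simp: gen_Nil)
    then show ?thesis using w len_gen[OF homog] by simp
  qed
  show "\<exists>j\<in>positive G. inv\<^sub>G g \<cdot> j \<in> positive G \<and>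
      (\<forall>w\<in>positive G. inv\<^sub>G g \<cdot> w \<in> positive G \<longrightarrow> inv\<^sub>G j \<cdot> w \<in> positive G)"
    if g: "g \<in> carrier G" for g
  proof -
    obtain k :: nat where k: "elt dl [^]\<^bsub>G\<^esub> k \<cdot> g \<in> positive G" using dominated[OF g] by blast
    \<comment> \<open>As Delta^k g is the product of \<open>ds\<close>, an element w lies above g
      iff that product is a prefix of Delta^k w.\<close>
    let ?Y = "elt dl [^]\<^bsub>G\<^esub> k"
    have Y: "?Y \<in> positive G" by (induction k) (auto simp: one_pos intro: pos_mult)
    obtain ds where ds: "NL ds" "?Y \<cdot> g = prodE ds" using k by (rule pos_NL)
    obtain j where j: "j \<in> positive G" "\<And>w. w \<in> positive G \<Longrightarrow>
      inv\<^sub>G prodE ds \<cdot> (?Y \<cdot> w) \<in> positive G \<longleftrightarrow> inv\<^sub>G j \<cdot> w \<in> positive G"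
      using list_lcm[OF NL_S[OF ds(1)] Y] by blast
    have eq: "inv\<^sub>G prodE ds \<cdot> (?Y \<cdot> w) = inv\<^sub>G g \<cdot> w" if "w \<in> carrier G" for w
      unfolding ds(2)[symmetric] using that g pos_carrier[OF Y]
      by (simp add: Gr.inv_mult_group Gr.m_assoc) (simp add: Gr.m_assoc[symmetric])
    have "inv\<^sub>G j \<cdot> j \<in> positive G" using j(1) pos_carrier one_pos by simp
    then show ?thesis using j eq pos_carrier by (intro bexI[of _ j]) auto
  qed
qed

text \<open>In the induction the tail of a product dividing Delta is an element t of the germ below
  cmp x, so the product of x and t is defined there.\<close>

lemma simples_G: "simples G = elt ` S"
proof (intro Set.set_eqI iffI)
  interpret gg: garside_group G len by (rule garside_group_G)
  fix g
  show "g \<in> simples G" if g: "g \<in> elt ` S"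
  proof -
    obtain s where s: "s \<in> S" "g = elt s" using g by blast
    then show ?thesis using elt_le_iff[OF s(1) dl_S] le_dl by (simp add: gg.simples_iff elt_dl)
  qed
  assume g: "g \<in> simples G"
  then obtain xs where xs: "NL xs" "g = prodE xs" using pos_NL gg.simples_iff by blast
  have "set xs \<subseteq> S \<Longrightarrow> inv\<^sub>G prodE xs \<cdot> \<Delta>\<^bsub>G\<^esub> \<in> positive G \<Longrightarrow> prodE xs \<in> elt ` S"
  proof (induction xs)
    case Nil then show ?case using elt_e by (metis e_S imageI prodE_simps(1))
  next
    case (Cons x xs)
    have x: "x \<in> S" "set xs \<subseteq> S" using Cons by auto
    have xc: "elt x \<cdot> elt (cmp x) = \<Delta>\<^bsub>G\<^esub>" using elt_mul[of x "cmp x" dl] x by (simp add: elt_dl)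
    have "inv\<^sub>G prodE (x # xs) \<cdot> \<Delta>\<^bsub>G\<^esub> = inv\<^sub>G prodE xs \<cdot> elt (cmp x)"
      unfolding xc[symmetric] using x by (simp add: Gr.inv_mult_group Gr.m_assoc)
    then have p: "inv\<^sub>G prodE xs \<cdot> elt (cmp x) \<in> positive G" using Cons.prems by simp
    have "inv\<^sub>G elt (cmp x) \<cdot> \<Delta>\<^bsub>G\<^esub> \<in> positive G"
      using elt_le_iff[of "cmp x" dl] le_dl x by (simp add: elt_dl)
    then have "inv\<^sub>G prodE xs \<cdot> \<Delta>\<^bsub>G\<^esub> \<in> positive G"
      using gg.le_trans[OF _ _ _ p] x by simp
    then obtain t where t: "t \<in> S" "prodE xs = elt t" using Cons.IH x by blast
    then have "t \<preceq> cmp x" using p elt_le_iff[of t "cmp x"] x by simp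
    then obtain u where u: "u \<in> S" "mul x t = Some u" using mul_defined_iff[OF x(1) t(1)] by blast
    then show ?case using elt_mul[OF x(1) t(1)] t by auto
  qed
  then show "g \<in> elt ` S" using xs NL_S[OF xs(1)] g gg.simples_iff by blast
qed

lemma len_elt: "s \<in> S \<Longrightarrow> len (elt s) = int (length (rep s))"
  unfolding elt_def using len_gen[OF homog] by simp

end

section \<open>Periodicity and rigid exponents\<close>

context garside_group begin

text \<open>Let z = g^(-1) y g. Rigidity of y^k puts g^(-1) into an axis set of z^k, with exponents
  kp and kq by uniqueness. The inclusion moves it into V z, which is rigidity of y.\<close>

lemma rigid_of_rigid_pow:
  assumes y: "y \<in> carrier G" and z: "rigid G z" "conjugate G y z" "\<And>j. z \<noteq> D j"
    and k: "1 \<le> k" "rigid G (y [^] (k :: nat))"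
    and sub: "\<And>p q. \<lbrakk>p < q; \<one> \<in> V z p q\<rbrakk> \<Longrightarrow> V (z [^] k) (int k * p) (int k * q) \<subseteq> V z p q"
  shows "rigid G y"
proof -
  obtain g where g: "g \<in> carrier G" "z = inv g \<otimes> y \<otimes> g" using z(2) by (auto simp: conjugate_def)
  have zG: "z \<in> carrier G" using g y by simp
  obtain p q where pq: "p < q" "\<one> \<in> V z p q" using z(1,3) unfolding rigid_iff by blast
  let ?c = "inv g"
  have c: "?c \<in> carrier G" using g by simp
  have yz: "y = inv ?c \<otimes> z \<otimes> ?c" unfolding g(2) using g(1) y by (simp add: m_assoc)
  have yk: "y [^] k = inv ?c \<otimes> z [^] k \<otimes> ?c" unfolding yz using conj_pow[OF zG c] by simp
  have np: "nonpower (z [^] k)" using nonpower_pow[OF zG pq z(3) k(1)] .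
  have "\<And>j. y [^] k \<noteq> D j" using np c unfolding nonpower_def yk by blast
  then obtain p' q' where V: "p' < q'" "\<one> \<in> V (y [^] k) p' q'" using k(2) unfolding rigid_iff by blast
  have zk: "z [^] k \<in> carrier G" using zG by simp
  have lt: "int k * p < int k * q" using pq k by simp
  have cV: "?c \<in> V (z [^] k) p' q'" using V_conj[OF zk c one_closed] V(2) c unfolding yk by simp
  then have "p' = int k * p" "q' = int k * q"
    using V_exp_unique[OF zk V(1) lt cV V_pow[OF zG pq k(1)] np] by auto
  then have "?c \<in> V z p q" using cV sub[OF pq] by blast
  then have "\<one> \<in> V y p q" using V_conj[OF zG c one_closed] c yz by simp
  then show ?thesis using y pq unfolding rigid_iff by blast
qed

lemma card_SC_periodic:
  assumes x: "rigid G x" and L: "1 \<le> L"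
    and sub: "\<And>p q n. \<lbrakk>p < q; \<one> \<in> V x p q; \<And>k. x \<noteq> D k; 1 \<le> n\<rbrakk> \<Longrightarrow>
      V (x [^] (n :: nat)) (int n * p) (int n * q) \<subseteq> V (x [^] L) (int L * p) (int L * q)"
  shows "periodic L (\<lambda>n. card (SC G (x [^] n)))"
proof (cases "\<exists>k. x = D k")
  case True
  then obtain k where "x = D k" by blast
  then show ?thesis using L by (simp add: periodic_def nat_D SC_D)
next
  case False
  then obtain p q where pq: "p < q" "\<one> \<in> V x p q" and xG: "x \<in> carrier G" using x unfolding rigid_iff by blast
  have "card (SC G (x [^] (n + L))) = card (SC G (x [^] n))" if "1 \<le> n" for n
    by (rule card_SC_pow_add[OF xG pq _ L _ that]) (use False sub[OF pq] in blast)+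
  then show ?thesis using L by (simp add: periodic_def)
qed

text \<open>If y is conjugate to a power of Delta, its power with the central exponent e is itself a
  power of Delta and hence rigid. Otherwise y is already rigid, and only the first case can make the
  exponent exceed 1.\<close>

lemma rigid_exponent_le:
  fixes e :: nat
  assumes y: "y \<in> carrier G" and z: "rigid G z" "conjugate G y z"
    and k: "1 \<le> k" "rigid G (y [^] (k :: nat))"
    and sub: "\<And>p q. \<lbrakk>p < q; \<one> \<in> V z p q; \<And>j. z \<noteq> D j\<rbrakk> \<Longrightarrow> V (z [^] k) (int k * p) (int k * q) \<subseteq> V z p q"
    and e: "0 < e" "\<And>g. g \<in> carrier G \<Longrightarrow> \<Delta> [^] e \<otimes> g = g \<otimes> \<Delta> [^] e"
  shows "rigid_exponent G y \<le> e"
proof (cases "\<exists>j. z = D j")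
  case True
  then obtain j where j: "z = D j" by blast
  obtain g where g: "g \<in> carrier G" "z = inv g \<otimes> y \<otimes> g" using z(2) by (auto simp: conjugate_def)
  have "z [^] e = inv g \<otimes> y [^] e \<otimes> g" unfolding g(2) using conj_pow[OF y g(1)] .
  then have "y [^] e = g \<otimes> D (int e * j) \<otimes> inv g" using g(1) y unfolding j nat_D by (simp add: m_assoc)
  also have "\<dots> = D (int e * j) \<otimes> g \<otimes> inv g" using D_mult_central[OF e(2) g(1)] by simp
  also have "\<dots> = D (int e * j)" using g(1) by (simp add: m_assoc)
  finally have "rigid G (y [^] e)" using y unfolding rigid_iff by auto
  then show ?thesis unfolding rigid_exponent_def using e(1) by (intro Least_le) simp
next
  case False
  then have "rigid G y" using rigid_of_rigid_pow[OF y z _ k] sub by blast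
  then have "rigid_exponent G y \<le> 1" unfolding rigid_exponent_def using y by (intro Least_le) simp
  then show ?thesis using e(1) by simp
qed

end

section \<open>Circular groups\<close>

text \<open>The pair (i, p) stands for s(i, p). All words of length 0 represent 1 and all words of
  length l represent Delta, so the starting index is normalized to 0 for these.\<close>

definition circ_simples :: "nat \<Rightarrow> nat \<Rightarrow> (nat \<times> nat) set" where
  "circ_simples m l = {(i, p). i < m \<and> p \<le> l \<and> (p = 0 \<or> p = l \<longrightarrow> i = 0)}"

definition circ_mul :: "nat \<Rightarrow> nat \<Rightarrow> nat \<times> nat \<Rightarrow> nat \<times> nat \<Rightarrow> (nat \<times> nat) option" where
  "circ_mul m l = (\<lambda>(i, p) (j, q). if p = 0 then Some (j, q) else if q = 0 then Some (i, p)
     else if j = (i + p) mod m \<and> p + q \<le> l then Some (if p + q = l then 0 else i, p + q) else None)"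

definition circ_cmp :: "nat \<Rightarrow> nat \<Rightarrow> nat \<times> nat \<Rightarrow> nat \<times> nat" where
  "circ_cmp m l = (\<lambda>(i, p). (if p = 0 \<or> p = l then 0 else (i + p) mod m, l - p))"

definition circ_meet :: "nat \<Rightarrow> nat \<times> nat \<Rightarrow> nat \<times> nat \<Rightarrow> nat \<times> nat" where
  "circ_meet l = (\<lambda>(i, p) (j, q). if p = l then (j, q) else if q = l then (i, p)
     else if i = j then (i, min p q) else (0, 0))"

text \<open>The simple elements form m chains, one for each starting letter, glued together at 1 and
  Delta.\<close>

lemma circ_le_iff:
  assumes s: "(i, p) \<in> circ_simples m l" and t: "(j, q) \<in> circ_simples m l"
  shows "(\<exists>u\<in>circ_simples m l. circ_mul m l (i, p) u = Some (j, q)) \<longleftrightarrow> p = 0 \<or> q = l \<or> (i = j \<and> p \<le> q)"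
proof
  assume "\<exists>u\<in>circ_simples m l. circ_mul m l (i, p) u = Some (j, q)"
  then show "p = 0 \<or> q = l \<or> (i = j \<and> p \<le> q)"
    by (auto simp: circ_mul_def split: if_splits)
next
  have m: "0 < m" using s by (auto simp: circ_simples_def)
  assume "p = 0 \<or> q = l \<or> (i = j \<and> p \<le> q)"
  then consider "p = 0" | "p \<noteq> 0" "p = q" "i = j" | "p \<noteq> 0" "q = l" "p < l" | "p \<noteq> 0" "q \<noteq> l" "i = j" "p < q"
    using s t by (fastforce simp: circ_simples_def)
  then show "\<exists>u\<in>circ_simples m l. circ_mul m l (i, p) u = Some (j, q)"
  proof cases
    case 1 then show ?thesis using t by (intro bexI[of _ "(j, q)"]) (auto simp: circ_mul_def)
  next
    case 2 then show ?thesis using m by (intro bexI[of _ "(0, 0)"]) (auto simp: circ_mul_def circ_simples_def)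
  next
    case 3 then show ?thesis using s t m
      by (intro bexI[of _ "((i + p) mod m, l - p)"]) (auto simp: circ_mul_def circ_simples_def)
  next
    case 4 then show ?thesis using s t m
      by (intro bexI[of _ "((i + p) mod m, q - p)"]) (auto simp: circ_mul_def circ_simples_def)
  qed
qed

text \<open>Conjugation by Delta moves the starting index by l modulo m, whence the order m / gcd(m,
  l) in the bound.\<close>

lemma circ_cmp_pow:
  assumes "0 < p" "p < l" "i < m"
  shows "(circ_cmp m l ^^ (2 * k)) (i, p) = ((i + k * l) mod m, p)"
proof (induction k)
  case (Suc k)
  have "(circ_cmp m l ^^ (2 * Suc k)) (i, p) = circ_cmp m l (circ_cmp m l ((i + k * l) mod m, p))"
    using Suc by simp
  also have "\<dots> = ((((i + k * l) mod m + p) mod m + (l - p)) mod m, p)" using assms by (simp add: circ_cmp_def)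
  also have "(((i + k * l) mod m + p) mod m + (l - p)) mod m = (i + k * l + p + (l - p)) mod m"
    by (simp add: mod_simps)
  also have "i + k * l + p + (l - p) = i + Suc k * l" using assms by simp
  finally show ?case .
qed (use assms in simp)

lemma germ_circ:
  assumes m: "1 \<le> m" and l: "1 \<le> l"
  shows "germ (circ_simples m l) (circ_mul m l) (0, 0) (0, l) (circ_cmp m l) (circ_meet l) (m div gcd m l)"
proof
  let ?S = "circ_simples m l" and ?mul = "circ_mul m l"
  show "(0, 0) \<in> ?S" "(0, l) \<in> ?S" using m by (auto simp: circ_simples_def)
  show "(0, 0) \<noteq> (0, l)" using l by simp
  show "0 < m div gcd m l" using m by (simp add: div_greater_zero_iff gcd_le1_nat)
  fix s assume s: "s \<in> ?S"
  obtain i p where ip: "s = (i, p)" by (cases s)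
  show "circ_cmp m l s \<in> ?S" using s m by (auto simp: ip circ_simples_def circ_cmp_def)
  show "?mul (0, 0) s = Some s" "?mul s (0, 0) = Some s" using s by (auto simp: ip circ_mul_def circ_simples_def)
  show "?mul s (circ_cmp m l s) = Some (0, l)" using s by (auto simp: ip circ_mul_def circ_cmp_def circ_simples_def)
  show "(circ_cmp m l ^^ (2 * (m div gcd m l))) s = s"
  proof (cases "p = 0 \<or> p = l")
    case True
    then have "s = (0, 0) \<or> s = (0, l)" using s by (auto simp: ip circ_simples_def)
    moreover have "(circ_cmp m l ^^ (2 * k)) (0, 0) = (0, 0) \<and> (circ_cmp m l ^^ (2 * k)) (0, l) = (0, l)" for k
      by (induction k) (auto simp: circ_cmp_def)
    ultimately show ?thesis by blast
  next
    case False
    then have "0 < p" "p < l" "i < m" using s by (auto simp: ip circ_simples_def)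
    moreover have "m dvd m div gcd m l * l"
      by (metis dvd_div_mult dvd_triv_left gcd_dvd1 gcd_dvd2 div_mult_swap)
    then have "(i + m div gcd m l * l) mod m = i" using \<open>i < m\<close> by (metis mod_add_right_eq dvd_imp_mod_0 add.right_neutral mod_less)
    ultimately show ?thesis using circ_cmp_pow by (simp add: ip)
  qed
  fix t assume t: "t \<in> ?S"
  obtain j q where jq: "t = (j, q)" by (cases t)
  show mS: "circ_meet l s t \<in> ?S" using s t m by (auto simp: ip jq circ_simples_def circ_meet_def min_def)
  show "\<exists>u\<in>?S. ?mul (circ_meet l s t) u = Some s" "\<exists>u\<in>?S. ?mul (circ_meet l s t) u = Some t"
  proof -
    obtain k r where kr: "circ_meet l s t = (k, r)" by (cases "circ_meet l s t")
    have "r = 0 \<or> p = l \<or> (k = i \<and> r \<le> p)" "r = 0 \<or> q = l \<or> (k = j \<and> r \<le> q)"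
      using kr s t by (auto simp: ip jq circ_meet_def circ_simples_def split: if_splits)
    then show "\<exists>u\<in>?S. ?mul (circ_meet l s t) u = Some s" "\<exists>u\<in>?S. ?mul (circ_meet l s t) u = Some t"
      using circ_le_iff[of k r m l i p] circ_le_iff[of k r m l j q] mS s t kr by (auto simp: ip jq)
  qed
  show "?mul s t = Some (0, 0) \<Longrightarrow> s = (0, 0)" using s by (auto simp: ip jq circ_mul_def circ_simples_def split: if_splits)
  show "u \<in> ?S" if "?mul s t = Some u" for u
    using that s t m by (auto simp: ip jq circ_mul_def circ_simples_def split: if_splits)
  show "t = t'" if "t' \<in> ?S" "?mul s t = Some x" "?mul s t' = Some x" for t' x
    using that s t by (cases t') (auto simp: ip jq circ_mul_def circ_simples_def split: if_splits)
  show "Option.bind (?mul s t) (\<lambda>x. ?mul x u) = Option.bind (?mul t u) (?mul s)" if "u \<in> ?S" for u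
  proof -
    obtain k r where kr: "u = (k, r)" by (cases u)
    consider "p = 0" | "p > 0" "q = 0" | "p > 0" "q > 0" "r = 0" | "p > 0" "q > 0" "r > 0" by blast
    then show ?thesis
    proof cases
      case 1 then show ?thesis using that t by (cases "?mul t u") (auto simp: ip jq kr circ_mul_def circ_simples_def)
    next
      case 2 then show ?thesis using s t by (simp add: ip jq kr circ_mul_def circ_simples_def)
    next
      case 3 then show ?thesis using that s t by (simp add: ip jq kr circ_mul_def circ_simples_def)
    next
      case 4
      let ?c = "j = (i + p) mod m \<and> k = (j + q) mod m \<and> p + q + r \<le> l"
      have mod: "((i + p) mod m + q) mod m = (i + (p + q)) mod m" by (simp add: mod_simps add.assoc)
      have "Option.bind (?mul s t) (\<lambda>x. ?mul x u) = (if ?c then Some (if p + q + r = l then 0 else i, p + q + r) else None)"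
        using 4 mod by (auto simp: ip jq kr circ_mul_def)
      moreover have "Option.bind (?mul t u) (?mul s) = (if ?c then Some (if p + q + r = l then 0 else i, p + q + r) else None)"
        using 4 by (auto simp: ip jq kr circ_mul_def)
      ultimately show ?thesis by simp
    qed
  qed
  show "\<exists>u\<in>?S. ?mul r u = Some (circ_meet l s t)"
    if "r \<in> ?S" "\<exists>u\<in>?S. ?mul r u = Some s" "\<exists>u\<in>?S. ?mul r u = Some t" for r
  proof -
    obtain k n where kn: "r = (k, n)" by (cases r)
    obtain k' n' where kn': "circ_meet l s t = (k', n')" by (cases "circ_meet l s t")
    have "n = 0 \<or> p = l \<or> (k = i \<and> n \<le> p)" "n = 0 \<or> q = l \<or> (k = j \<and> n \<le> q)"
      using that circ_le_iff[of k n m l i p] circ_le_iff[of k n m l j q] s t by (auto simp: ip jq kn)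
    then have "n = 0 \<or> n' = l \<or> (k = k' \<and> n \<le> n')"
      using kn' by (auto simp: ip jq circ_meet_def split: if_splits)
    then show ?thesis using circ_le_iff[of k n m l k' n'] that mS by (auto simp: kn kn')
  qed
  show "\<exists>j\<in>?S. (\<exists>u\<in>?S. ?mul s u = Some j) \<and> (\<exists>u\<in>?S. ?mul t u = Some j) \<and>
      (\<forall>w\<in>?S. (\<exists>u\<in>?S. ?mul s u = Some w) \<longrightarrow> (\<exists>u\<in>?S. ?mul t u = Some w) \<longrightarrow> (\<exists>u\<in>?S. ?mul j u = Some w))"
  proof -
    define w where "w = (if p = 0 then t else if q = 0 then s else if i = j then (i, max p q) else (0, l))"
    obtain k n where kn: "w = (k, n)" by (cases w)
    have wS: "w \<in> ?S" using s t m by (auto simp: w_def ip jq circ_simples_def max_def)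
    have le: "p = 0 \<or> n = l \<or> (i = k \<and> p \<le> n)" "q = 0 \<or> n = l \<or> (j = k \<and> q \<le> n)"
      using kn by (auto simp: w_def ip jq split: if_splits)
    have "n = 0 \<or> n' = l \<or> (k = k' \<and> n \<le> n')"
      if "p = 0 \<or> n' = l \<or> (i = k' \<and> p \<le> n')" "q = 0 \<or> n' = l \<or> (j = k' \<and> q \<le> n')" for k' n'
      using that kn by (auto simp: w_def ip jq split: if_splits)
    then have least: "\<exists>u\<in>?S. ?mul w u = Some r"
        if "r \<in> ?S" "\<exists>u\<in>?S. ?mul s u = Some r" "\<exists>u\<in>?S. ?mul t u = Some r" for r
      using that circ_le_iff[of i p m l "fst r" "snd r"] circ_le_iff[of j q m l "fst r" "snd r"]
        circ_le_iff[of k n m l "fst r" "snd r"] wS s t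
      unfolding kn ip jq prod.collapse by metis
    moreover have "\<exists>u\<in>?S. ?mul s u = Some w" "\<exists>u\<in>?S. ?mul t u = Some w"
      using le circ_le_iff[of i p m l k n] circ_le_iff[of j q m l k n] wS s t
      unfolding kn ip jq by metis+
    ultimately show ?thesis using wS by blast
  qed
qed

definition circ_rel :: "nat \<Rightarrow> nat \<Rightarrow> (nat list \<times> nat list) set" where
  "circ_rel m l = {(circular_word m i l, circular_word m (i + 1) l) | i. i < m}"

lemma circular_word_Suc: "circular_word m i (Suc p) = i mod m # circular_word m (i + 1) p"
  by (simp add: circular_word_def upt_conv_Cons map_Suc_upt[symmetric] comp_def del: upt_Suc)

lemma circular_word_add: "circular_word m i (p + q) = circular_word m i p @ circular_word m (i + p) q"
  by (induction p arbitrary: i) (simp_all add: circular_word_Suc, simp add: circular_word_def)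

lemma circular_word_mod: "circular_word m (i mod m) p = circular_word m i p"
  by (simp add: circular_word_def mod_simps)

lemma circular_word_lists: "0 < m \<Longrightarrow> circular_word m i p \<in> lists {0..<m}"
  by (auto simp: circular_word_def in_lists_conv_set)

context
  fixes m l :: nat
  assumes m: "1 \<le> m" and l: "1 \<le> l"
begin

text \<open>For l = 1 every letter is Delta and needs its normalized name (0, 1).\<close>

definition circ_at :: "nat \<Rightarrow> nat \<times> nat" where "circ_at a = (if l = 1 then (0, 1) else (a, 1))"

definition circ_rep :: "nat \<times> nat \<Rightarrow> nat list" where "circ_rep = (\<lambda>(i, p). circular_word m i p)"

interpretation ge: germ "circ_simples m l" "circ_mul m l" "(0, 0)" "(0, l)" "circ_cmp m l" "circ_meet l" "m div gcd m l"
  by (rule germ_circ[OF m l])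

interpretation wg: word_group "{0..<m}" "circ_rel m l" "circular_word m 0 l"
  by unfold_locales (use m circular_word_lists in simp)

lemma circ_gprod:
  "p \<le> l \<Longrightarrow> ge.gprod circ_at (circular_word m i p) = Some (if p = 0 \<or> p = l then 0 else i mod m, p)"
proof (induction p arbitrary: i)
  case 0 then show ?case by (simp add: circular_word_def)
next
  case (Suc p)
  then have "ge.gprod circ_at (circular_word m i (Suc p)) =
      circ_mul m l (circ_at (i mod m)) (if p = 0 then 0 else (i + 1) mod m, p)"
    by (simp add: circular_word_Suc)
  also have "\<dots> = Some (if Suc p = l then 0 else i mod m, Suc p)"
  proof (cases "l = 1")
    case True
    then have "p = 0" "circ_at (i mod m) = (0, 1)" using Suc.prems unfolding circ_at_def by simp_all
    then show ?thesis using True by (simp add: circ_mul_def)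
  next
    case False
    then have "circ_at (i mod m) = (i mod m, 1)" by (simp add: circ_at_def)
    then show ?thesis using Suc.prems False by (cases "p = 0") (auto simp: circ_mul_def mod_simps)
  qed
  finally show ?case by simp
qed

lemma circ_gen_l: "wg.gen (circular_word m i l) = wg.gen (circular_word m 0 l)"
proof (induction i)
  case (Suc i)
  have "(circular_word m (i mod m) l, circular_word m (i mod m + 1) l) \<in> circ_rel m l"
    using m by (auto simp: circ_rel_def)
  then have "([] @ circular_word m (i mod m) l @ [], [] @ circular_word m (i mod m + 1) l @ []) \<in> word_cong {0..<m} (circ_rel m l)"
    using m circular_word_lists by (intro word_cong.rel) auto
  then have "wg.gen (circular_word m (i mod m) l) = wg.gen (circular_word m (i mod m + 1) l)"
    using wg.gen_cong by simp
  moreover have "circular_word m (i mod m + 1) l = circular_word m (Suc i) l"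
    using circular_word_mod[of m "i mod m + 1" l] circular_word_mod[of m "Suc i" l] by (simp add: mod_simps)
  ultimately show ?case using Suc by (simp add: circular_word_mod)
qed simp

lemma germ_presentation_circ:
  "germ_presentation (circ_simples m l) (circ_mul m l) (0, 0) (0, l) (circ_cmp m l) (circ_meet l) (m div gcd m l)
    {0..<m} (circ_rel m l) (circular_word m 0 l) circ_rep circ_at"
proof unfold_locales
  show "length u = length v" if "(u, v) \<in> circ_rel m l" for u v
    using that by (auto simp: circ_rel_def circular_word_def)
  show "circ_at a \<in> circ_simples m l" if "a \<in> {0..<m}" for a
    using that m l by (auto simp: circ_at_def circ_simples_def)
  show "ge.gprod circ_at u = ge.gprod circ_at v \<and> ge.gprod circ_at u \<noteq> None" if "(u, v) \<in> circ_rel m l" for u v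
    using that circ_gprod[of l] by (auto simp: circ_rel_def)
  fix s assume s: "s \<in> circ_simples m l"
  obtain i p where ip: "s = (i, p)" by (cases s)
  show "circ_rep s \<in> lists {0..<m}" using m circular_word_lists by (simp add: ip circ_rep_def)
  show "ge.gprod circ_at (circ_rep s) = Some s"
    using s circ_gprod[of p i] by (auto simp: ip circ_rep_def circ_simples_def)
  show "wg.gen (circ_rep s) \<otimes>\<^bsub>presented_garside {0..<m} (circ_rel m l) (circular_word m 0 l)\<^esub> wg.gen (circ_rep t) = wg.gen (circ_rep x)"
    if t: "t \<in> circ_simples m l" and x: "circ_mul m l s t = Some x" for t x
  proof -
    obtain j q where jq: "t = (j, q)" by (cases t)
    consider "p = 0" | "q = 0" | "p \<noteq> 0" "q \<noteq> 0" by blast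
    then have "wg.gen (circular_word m i p @ circular_word m j q) = wg.gen (circ_rep x)"
    proof cases
      case 1
      then have "x = (j, q)" using x by (simp add: ip jq circ_mul_def)
      then show ?thesis using 1 by (simp add: circ_rep_def circular_word_def)
    next
      case 2 then show ?thesis using x s t
        by (auto simp: ip jq circ_mul_def circ_rep_def circ_simples_def circular_word_def split: if_splits)
    next
      case 3
      then have j: "j = (i + p) mod m" "x = (if p + q = l then 0 else i, p + q)"
        using x by (auto simp: ip jq circ_mul_def split: if_splits)
      have "circular_word m i p @ circular_word m j q = circular_word m i (p + q)"
        unfolding j(1) circular_word_mod circular_word_add ..
      then show ?thesis using j(2) circ_gen_l[of i] by (auto simp: circ_rep_def)
    qed
    then show ?thesis using m circular_word_lists by (simp add: ip jq circ_rep_def wg.gen_append)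
  qed
next
  show "wg.gen (circ_rep (circ_at a)) = wg.gen [a]" if "a \<in> {0..<m}" for a
  proof -
    have w: "circular_word m a 1 = [a]" using that by (simp add: circular_word_def)
    show ?thesis
    proof (cases "l = 1")
      case True
      then have "wg.gen (circular_word m 0 1) = wg.gen [a]" using circ_gen_l[of a] w by metis
      then show ?thesis using True unfolding circ_at_def circ_rep_def by simp
    next
      case False then show ?thesis using w by (simp add: circ_at_def circ_rep_def)
    qed
  qed
  show "wg.gen (circ_rep (0, l)) = wg.gen (circular_word m 0 l)" by (simp add: circ_rep_def)
qed

interpretation gp: germ_presentation "circ_simples m l" "circ_mul m l" "(0, 0)" "(0, l)" "circ_cmp m l" "circ_meet l"
    "m div gcd m l" "{0..<m}" "circ_rel m l" "circular_word m 0 l" circ_rep circ_at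
  by (rule germ_presentation_circ)

lemma circular_group_eq: "circular_group m l = presented_garside {0..<m} (circ_rel m l) (circular_word m 0 l)"
  by (simp add: circular_group_def circ_rel_def)

abbreviation "CG \<equiv> circular_group m l"

interpretation gg: garside_group "CG" wg.len
  unfolding circular_group_eq by (rule gp.garside_group_G)

text \<open>A trivial meet forces u and v into different chains and strictly between 1 and Delta, so
  only Delta lies above both.\<close>

lemma circular_simples_join:
  assumes "u \<in> simples (CG)" "v \<in> simples (CG)" "w \<in> simples (CG)"
    and ne: "u \<noteq> \<one>\<^bsub>CG\<^esub>" "v \<noteq> \<one>\<^bsub>CG\<^esub>"
    and uv: "gg.meet u v = \<one>\<^bsub>CG\<^esub>"
    and w: "inv\<^bsub>CG\<^esub> u \<otimes>\<^bsub>CG\<^esub> w \<in> positive (CG)"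
      "inv\<^bsub>CG\<^esub> v \<otimes>\<^bsub>CG\<^esub> w \<in> positive (CG)"
  shows "w = \<Delta>\<^bsub>CG\<^esub>"
proof -
  let ?S = "circ_simples m l"
  obtain s t r where str: "s \<in> ?S" "u = gp.elt s" "t \<in> ?S" "v = gp.elt t" "r \<in> ?S" "w = gp.elt r"
    using assms(1-3) unfolding circular_group_eq gp.simples_G by blast
  have ne': "s \<noteq> (0, 0)" "t \<noteq> (0, 0)" using ne str gp.elt_e unfolding circular_group_eq by auto
  have le: "ge.le s r" "ge.le t r"
    using w gp.elt_le_iff str unfolding circular_group_eq by auto
  let ?m = "circ_meet l s t"
  have mS: "?m \<in> ?S" using str by simp
  have "ge.le ?m s" "ge.le ?m t" using ge.mt_le1 ge.mt_le2 str by auto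
  then have m1: "inv\<^bsub>CG\<^esub> gp.elt ?m \<otimes>\<^bsub>CG\<^esub> u \<in> positive (CG)"
     "inv\<^bsub>CG\<^esub> gp.elt ?m \<otimes>\<^bsub>CG\<^esub> v \<in> positive (CG)"
    using gp.elt_le_iff mS str unfolding circular_group_eq by auto
  have G: "gp.elt ?m \<in> carrier (CG)" "gp.elt ?m \<in> positive (CG)"
    "u \<in> carrier (CG)" "v \<in> carrier (CG)"
    using mS str gp.elt_carrier gp.elt_pos unfolding circular_group_eq by auto
  have "gp.elt ?m = \<one>\<^bsub>CG\<^esub>"
    using gg.meet_greatest[OF G(3,4,1) m1] gg.eq_one[OF G(2)] unfolding uv by blast
  then have "?m = (0, 0)"
    using gp.elt_inj[of ?m "(0, 0)"] mS gp.elt_e unfolding circular_group_eq by simp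
  moreover obtain i p j q k n where ijk: "s = (i, p)" "t = (j, q)" "r = (k, n)"
    by (cases s, cases t, cases r) blast
  ultimately have "i \<noteq> j" "p \<noteq> 0" "q \<noteq> 0" "p \<noteq> l" "q \<noteq> l"
    using ne' str(1,3) by (auto simp: circ_meet_def circ_simples_def split: if_splits)
  moreover have "p = 0 \<or> n = l \<or> (i = k \<and> p \<le> n)" "q = 0 \<or> n = l \<or> (j = k \<and> q \<le> n)"
    using le str circ_le_iff unfolding ge.le_def ijk by blast+
  ultimately have "r = (0, l)" using str(5) ijk by (auto simp: circ_simples_def)
  then show ?thesis using str gp.elt_dl unfolding circular_group_eq by simp
qed

lemma circular_V_pow_subset:
  assumes "x \<in> carrier (CG)" "p < q" "\<one>\<^bsub>CG\<^esub> \<in> gg.V x p q"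
    "\<And>k. x \<noteq> gg.D k" "1 \<le> (n::nat)"
  shows "gg.V (x [^]\<^bsub>CG\<^esub> n) (int n * p) (int n * q) \<subseteq> gg.V x p q"
  by (rule gg.V_pow_subset_join[OF circular_simples_join assms])

lemma circular_periodic:
  assumes "rigid (CG) x"
  shows "periodic 1 (\<lambda>n. card (SC (CG) (x [^]\<^bsub>CG\<^esub> n)))"
proof (rule gg.card_SC_periodic[OF assms])
  have x: "x \<in> carrier (CG)" using assms by (simp add: rigid_def)
  show "gg.V (x [^]\<^bsub>CG\<^esub> n) (int n * p) (int n * q) \<subseteq>
      gg.V (x [^]\<^bsub>CG\<^esub> (1::nat)) (int 1 * p) (int 1 * q)"
    if "p < q" "\<one>\<^bsub>CG\<^esub> \<in> gg.V x p q" "\<And>k. x \<noteq> gg.D k" "1 \<le> n" for p q and n :: nat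
    using circular_V_pow_subset[OF x that] x by simp
qed simp

lemma circular_rigid_exponent:
  assumes y: "y \<in> carrier (CG)"
    and z: "rigid (CG) z" "conjugate (CG) y z"
    and k: "1 \<le> k" "rigid (CG) (y [^]\<^bsub>CG\<^esub> (k::nat))"
  shows "rigid_exponent (CG) y \<le> m div gcd m l"
proof (rule gg.rigid_exponent_le[OF y z k])
  show "gg.V (z [^]\<^bsub>CG\<^esub> k) (int k * p) (int k * q) \<subseteq> gg.V z p q"
    if "p < q" "\<one>\<^bsub>CG\<^esub> \<in> gg.V z p q" "\<And>j. z \<noteq> gg.D j" for p q
    using circular_V_pow_subset[OF _ that k(1)] z(1) by (simp add: rigid_def)
  show "0 < m div gcd m l" by (rule ge.ord_pos)
  show "\<Delta>\<^bsub>CG\<^esub> [^]\<^bsub>CG\<^esub> (m div gcd m l) \<otimes>\<^bsub>CG\<^esub> g =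
      g \<otimes>\<^bsub>CG\<^esub> \<Delta>\<^bsub>CG\<^esub> [^]\<^bsub>CG\<^esub> (m div gcd m l)"
    if "g \<in> carrier (CG)" for g
    using gp.dl_pow_central[of g] that unfolding circular_group_eq by (simp add: gp.elt_dl)
qed

end

section \<open>The dual four-strand braid group\<close>

text \<open>The simple elements of the dual structure are the noncrossing partitions of \<open>{1, 2, 3, 4}\<close>:
  atoms \<open>A\<^sub>t\<^sub>s\<close>, triangles \<open>T\<^sub>t\<^sub>s\<^sub>r\<close>, and the two pairs \<open>P\<close> of commuting atoms.\<close>

datatype ncp = E0 | A21 | A31 | A32 | A41 | A42 | A43
  | T321 | T421 | T431 | T432 | P43_21 | P41_32 | D0

definition ncps :: "ncp list" where
  "ncps = [E0, A21, A31, A32, A41, A42, A43, T321, T421, T431, T432, P43_21, P41_32, D0]"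

text \<open>The products of two atoms: around a triangle they follow the cyclic order of its sides,
  and a commuting pair occurs in both orders.\<close>

fun factorizations :: "ncp \<Rightarrow> (ncp \<times> ncp) list" where
  "factorizations T321 = [(A32, A21), (A31, A32), (A21, A31)]"
| "factorizations T421 = [(A42, A21), (A41, A42), (A21, A41)]"
| "factorizations T431 = [(A43, A31), (A41, A43), (A31, A41)]"
| "factorizations T432 = [(A43, A32), (A42, A43), (A32, A42)]"
| "factorizations P43_21 = [(A43, A21), (A21, A43)]"
| "factorizations P41_32 = [(A41, A32), (A32, A41)]"
| "factorizations _ = []"

text \<open>The Kreweras complement. Applied twice it rotates the four points, so its eighth iterate
  is the identity.\<close>

fun ncp_cmp :: "ncp \<Rightarrow> ncp" where
  "ncp_cmp E0 = D0" | "ncp_cmp D0 = E0"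
| "ncp_cmp A21 = T431" | "ncp_cmp A31 = P41_32" | "ncp_cmp A32 = T421"
| "ncp_cmp A41 = T432" | "ncp_cmp A42 = P43_21" | "ncp_cmp A43 = T321"
| "ncp_cmp T321 = A41" | "ncp_cmp T421 = A43" | "ncp_cmp T431 = A32" | "ncp_cmp T432 = A21"
| "ncp_cmp P43_21 = A31" | "ncp_cmp P41_32 = A42"

definition ncp_mul :: "ncp \<Rightarrow> ncp \<Rightarrow> ncp option" where
  "ncp_mul s t = (if s = E0 then Some t else if t = E0 then Some s else if t = ncp_cmp s then Some D0
     else find (\<lambda>r. (s, t) \<in> set (factorizations r)) ncps)"

definition ncp_le :: "ncp \<Rightarrow> ncp \<Rightarrow> bool" where
  "ncp_le s t \<longleftrightarrow> s = E0 \<or> t = D0 \<or> s = t \<or> s \<in> set (map fst (factorizations t))"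

text \<open>Incomparable elements have at most one common lower bound besides E0, so the first one
  found is the meet; \<open>tl\<close> removes E0 from the search.\<close>

definition ncp_meet :: "ncp \<Rightarrow> ncp \<Rightarrow> ncp" where
  "ncp_meet s t = (if ncp_le s t then s else if ncp_le t s then t
     else case find (\<lambda>a. ncp_le a s \<and> ncp_le a t) (tl ncps) of Some a \<Rightarrow> a | None \<Rightarrow> E0)"

text \<open>The list \<open>ncps\<close> is ordered by length, so a common upper bound of length 2
  is found before D0.\<close>

definition ncp_join :: "ncp \<Rightarrow> ncp \<Rightarrow> ncp" where
  "ncp_join s t = (if ncp_le s t then t else if ncp_le t s then s
     else case find (\<lambda>r. ncp_le s r \<and> ncp_le t r) ncps of Some r \<Rightarrow> r | None \<Rightarrow> D0)"

text \<open>Reduces lattice and germ laws for the fourteen elements to finite evaluation.\<close>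

lemma list_all_ncps: "list_all P ncps \<Longrightarrow> P s"
  by (cases s) (simp_all add: ncps_def)

lemma ncp_cmp_pow: "(ncp_cmp ^^ 8) s = s"
  by (cases s) (simp_all add: eval_nat_numeral)

lemma ncp_assoc: "Option.bind (ncp_mul s t) (\<lambda>x. ncp_mul x u) = Option.bind (ncp_mul t u) (ncp_mul s)"
proof -
  have "list_all (\<lambda>s. list_all (\<lambda>t. list_all (\<lambda>u.
    Option.bind (ncp_mul s t) (\<lambda>x. ncp_mul x u) = Option.bind (ncp_mul t u) (ncp_mul s)) ncps) ncps) ncps"
    by code_simp
  then show ?thesis by (blast dest: list_all_ncps)
qed

lemma ncp_le_iff: "ncp_le s t \<longleftrightarrow> (\<exists>u. ncp_mul s u = Some t)"
proof -
  have "list_all (\<lambda>s. list_all (\<lambda>t. ncp_le s t \<longleftrightarrow> list_ex (\<lambda>u. ncp_mul s u = Some t) ncps) ncps) ncps"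
    by code_simp
  then have "ncp_le s t \<longleftrightarrow> list_ex (\<lambda>u. ncp_mul s u = Some t) ncps" by (blast dest: list_all_ncps)
  moreover have "u \<in> set ncps" for u by (cases u) (simp_all add: ncps_def)
  ultimately show ?thesis by (auto simp: list_ex_iff)
qed

lemma ncp_cancel: "ncp_mul s t = Some x \<Longrightarrow> ncp_mul s t' = Some x \<Longrightarrow> t = t'"
proof -
  have "list_all (\<lambda>s. list_all (\<lambda>t. list_all (\<lambda>t'. ncp_mul s t = ncp_mul s t' \<longrightarrow> ncp_mul s t = None \<or> t = t') ncps) ncps) ncps"
    by code_simp
  then have "ncp_mul s t = ncp_mul s t' \<longrightarrow> ncp_mul s t = None \<or> t = t'" by (blast dest: list_all_ncps)
  then show "ncp_mul s t = Some x \<Longrightarrow> ncp_mul s t' = Some x \<Longrightarrow> t = t'" by simp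
qed

lemma ncp_meet_le: "ncp_le (ncp_meet s t) s \<and> ncp_le (ncp_meet s t) t"
proof -
  have "list_all (\<lambda>s. list_all (\<lambda>t. ncp_le (ncp_meet s t) s \<and> ncp_le (ncp_meet s t) t) ncps) ncps"
    by code_simp
  then show ?thesis by (blast dest: list_all_ncps)
qed

lemma ncp_le_join: "ncp_le s (ncp_join s t) \<and> ncp_le t (ncp_join s t)"
proof -
  have "list_all (\<lambda>s. list_all (\<lambda>t. ncp_le s (ncp_join s t) \<and> ncp_le t (ncp_join s t)) ncps) ncps"
    by code_simp
  then show ?thesis by (blast dest: list_all_ncps)
qed

lemma ncp_meet_greatest: "ncp_le r s \<Longrightarrow> ncp_le r t \<Longrightarrow> ncp_le r (ncp_meet s t)"
proof -
  have "list_all (\<lambda>r. list_all (\<lambda>s. list_all (\<lambda>t. ncp_le r s \<and> ncp_le r t \<longrightarrow> ncp_le r (ncp_meet s t)) ncps) ncps) ncps"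
    by code_simp
  then show "ncp_le r s \<Longrightarrow> ncp_le r t \<Longrightarrow> ncp_le r (ncp_meet s t)" by (blast dest: list_all_ncps)
qed

lemma ncp_join_least: "ncp_le s w \<Longrightarrow> ncp_le t w \<Longrightarrow> ncp_le (ncp_join s t) w"
proof -
  have "list_all (\<lambda>s. list_all (\<lambda>t. list_all (\<lambda>w. ncp_le s w \<and> ncp_le t w \<longrightarrow> ncp_le (ncp_join s t) w) ncps) ncps) ncps"
    by code_simp
  then show "ncp_le s w \<Longrightarrow> ncp_le t w \<Longrightarrow> ncp_le (ncp_join s t) w" by (blast dest: list_all_ncps)
qed

lemma ncp_mul_cmp: "ncp_mul s (ncp_cmp s) = Some D0"
  by (cases s) (simp_all add: ncp_mul_def)

lemma ncp_unit: "ncp_mul s t = Some E0 \<Longrightarrow> s = E0"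
  by (auto simp: ncp_mul_def ncps_def split: if_splits)

lemma germ_ncp: "germ UNIV ncp_mul E0 D0 ncp_cmp ncp_meet 4"
proof
  show "\<exists>j\<in>UNIV. (\<exists>u\<in>UNIV. ncp_mul s u = Some j) \<and> (\<exists>u\<in>UNIV. ncp_mul t u = Some j) \<and>
      (\<forall>w\<in>UNIV. (\<exists>u\<in>UNIV. ncp_mul s u = Some w) \<longrightarrow> (\<exists>u\<in>UNIV. ncp_mul t u = Some w) \<longrightarrow>
        (\<exists>u\<in>UNIV. ncp_mul j u = Some w))" for s t
    using ncp_le_join[of s t] ncp_join_least[of s _ t] unfolding ncp_le_iff by blast
  show "\<exists>u\<in>UNIV. ncp_mul (ncp_meet s t) u = Some s" "\<exists>u\<in>UNIV. ncp_mul (ncp_meet s t) u = Some t" for s t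
    using ncp_meet_le[of s t] unfolding ncp_le_iff by auto
  show "\<exists>u\<in>UNIV. ncp_mul r u = Some (ncp_meet s t)"
    if "\<exists>u\<in>UNIV. ncp_mul r u = Some s" "\<exists>u\<in>UNIV. ncp_mul r u = Some t" for r s t
    using that ncp_meet_greatest[of r s t] unfolding ncp_le_iff by blast
  show "Option.bind (ncp_mul s t) (\<lambda>x. ncp_mul x u) = Option.bind (ncp_mul t u) (ncp_mul s)" for s t u
    by (rule ncp_assoc)
  show "t = t'" if "ncp_mul s t = Some x" "ncp_mul s t' = Some x" for s t t' x
    using ncp_cancel that .
  show "(ncp_cmp ^^ (2 * 4)) s = s" for s using ncp_cmp_pow[of s] by simp
  show "ncp_mul s E0 = Some s" "ncp_mul E0 s = Some s" for s by (simp_all add: ncp_mul_def)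
  show "ncp_mul s (ncp_cmp s) = Some D0" for s by (rule ncp_mul_cmp)
  show "s = E0" if "ncp_mul s t = Some E0" for s t using ncp_unit that .
qed simp_all

section \<open>Comparison of the germ with the presentation\<close>

fun ncp_rep :: "ncp \<Rightarrow> (int \<times> int) list" where
  "ncp_rep E0 = []" | "ncp_rep D0 = [(4, 3), (3, 2), (2, 1)]"
| "ncp_rep A21 = [(2, 1)]" | "ncp_rep A31 = [(3, 1)]" | "ncp_rep A32 = [(3, 2)]"
| "ncp_rep A41 = [(4, 1)]" | "ncp_rep A42 = [(4, 2)]" | "ncp_rep A43 = [(4, 3)]"
| "ncp_rep T321 = [(3, 2), (2, 1)]" | "ncp_rep T421 = [(4, 2), (2, 1)]"
| "ncp_rep T431 = [(4, 3), (3, 1)]" | "ncp_rep T432 = [(4, 3), (3, 2)]"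
| "ncp_rep P43_21 = [(4, 3), (2, 1)]" | "ncp_rep P41_32 = [(4, 1), (3, 2)]"

definition ncp_at :: "int \<times> int \<Rightarrow> ncp" where
  "ncp_at a = (if a = (2, 1) then A21 else if a = (3, 1) then A31 else if a = (3, 2) then A32
     else if a = (4, 1) then A41 else if a = (4, 2) then A42 else A43)"

lemma bkl_atoms_eq: "bkl_atoms = {(2, 1), (3, 1), (3, 2), (4, 1), (4, 2), (4, 3)}"
  unfolding bkl_atoms_def by auto

lemma bkl_indices: "4 \<ge> t \<and> t > s \<and> s > r \<and> r \<ge> 1 \<longleftrightarrow>
    (t, s, r) \<in> {(3, 2, 1), (4, 2, 1), (4, 3, 1), (4, 3, 2)}" for t s r :: int
  by auto

lemma bkl_relations_eq: "bkl_relations =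
  {([(4, 3), (2, 1)], [(2, 1), (4, 3)]), ([(2, 1), (4, 3)], [(4, 3), (2, 1)]),
   ([(4, 1), (3, 2)], [(3, 2), (4, 1)]), ([(3, 2), (4, 1)], [(4, 1), (3, 2)]),
   ([(3, 2), (2, 1)], [(3, 1), (3, 2)]), ([(4, 2), (2, 1)], [(4, 1), (4, 2)]),
   ([(4, 3), (3, 1)], [(4, 1), (4, 3)]), ([(4, 3), (3, 2)], [(4, 2), (4, 3)]),
   ([(3, 1), (3, 2)], [(2, 1), (3, 1)]), ([(4, 1), (4, 2)], [(2, 1), (4, 1)]),
   ([(4, 1), (4, 3)], [(3, 1), (4, 1)]), ([(4, 2), (4, 3)], [(3, 2), (4, 2)])}"
    (is "_ = ?R")
proof (intro subset_antisym subsetI)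
  fix w assume w: "w \<in> bkl_relations"
  consider (comm) t s r q where "w = ([(t, s), (r, q)], [(r, q), (t, s)])" "(t, s) \<in> bkl_atoms" "(r, q) \<in> bkl_atoms"
      "(t - r) * (t - q) * (s - r) * (s - q) > 0"
    | (tri) t s r where "4 \<ge> t \<and> t > s \<and> s > r \<and> r \<ge> 1"
      "w = ([(t, s), (s, r)], [(t, r), (t, s)]) \<or> w = ([(t, r), (t, s)], [(s, r), (t, r)])"
    using w unfolding bkl_relations_def by blast
  then show "w \<in> ?R"
  proof cases
    case comm
    then show ?thesis unfolding bkl_atoms_eq insert_iff empty_iff prod.inject by (elim disjE conjE) simp_all
  next
    case tri
    then have "(t, s, r) \<in> {(3, 2, 1), (4, 2, 1), (4, 3, 1), (4, 3, 2)}" unfolding bkl_indices by blast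
    then show ?thesis using tri(2) unfolding insert_iff empty_iff prod.inject by (elim disjE conjE) simp_all
  qed
next
  fix w assume "w \<in> ?R"
  then show "w \<in> bkl_relations"
    unfolding insert_iff empty_iff by (elim disjE) (simp_all add: bkl_relations_def bkl_atoms_def)
qed

interpretation bg: germ UNIV ncp_mul E0 D0 ncp_cmp ncp_meet 4
  by (rule germ_ncp)

interpretation bw: word_group bkl_atoms bkl_relations "[(4, 3), (3, 2), (2, 1)]"
  by unfold_locales (simp add: bkl_atoms_eq)

lemma find_SomeD: "find P xs = Some x \<Longrightarrow> P x"
  by (induction xs) (auto split: if_splits)

lemma ncp_rep_lists: "ncp_rep s \<in> lists bkl_atoms"
  by (cases s) (simp_all add: bkl_atoms_eq)

lemma bkl_gen_rel: "(u, v) \<in> bkl_relations \<Longrightarrow> bw.gen u = bw.gen v"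
proof -
  assume uv: "(u, v) \<in> bkl_relations"
  then have "u \<in> lists bkl_atoms \<and> v \<in> lists bkl_atoms"
    unfolding bkl_relations_eq insert_iff empty_iff prod.inject by (elim disjE conjE) (simp_all add: bkl_atoms_eq)
  then have "([] @ u @ [], [] @ v @ []) \<in> word_cong bkl_atoms bkl_relations" using uv by (intro word_cong.rel) auto
  then show ?thesis using bw.gen_cong by simp
qed

lemma ncp_mul_atoms:
  "(s, t) \<in> set (factorizations r) \<Longrightarrow> bw.gen (ncp_rep s) \<otimes>\<^bsub>bw.G\<^esub> bw.gen (ncp_rep t) = bw.gen (ncp_rep r)"
proof -
  assume st: "(s, t) \<in> set (factorizations r)"
  have rels: "bw.gen [(2, 1), (4, 3)] = bw.gen [(4, 3), (2, 1)]"
    "bw.gen [(3, 2), (4, 1)] = bw.gen [(4, 1), (3, 2)]"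
    "bw.gen [(3, 1), (3, 2)] = bw.gen [(3, 2), (2, 1)]"
    "bw.gen [(4, 1), (4, 2)] = bw.gen [(4, 2), (2, 1)]"
    "bw.gen [(4, 1), (4, 3)] = bw.gen [(4, 3), (3, 1)]"
    "bw.gen [(4, 2), (4, 3)] = bw.gen [(4, 3), (3, 2)]"
    "bw.gen [(2, 1), (3, 1)] = bw.gen [(3, 1), (3, 2)]"
    "bw.gen [(2, 1), (4, 1)] = bw.gen [(4, 1), (4, 2)]"
    "bw.gen [(3, 1), (4, 1)] = bw.gen [(4, 1), (4, 3)]"
    "bw.gen [(3, 2), (4, 2)] = bw.gen [(4, 2), (4, 3)]"
    by (rule bkl_gen_rel[symmetric], simp add: bkl_relations_eq)+
  have "bw.gen (ncp_rep s @ ncp_rep t) = bw.gen (ncp_rep r)"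
    using st by (cases r) (auto simp: rels)
  then show ?thesis using ncp_rep_lists by (simp add: bw.gen_append)
qed

text \<open>Associativity x (y z) = (x y) z for three atoms turns one factorization of Delta into
  another. The remaining complements are reached in this way from the two that can be read off the
  word for Delta.\<close>

lemma ncp_mul_shift:
  assumes "(x, y) \<in> set (factorizations r)" "(y, z) \<in> set (factorizations t)"
  shows "bw.gen (ncp_rep x) \<otimes>\<^bsub>bw.G\<^esub> bw.gen (ncp_rep t) = bw.gen (ncp_rep r) \<otimes>\<^bsub>bw.G\<^esub> bw.gen (ncp_rep z)"
proof -
  interpret group bw.G by (rule bw.group_G)
  show ?thesis
    unfolding ncp_mul_atoms[OF assms(1), symmetric] ncp_mul_atoms[OF assms(2), symmetric]
    using ncp_rep_lists by (simp add: m_assoc)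
qed

lemma ncp_mul_cmp_gen: "bw.gen (ncp_rep s) \<otimes>\<^bsub>bw.G\<^esub> bw.gen (ncp_rep (ncp_cmp s)) = bw.gen (ncp_rep D0)"
proof -
  let ?g = "\<lambda>s. bw.gen (ncp_rep s)" and ?m = "\<lambda>s t. bw.gen (ncp_rep s) \<otimes>\<^bsub>bw.G\<^esub> bw.gen (ncp_rep t)"
  interpret group bw.G by (rule bw.group_G)
  have one: "?m E0 D0 = ?g D0" "?m D0 E0 = ?g D0" using ncp_rep_lists[of D0] by (simp_all add: bw.gen_Nil)
  have 0: "?m A43 T321 = ?g D0" using bw.gen_append[of "ncp_rep A43" "ncp_rep T321"] by (simp add: bkl_atoms_eq)
  have 1: "?m T432 A21 = ?g D0" using bw.gen_append[of "ncp_rep T432" "ncp_rep A21"] by (simp add: bkl_atoms_eq)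
  have 2: "?m A42 P43_21 = ?g D0" using ncp_mul_shift[of A42 A43 T432 A21 P43_21] 1 by simp
  have 3: "?m T421 A43 = ?g D0" using ncp_mul_shift[of A42 A21 T421 A43 P43_21] 2 by simp
  have 4: "?m A32 T421 = ?g D0" using ncp_mul_shift[of A32 A42 T432 A21 T421] 1 by simp
  have 5: "?m T321 A41 = ?g D0" using ncp_mul_shift[of A32 A21 T321 A41 T421] 4 by simp
  have 6: "?m P41_32 A42 = ?g D0" using ncp_mul_shift[of A32 A41 P41_32 A42 T421] 4 by simp
  have 7: "?m A41 T432 = ?g D0" using ncp_mul_shift[of A41 A32 P41_32 A42 T432] 6 by simp
  have 8: "?m A21 T431 = ?g D0" using ncp_mul_shift[of A21 A31 T321 A41 T431] 5 by simp
  have 9: "?m P43_21 A31 = ?g D0" using ncp_mul_shift[of A21 A43 P43_21 A31 T431] 8 by simp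
  have 10: "?m A31 P41_32 = ?g D0" using ncp_mul_shift[of A31 A32 T321 A41 P41_32] 5 by simp
  have 11: "?m T431 A32 = ?g D0" using ncp_mul_shift[of A31 A41 T431 A32 P41_32] 10 by simp
  show ?thesis by (cases s) (simp_all only: ncp_cmp.simps one 0 1 2 3 4 5 6 7 8 9 10 11)
qed

interpretation bp: germ_presentation UNIV ncp_mul E0 D0 ncp_cmp ncp_meet 4
    bkl_atoms bkl_relations "[(4, 3), (3, 2), (2, 1)]" ncp_rep ncp_at
proof
  show "length u = length v" if "(u, v) \<in> bkl_relations" for u v
    using that unfolding bkl_relations_eq by auto
  show "ncp_rep s \<in> lists bkl_atoms" for s by (rule ncp_rep_lists)
  show "bg.gprod ncp_at (ncp_rep s) = Some s" for s
    by (cases s) (simp_all add: ncp_at_def ncp_mul_def ncps_def)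
  show "bg.gprod ncp_at u = bg.gprod ncp_at v \<and> bg.gprod ncp_at u \<noteq> None" if "(u, v) \<in> bkl_relations" for u v
    using that unfolding bkl_relations_eq by (auto simp: ncp_at_def ncp_mul_def ncps_def)
  show "bw.gen (ncp_rep (ncp_at a)) = bw.gen [a]" if "a \<in> bkl_atoms" for a
    using that unfolding bkl_atoms_eq by (auto simp: ncp_at_def)
  show "bw.gen (ncp_rep s) \<otimes>\<^bsub>bw.G\<^esub> bw.gen (ncp_rep t) = bw.gen (ncp_rep x)" if mul: "ncp_mul s t = Some x" for s t x
  proof -
    interpret group bw.G by (rule bw.group_G)
    consider "s = E0" "x = t" | "t = E0" "x = s" | "t = ncp_cmp s" "x = D0" | "(s, t) \<in> set (factorizations x)"
      using mul find_SomeD unfolding ncp_mul_def by (metis option.inject)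
    then show ?thesis
      using ncp_rep_lists ncp_mul_cmp_gen ncp_mul_atoms by cases (simp_all add: bw.gen_Nil)
  qed
qed simp_all

abbreviation "BG \<equiv> dual_braid_group_4"

context
begin

interpretation bga: garside_group BG bw.len
  unfolding dual_braid_group_4_def by (rule bp.garside_group_G)

section \<open>Lengths and the cyclic order of atoms\<close>

definition ncp_len :: "ncp \<Rightarrow> nat" where "ncp_len s = length (ncp_rep s)"

definition ncp_rank :: "nat \<Rightarrow> ncp list" where
  "ncp_rank k = filter (\<lambda>s. ncp_len s = k) ncps"

lemma ncp_rank_iff: "s \<in> set (ncp_rank k) \<longleftrightarrow> ncp_len s = k"
  by (cases s) (auto simp: ncp_rank_def ncps_def)

lemma ncp_card_atoms: "list_all (\<lambda>r. length (filter (\<lambda>a. ncp_le a r) (ncp_rank 1)) \<le> 3) (ncp_rank 2)"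
  by code_simp

text \<open>Removes one quantifier from a nested check. Filtering each variable by the hypotheses
  already available keeps the enumeration small.\<close>

lemma ncp_rankD: "list_all P (filter Q (ncp_rank k)) \<Longrightarrow> ncp_len s = k \<Longrightarrow> Q s \<Longrightarrow> P s"
  by (simp add: list_all_iff ncp_rank_iff)

lemma ncp_cyclic:
  assumes "ncp_len r = 2" "ncp_len a = 1" "ncp_len b = 1" "ncp_len c = 1"
    "ncp_le a r" "ncp_le b r \<and> b \<noteq> a" "ncp_le c r \<and> c \<noteq> a \<and> c \<noteq> b"
  shows "ncp_mul a b = Some r \<or> ncp_mul a c = Some r"
proof -
  have "list_all (\<lambda>r. list_all (\<lambda>a. list_all (\<lambda>b. list_all (\<lambda>c. ncp_mul a b = Some r \<or> ncp_mul a c = Some r)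
      (filter (\<lambda>c. ncp_le c r \<and> c \<noteq> a \<and> c \<noteq> b) (ncp_rank 1)))
      (filter (\<lambda>b. ncp_le b r \<and> b \<noteq> a) (ncp_rank 1)))
      (filter (\<lambda>a. ncp_le a r) (ncp_rank 1))) (filter (\<lambda>r. True) (ncp_rank 2))"
    by code_simp
  note 1 = ncp_rankD[OF this assms(1) TrueI]
  note 2 = ncp_rankD[OF 1 assms(2,5)]
  note 3 = ncp_rankD[OF 2 assms(3,6)]
  show ?thesis by (rule ncp_rankD[OF 3 assms(4,7)])
qed

text \<open>Here r is a triangle and y joins the fourth point to one of its vertices. Elements s, t
  and u of length 2 exist only when y crosses no side of r.\<close>

lemma ncp_cyclic_shift:
  assumes "ncp_len r = 2" "ncp_len a = 1" "ncp_len b = 1" "ncp_len c = 1" "ncp_len y = 1"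
    "ncp_len s = 2" "ncp_len t = 2" "ncp_len u = 2"
    "ncp_le a r" "ncp_le b r \<and> b \<noteq> a \<and> ncp_mul a b = Some r" "ncp_le c r \<and> c \<noteq> a \<and> c \<noteq> b"
    "\<not> ncp_le y r" "ncp_le y s \<and> ncp_le a s" "ncp_le y t \<and> ncp_le b t" "ncp_le y u \<and> ncp_le c u"
  shows "ncp_mul y (ncp_cmp s) = Some t"
proof -
  have "list_all (\<lambda>r. list_all (\<lambda>a. list_all (\<lambda>b. list_all (\<lambda>c. list_all (\<lambda>y.
      list_all (\<lambda>s. list_all (\<lambda>t. list_all (\<lambda>u. ncp_mul y (ncp_cmp s) = Some t)
      (filter (\<lambda>u. ncp_le y u \<and> ncp_le c u) (ncp_rank 2)))
      (filter (\<lambda>t. ncp_le y t \<and> ncp_le b t) (ncp_rank 2)))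
      (filter (\<lambda>s. ncp_le y s \<and> ncp_le a s) (ncp_rank 2)))
      (filter (\<lambda>y. \<not> ncp_le y r) (ncp_rank 1)))
      (filter (\<lambda>c. ncp_le c r \<and> c \<noteq> a \<and> c \<noteq> b) (ncp_rank 1)))
      (filter (\<lambda>b. ncp_le b r \<and> b \<noteq> a \<and> ncp_mul a b = Some r) (ncp_rank 1)))
      (filter (\<lambda>a. ncp_le a r) (ncp_rank 1))) (filter (\<lambda>r. True) (ncp_rank 2))"
    by code_simp
  note 1 = ncp_rankD[OF this assms(1) TrueI]
  note 2 = ncp_rankD[OF 1 assms(2,9)]
  note 3 = ncp_rankD[OF 2 assms(3,10)]
  note 4 = ncp_rankD[OF 3 assms(4,11)]
  note 5 = ncp_rankD[OF 4 assms(5,12)]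
  note 6 = ncp_rankD[OF 5 assms(6,13)]
  note 7 = ncp_rankD[OF 6 assms(7,14)]
  show ?thesis by (rule ncp_rankD[OF 7 assms(8,15)])
qed

lemma dual_braid_simples:
  "u \<in> simples BG \<longleftrightarrow> (\<exists>s. u = bp.elt s)"
  unfolding dual_braid_group_4_def bp.simples_G by blast

lemma dual_braid_le:
  "inv\<^bsub>BG\<^esub> bp.elt s \<otimes>\<^bsub>BG\<^esub> bp.elt t \<in> positive BG \<longleftrightarrow> ncp_le s t"
  unfolding dual_braid_group_4_def ncp_le_iff using bp.elt_le_iff[of s t] by (simp add: bg.le_def)

lemma dual_braid_mul:
  "bp.elt s \<otimes>\<^bsub>BG\<^esub> bp.elt t = bp.elt r" if "ncp_mul s t = Some r"
  unfolding dual_braid_group_4_def using bp.elt_mul[of s t r] that by simp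

lemma dual_braid_len: "bw.len (bp.elt s) = int (ncp_len s)"
  using bp.len_elt[of s] by (simp add: ncp_len_def)

lemma dual_braid_inj: "bp.elt s = bp.elt t \<longleftrightarrow> s = t"
  using bp.elt_inj[of s t] by auto

lemma dual_braid_Delta: "\<Delta>\<^bsub>BG\<^esub> = bp.elt D0"
  unfolding dual_braid_group_4_def by (rule bp.elt_dl[symmetric])

lemma dual_braid_carrier: "bp.elt s \<in> carrier BG"
  unfolding dual_braid_group_4_def by simp

lemma garside_rank3_dual_braid: "garside_rank3 BG bw.len"
proof
  show "bw.len \<Delta>\<^bsub>BG\<^esub> = 3"
    by (simp add: dual_braid_Delta dual_braid_len ncp_len_def)
  have UN: "s \<in> set ncps" for s by (cases s) (simp_all add: ncps_def)
  have "simples BG \<subseteq> bp.elt ` set ncps" using dual_braid_simples UN by blast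
  then show "finite (simples BG)" by (rule finite_subset) simp
  note iffs = dual_braid_le dual_braid_len dual_braid_inj
  show "card {a \<in> simples BG. bw.len a = 1 \<and>
      inv\<^bsub>BG\<^esub> a \<otimes>\<^bsub>BG\<^esub> r \<in> positive BG} \<le> 3"
    if R: "r \<in> simples BG" "bw.len r = 2" for r
  proof -
    obtain r' where r: "r = bp.elt r'" using R dual_braid_simples by blast
    let ?as = "filter (\<lambda>a. ncp_le a r') (ncp_rank 1)"
    have "ncp_len r' = 2" using r R(2) by (simp add: iffs)
    then have "r' \<in> set (ncp_rank 2)" unfolding ncp_rank_iff .
    with ncp_card_atoms[unfolded list_all_iff] have "length ?as \<le> 3" by (rule bspec)
    moreover have "{a \<in> simples BG. bw.len a = 1 \<and>
        inv\<^bsub>BG\<^esub> a \<otimes>\<^bsub>BG\<^esub> r \<in> positive BG} \<subseteq> bp.elt ` set ?as"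
    proof
      fix a assume a: "a \<in> {a \<in> simples BG. bw.len a = 1 \<and>
        inv\<^bsub>BG\<^esub> a \<otimes>\<^bsub>BG\<^esub> r \<in> positive BG}"
      then obtain a' where a': "a = bp.elt a'" using dual_braid_simples by blast
      then have "ncp_len a' = 1" "ncp_le a' r'" using a r by (simp_all add: iffs)
      then show "a \<in> bp.elt ` set ?as" unfolding a' set_filter ncp_rank_iff by blast
    qed
    ultimately show ?thesis
      by (meson surj_card_le card_length finite_set le_trans)
  qed
  show "a \<otimes>\<^bsub>BG\<^esub> b = r \<or> a \<otimes>\<^bsub>BG\<^esub> c = r"
    if s: "{r, a, b, c} \<subseteq> simples BG" and h: "bw.len r = 2" "bw.len a = 1" "bw.len b = 1" "bw.len c = 1"
      "{inv\<^bsub>BG\<^esub> a \<otimes>\<^bsub>BG\<^esub> r, inv\<^bsub>BG\<^esub> b \<otimes>\<^bsub>BG\<^esub> r,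
        inv\<^bsub>BG\<^esub> c \<otimes>\<^bsub>BG\<^esub> r} \<subseteq> positive BG"
      "a \<noteq> b" "a \<noteq> c" "b \<noteq> c" for r a b c
  proof -
    obtain r' a' b' c' where e: "r = bp.elt r'" "a = bp.elt a'" "b = bp.elt b'" "c = bp.elt c'"
      using s unfolding insert_subset dual_braid_simples by blast
    have "ncp_mul a' b' = Some r' \<or> ncp_mul a' c' = Some r'"
    proof (rule ncp_cyclic)
      show "ncp_len r' = 2" "ncp_len a' = 1" "ncp_len b' = 1" "ncp_len c' = 1"
        using h(1-4) unfolding e dual_braid_len by linarith+
      show "ncp_le a' r'" "ncp_le b' r' \<and> b' \<noteq> a'" "ncp_le c' r' \<and> c' \<noteq> a' \<and> c' \<noteq> b'"
        using h(5-8) unfolding e insert_subset dual_braid_le dual_braid_inj by blast+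
    qed
    then show ?thesis unfolding e using dual_braid_mul by blast
  qed
  show "y \<otimes>\<^bsub>BG\<^esub> inv\<^bsub>BG\<^esub> s \<otimes>\<^bsub>BG\<^esub> \<Delta>\<^bsub>BG\<^esub> = t"
    if S: "{r, a, b, c, y, s, t, u} \<subseteq> simples BG"
      and h: "bw.len r = 2" "bw.len a = 1" "bw.len b = 1" "bw.len c = 1"
      "{inv\<^bsub>BG\<^esub> a \<otimes>\<^bsub>BG\<^esub> r, inv\<^bsub>BG\<^esub> b \<otimes>\<^bsub>BG\<^esub> r,
        inv\<^bsub>BG\<^esub> c \<otimes>\<^bsub>BG\<^esub> r} \<subseteq> positive BG"
      "a \<noteq> b" "a \<noteq> c" "b \<noteq> c" and ab: "a \<otimes>\<^bsub>BG\<^esub> b = r"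
      and h': "bw.len y = 1" "inv\<^bsub>BG\<^esub> y \<otimes>\<^bsub>BG\<^esub> r \<notin> positive BG"
      "bw.len s = 2" "bw.len t = 2" "bw.len u = 2"
      "{inv\<^bsub>BG\<^esub> y \<otimes>\<^bsub>BG\<^esub> s, inv\<^bsub>BG\<^esub> y \<otimes>\<^bsub>BG\<^esub> t,
        inv\<^bsub>BG\<^esub> y \<otimes>\<^bsub>BG\<^esub> u, inv\<^bsub>BG\<^esub> a \<otimes>\<^bsub>BG\<^esub> s,
        inv\<^bsub>BG\<^esub> b \<otimes>\<^bsub>BG\<^esub> t, inv\<^bsub>BG\<^esub> c \<otimes>\<^bsub>BG\<^esub> u}
        \<subseteq> positive BG" for r a b c y s t u
  proof -
    obtain r' a' b' c' where e: "r = bp.elt r'" "a = bp.elt a'" "b = bp.elt b'" "c = bp.elt c'"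
      using S unfolding insert_subset dual_braid_simples by blast
    obtain y' s' t' u' where f: "y = bp.elt y'" "s = bp.elt s'" "t = bp.elt t'" "u = bp.elt u'"
      using S unfolding insert_subset dual_braid_simples by blast
    have le: "ncp_le a' r'" "ncp_le b' r'" "ncp_le c' r'" "\<not> ncp_le y' r'"
      "ncp_le y' s'" "ncp_le y' t'" "ncp_le y' u'" "ncp_le a' s'" "ncp_le b' t'" "ncp_le c' u'"
      using h(5) h'(2,6) unfolding e f insert_subset dual_braid_le by blast+
    have len: "ncp_len r' = 2" "ncp_len a' = 1" "ncp_len b' = 1" "ncp_len c' = 1" "ncp_len y' = 1"
      "ncp_len s' = 2" "ncp_len t' = 2" "ncp_len u' = 2"
      using h(1-4) h'(1,3-5) unfolding e f dual_braid_len by linarith+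
    have ne: "a' \<noteq> b'" "a' \<noteq> c'" "b' \<noteq> c'" using h(6-8) e by blast+
    \<comment> \<open>The equation a b = r holds in the group; cancelling a against a factorization
      in the germ brings it back to the germ.\<close>
    obtain v where v: "ncp_mul a' v = Some r'" using le(1) unfolding ncp_le_iff by blast
    then have "bp.elt a' \<otimes>\<^bsub>BG\<^esub> bp.elt v = bp.elt a' \<otimes>\<^bsub>BG\<^esub> bp.elt b'"
      using dual_braid_mul[OF v] ab e by simp
    then have "v = b'" using dual_braid_carrier dual_braid_inj by simp
    then have ab': "ncp_mul a' b' = Some r'" using v by simp
    have "ncp_mul y' (ncp_cmp s') = Some t'"
      using le len ne ab' by (intro ncp_cyclic_shift[of r' a' b' c' y' s' t' u']) simp_all
    then have t: "bp.elt y' \<otimes>\<^bsub>BG\<^esub> bp.elt (ncp_cmp s') = t" using dual_braid_mul f by simp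
    have "bp.elt s' \<otimes>\<^bsub>BG\<^esub> bp.elt (ncp_cmp s') = \<Delta>\<^bsub>BG\<^esub>"
      using dual_braid_mul[OF ncp_mul_cmp] by (simp add: dual_braid_Delta)
    then have "bp.elt (ncp_cmp s') = inv\<^bsub>BG\<^esub> bp.elt s' \<otimes>\<^bsub>BG\<^esub> \<Delta>\<^bsub>BG\<^esub>"
      using dual_braid_carrier by (metis bga.inv_solve_left bga.Delta_carrier)
    then show ?thesis using t f dual_braid_carrier by (simp add: bga.m_assoc)
  qed
qed

interpretation b3: garside_rank3 BG bw.len
  by (rule garside_rank3_dual_braid)

lemma dual_braid_periodic:
  assumes "rigid BG x"
  shows "periodic 6 (\<lambda>n. card (SC BG (x [^]\<^bsub>BG\<^esub> n)))"
proof (rule bga.card_SC_periodic[OF assms])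
  have x: "x \<in> carrier BG" using assms by (simp add: rigid_def)
  show "bga.V (x [^]\<^bsub>BG\<^esub> n) (int n * p) (int n * q) \<subseteq>
      bga.V (x [^]\<^bsub>BG\<^esub> (6::nat)) (int 6 * p) (int 6 * q)"
    if "p < q" "\<one>\<^bsub>BG\<^esub> \<in> bga.V x p q" "\<And>k. x \<noteq> bga.D k" "1 \<le> n" for p q and n :: nat
    using b3.V_pow_subset_rank3[OF x that] .
qed simp

end

theorem theorem1p11:
  shows "(\<forall>m l :: nat. m \<ge> 1 \<and> l \<ge> 1 \<longrightarrow>
      (\<forall>x. rigid (circular_group m l) x \<longrightarrow>
         periodic 1 (\<lambda>n. card (SC (circular_group m l) (x [^]\<^bsub>circular_group m l\<^esub> n)))) \<and>
      (\<forall>y\<in>carrier (circular_group m l).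
         (\<exists>z. rigid (circular_group m l) z \<and> conjugate (circular_group m l) y z) \<and>
         (\<exists>k::nat. k \<ge> 1 \<and> rigid (circular_group m l) (y [^]\<^bsub>circular_group m l\<^esub> k))
         \<longrightarrow> rigid_exponent (circular_group m l) y \<le> m div gcd m l))
    \<and>
    (\<forall>x. rigid dual_braid_group_4 x \<longrightarrow>
      (\<exists>r \<in> {1..Lcm {1..27::nat}}.
         periodic r (\<lambda>n. card (SC dual_braid_group_4 (x [^]\<^bsub>dual_braid_group_4\<^esub> n)))))"
proof -
  have "6 dvd Lcm {1..27::nat}" by (rule dvd_Lcm) simp
  moreover have "Lcm {1..27::nat} \<noteq> 0" by (simp add: Lcm_0_iff)
  ultimately have "6 \<in> {1..Lcm {1..27::nat}}" using dvd_imp_le by fastforce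
  then show ?thesis
    using circular_periodic circular_rigid_exponent dual_braid_periodic by blast
qed

end
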